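(* Let $(W,S)$ be a Coxeter system of rank $N$, where $W$ is a finite irreducible Coxeter group, and let $\widehat R_{W,S}$ and $\widehat{\widetilde R}_{W,S}$ be the associated $\mathbb{Q}$-algebras (defined in the context). Then there are the following unital ring isomorphisms: $$\widehat R_{W,S}\cong\begin{cases} M_N(\mathbb{Q}) & \text{if } (W,S) \text{ is of type } A_n\,(n\ge1),\ B_n\,(n\ge2),\ D_n\,(n\ge4),\ E_6,\ E_7,\ E_8,\ F_4 \text{ or } G_2,\\ M_N(\mathbb{Q}_5) & \text{if } (W,S) \text{ is of type } H_3 \text{ or } H_4,\\ M_2(\mathbb{Q}_n) & \text{if } (W,S) \text{ is of type } I_2(n),\ n\ge5,\ n\ne6,\end{cases}$$ and $$\widehat{\widetilde R}_{W,S}\cong\begin{cases} M_N(\mathbb{Q}) & \text{if } (W,S) \text{ is of type } A_n\,(n\ge1),\ D_n\,(n\ge4),\ E_6,\ E_7 \text{ or } E_8,\\ M_N(\mathbb{Q}_5) & \text{if } (W,S) \text{ is of type } H_3 \text{ or } H_4,\\ M_2(L_n) & \text{if } (W,S) \text{ is of type } I_2(n),\ n\ge5,\ n \text{ odd},\\ M_2(L_n)\oplus\mathbb{Q}\oplus\mathbb{Q} & \text{if } (W,S) \text{ is of type } I_2(n),\ n\ge6,\ n \text{ even},\\ M_n(\mathbb{Q})\oplus M_{n-1}(\mathbb{Q})\oplus\mathbb{Q} & \text{if } (W,S) \text{ is of type } B_n,\ n\ge2,\\ M_4(\mathbb{Q})\oplus M_2(\mathbb{Q})\oplus M_2(\mathbb{Q})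 & \text{if } (W,S) \text{ is of type } F_4.\end{cases}$$
   Context: **Graphs and path algebras.** A graph $\Gamma=(S,Y)$ (in the sense of Serre) consists of a vertex set $S$, an edge set $Y$, a map $Y\to S\times S$, $y\mapsto(o(y),t(y))$ (origin and terminus), and a map $Y\to Y$, $y\mapsto\bar y$, with $\bar{\bar y}=y$, $\bar y\ne y$ and $o(y)=t(\bar y)$. A path of length $k\ge1$ is a sequence of edges $y_1\cdots y_k$ with $t(y_i)=o(y_{i+1})$ for $1 \le i \le k-1$; paths of length $0$ are the vertices, written $[s]$, $s\in S$, with $o([s])=t([s])=s$. For a commutative ring $A$ with identity, the path algebra $A\Gamma$ is the associative $A$-algebra with $A$-basis the set of all paths, with multiplication given by concatenation: $pq$ is the concatenated path if the terminus of $p$ equals the origin of $q$, and $pq=0$ otherwise. The $[s]$ are orthogonal idempotents, and for finite $S$ the identity is $\sum_{s\in S}[s]$. **Polynomials.** For $n\ge3$, $C_n(t)\in\mathbb{Z}[t]$ is the minimal polynomial of $4\cos^2(\pi/n)$ over $\mathbb{Q}$, and $c_n(t)=\prod_{N\ge3,\;N\mid n}C_N(t)$. Put $\mathbb{Q}_n=\mathbb{Q}[t]/\langle C_n(t)\rangle$, the field extension $\mathbb{Q}(4\cos^2(\pi/n))$ of $\mathbb{Q}$, and $L_n=\mathbb{Q}[t]/\langle c_n(t)\rangle$; equivalently $L_n\cong\bigoplus_{N\ge3,\;N\mid n}\mathbb{Q}_N$, a direct product of fields. **The algebras.** For a Coxeter system $(W,S)$ of finite rank with $S=\{s_i\}_{1\le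 i\le N}$ and Coxeter matrix $(m_{ij})$, the graph $\Gamma_{W,S}$ has vertex set $S$ and edges $y_{ij}$ for all $i\ne j$ with $m_{ij}\ge3$, where $o(y_{ij})=s_i$, $t(y_{ij})=s_j$, $\overline{y_{ij}}=y_{ji}$. Let $P_{W,S}=\mathbb{Z}\Gamma_{W,S}$. For a polynomial $f$, $f(y_{ji}y_{ij})$ denotes evaluation of $f$ at $y_{ji}y_{ij}$ in the ring $[s_j]P_{W,S}[s_j]$, whose identity is $[s_j]$ (so the constant term is multiplied by $[s_j]$). Let $I_{W,S}$ be the two-sided ideal of $P_{W,S}$ generated by the elements $C_{m_{ij}}(y_{ji}y_{ij})$ for all $(i,j)$ with $2<m_{ij}<\infty$. Let $\widetilde I_{W,S}$ be the two-sided ideal generated by the elements $c_{m_{ij}}(y_{ji}y_{ij})$ for all $(i,j)$ with $2<m_{ij}<\infty$, $m_{ij}$ odd, together with the elements $y_{ij}\,c_{m_{ij}}(y_{ji}y_{ij})$ for all $(i,j)$ with $2<m_{ij}<\infty$, $m_{ij}$ even. Set $R_{W,S}=P_{W,S}/I_{W,S}$, $\widetilde R_{W,S}=P_{W,S}/\widetilde I_{W,S}$, $\widehat R_{W,S}=R_{W,S}\otimes_{\mathbb{Z}}\mathbb{Q}$ and $\widehat{\widetilde R}_{W,S}=\widetilde R_{W,S}\otimes_{\mathbb{Z}}\mathbb{Q}$. **Types.** The Coxeter graphs of the finite irreducible Coxeter groups are as follows (an edge joins $s_i$ and $s_j$ when $m_{ij}\ge3$; unlabelled edges have $m_{ij}=3$;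 non-adjacent distinct vertices have $m_{ij}=2$; the subscript is the number of vertices $N$). $A_n$: a path with $n$ vertices, all edges unlabelled. $B_n$: a path with $n$ vertices with one end edge labelled $4$ and the others unlabelled. $D_n$: a path $s_1,\dots,s_{n-1}$ together with a vertex $s_n$ joined to $s_{n-2}$, all edges unlabelled. $E_n$ ($n=6,7,8$): a path $s_1,s_3,s_4,\dots,s_n$ together with a vertex $s_2$ joined to $s_4$, all edges unlabelled. $F_4$: a path with $4$ vertices and successive edge entries $3,4,3$. $G_2=I_2(6)$. $H_3$, $H_4$: a path with $3$ (resp. $4$) vertices with one end edge labelled $5$ and the others unlabelled. $I_2(n)$: two vertices joined by an edge labelled $n$. *)

theory Defs
  imports
    Complex_Main
    "HOL-Computational_Algebra.Polynomial"
    "HOL-Library.Poly_Mapping"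
    "HOL-Algebra.Algebra"
    "HOL-Algebra.Algebraic_Closure_Type"
    "Graph_Theory.Arc_Walk"
    "Graph_Theory.Bidirected_Digraph"
    "Jordan_Normal_Form.Matrix"
begin

section \<open>Algebras with a multiplicative basis\<close>

text \<open>
  The free module over \<open>'a\<close> on the set \<open>B\<close> (finitely supported functions), with the bilinear
  product that extends a partial product \<open>m\<close> on \<open>B\<close>; the product of two basis elements is
  \<open>0\<close> where \<open>m\<close> is undefined. Path algebras and monoid rings are both of this form.
\<close>

definition basis_algebra ::
  "'b set \<Rightarrow> ('b \<Rightarrow> 'b \<Rightarrow> 'b option) \<Rightarrow> ('b \<Rightarrow>\<^sub>0 'a) \<Rightarrow> ('b \<Rightarrow>\<^sub>0 'a::comm_ring_1) ring" where
  "basis_algebra B m e = \<lparr>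
     carrier = {f. Poly_Mapping.keys f \<subseteq> B},
     monoid.mult = (\<lambda>f g. \<Sum>p\<in>Poly_Mapping.keys f. \<Sum>q\<in>Poly_Mapping.keys g.
        (case m p q of
           None \<Rightarrow> 0
         | Some r \<Rightarrow> Poly_Mapping.single r (Poly_Mapping.lookup f p * Poly_Mapping.lookup g q))),
     one = e,
     ring.zero = 0,
     add = (+)\<rparr>"


section \<open>Path algebras\<close>

text \<open>
  A graph in the sense of Serre is a \<^locale>\<open>bidirected_digraph\<close>. A path is encoded as its origin
  together with its list of edges, so \<open>(s, [])\<close> is the path \<open>[s]\<close> of length \<open>0\<close>, and
  \<open>y\<^sub>1 \<dots> y\<^sub>k\<close> with \<open>k \<ge> 1\<close> is \<open>(o(y\<^sub>1), [y\<^sub>1, \<dots>, y\<^sub>k])\<close>.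
\<close>

type_synonym ('v, 'e) path = "'v \<times> 'e list"

definition graph_paths :: "('v, 'e) pre_digraph \<Rightarrow> ('v, 'e) path set" where
  "graph_paths G = {(u, p). \<exists>v. pre_digraph.awalk G u p v}"

fun path_concat ::
  "('v, 'e) pre_digraph \<Rightarrow> ('v, 'e) path \<Rightarrow> ('v, 'e) path \<Rightarrow> ('v, 'e) path option" where
  "path_concat G (u, p) (v, q) =
     (if pre_digraph.awlast G u p = v then Some (u, p @ q) else None)"

abbreviation vertex_path :: "'v \<Rightarrow> (('v, 'e) path \<Rightarrow>\<^sub>0 'a::comm_ring_1)" where
  "vertex_path s \<equiv> Poly_Mapping.single (s, []) 1"

abbreviation edge_path :: "('v, 'e) pre_digraph \<Rightarrow> 'e \<Rightarrow> (('v, 'e) path \<Rightarrow>\<^sub>0 'a::comm_ring_1)" where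
  "edge_path G y \<equiv> Poly_Mapping.single (tail G y, [y]) 1"

text \<open>The coefficient ring is the type \<open>'a\<close>. The unit is meaningful for finite vertex sets only.\<close>

definition path_algebra ::
  "('v, 'e) pre_digraph \<Rightarrow> (('v, 'e) path \<Rightarrow>\<^sub>0 'a::comm_ring_1) ring" where
  "path_algebra G = basis_algebra (graph_paths G) (path_concat G) (\<Sum>s\<in>verts G. vertex_path s)"


section \<open>General ring constructions\<close>

text \<open>The corner ring \<open>eRe\<close> of an idempotent \<open>e\<close>.\<close>

definition corner :: "'r ring \<Rightarrow> 'r \<Rightarrow> 'r ring" where
  "corner R e = R\<lparr>carrier := {e \<otimes>\<^bsub>R\<^esub> x \<otimes>\<^bsub>R\<^esub> e | x. x \<in> carrier R}, one := e\<rparr>"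

definition int_poly_eval :: "'r ring \<Rightarrow> int poly \<Rightarrow> 'r \<Rightarrow> 'r" where
  "int_poly_eval R f x =
     (\<Oplus>\<^bsub>R\<^esub>k\<in>{..degree f}. [Polynomial.coeff f k] \<cdot>\<^bsub>R\<^esub> (x [^]\<^bsub>R\<^esub> k))"

text \<open>
  The tensor product of rings over \<open>\<int>\<close>: the free abelian group on \<open>R \<times> S\<close>, with the
  multiplication \<open>(a, b) (c, d) = (ac, bd)\<close>, modulo the biadditivity relations. Multiplying such a
  relation by some \<open>(c, d)\<close> gives another one, so the ideal they generate is just the subgroup they
  generate; the relation \<open>(za, b) = (a, zb)\<close> for an integer \<open>z\<close> follows from biadditivity.
\<close>

definition tensor_relations :: "'r ring \<Rightarrow> 's ring \<Rightarrow> ('r \<times> 's \<Rightarrow>\<^sub>0 int) set" where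
  "tensor_relations R S =
     {Poly_Mapping.single (a \<oplus>\<^bsub>R\<^esub> a', b) 1
        - Poly_Mapping.single (a, b) 1 - Poly_Mapping.single (a', b) 1 | a a' b.
        a \<in> carrier R \<and> a' \<in> carrier R \<and> b \<in> carrier S} \<union>
     {Poly_Mapping.single (a, b \<oplus>\<^bsub>S\<^esub> b') 1
        - Poly_Mapping.single (a, b) 1 - Poly_Mapping.single (a, b') 1 | a b b'.
        a \<in> carrier R \<and> b \<in> carrier S \<and> b' \<in> carrier S}"

definition pair_monoid_ring :: "'r ring \<Rightarrow> 's ring \<Rightarrow> ('r \<times> 's \<Rightarrow>\<^sub>0 int) ring" where
  "pair_monoid_ring R S =
     basis_algebra (carrier R \<times> carrier S)
       (\<lambda>p q. Some (fst p \<otimes>\<^bsub>R\<^esub> fst q, snd p \<otimes>\<^bsub>S\<^esub> snd q))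
       (Poly_Mapping.single (\<one>\<^bsub>R\<^esub>, \<one>\<^bsub>S\<^esub>) 1)"

definition tensor_ring :: "'r ring \<Rightarrow> 's ring \<Rightarrow> ('r \<times> 's \<Rightarrow>\<^sub>0 int) set ring" where
  "tensor_ring R S =
     pair_monoid_ring R S Quot Idl\<^bsub>pair_monoid_ring R S\<^esub> (tensor_relations R S)"

text \<open>
  The ring \<open>M\<^sub>n(R)\<close> over a ring given as a record; \<open>ring_mat\<close> only covers rings that are types.
\<close>

definition matrix_ring :: "nat \<Rightarrow> 'r ring \<Rightarrow> 'r mat ring" where
  "matrix_ring n R = \<lparr>
     carrier = {A \<in> carrier_mat n n. \<forall>i<n. \<forall>j<n. A $$ (i, j) \<in> carrier R},
     monoid.mult = (\<lambda>A B. mat n n (\<lambda>(i, j). \<Oplus>\<^bsub>R\<^esub>k\<in>{..<n}. A $$ (i, k) \<otimes>\<^bsub>R\<^esub> B $$ (k, j))),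
     one = mat n n (\<lambda>(i, j). if i = j then \<one>\<^bsub>R\<^esub> else \<zero>\<^bsub>R\<^esub>),
     ring.zero = mat n n (\<lambda>_. \<zero>\<^bsub>R\<^esub>),
     add = (\<lambda>A B. mat n n (\<lambda>ij. A $$ ij \<oplus>\<^bsub>R\<^esub> B $$ ij))\<rparr>"


section \<open>The polynomials and the coefficient rings\<close>

definition rat_min_poly :: "real \<Rightarrow> rat poly" where
  "rat_min_poly x = (THE p. lead_coeff p = 1 \<and> poly (map_poly of_rat p) x = 0 \<and>
     (\<forall>q. q \<noteq> 0 \<and> poly (map_poly of_rat q) x = 0 \<longrightarrow> degree p \<le> degree q))"

text \<open>
  \<open>4 cos\<^sup>2(\<pi>/n) = 2 + 2 cos(2\<pi>/n)\<close> is an algebraic integer, so its minimal polynomial over the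
  rationals has integer coefficients.
\<close>

definition C_poly :: "nat \<Rightarrow> int poly" where
  "C_poly n = (THE p. map_poly of_int p = rat_min_poly (4 * (cos (pi / real n))\<^sup>2))"

definition c_poly :: "nat \<Rightarrow> int poly" where
  "c_poly n = (\<Prod>N\<in>{N. 3 \<le> N \<and> N dvd n}. C_poly N)"

abbreviation Q_ring :: "rat ring" where
  "Q_ring \<equiv> ring_of_type_algebra"

abbreviation Qt_ring :: "rat poly ring" where
  "Qt_ring \<equiv> ring_of_type_algebra"

definition Qn_ring :: "nat \<Rightarrow> rat poly set ring" where
  "Qn_ring n = Qt_ring Quot PIdl\<^bsub>Qt_ring\<^esub> (map_poly of_int (C_poly n))"

definition Ln_ring :: "nat \<Rightarrow> rat poly set ring" where
  "Ln_ring n = Qt_ring Quot PIdl\<^bsub>Qt_ring\<^esub> (map_poly of_int (c_poly n))"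


section \<open>Coxeter systems\<close>

text \<open>The order is \<open>0\<close> for elements of infinite order, so here \<open>0\<close> encodes the entry \<open>\<infinity>\<close>.\<close>

definition coxeter_matrix :: "('w, 'x) monoid_scheme \<Rightarrow> 'w \<Rightarrow> 'w \<Rightarrow> nat" where
  "coxeter_matrix W s t = group.ord W (s \<otimes>\<^bsub>W\<^esub> t)"

definition coxeter_relation ::
  "('w, 'x) monoid_scheme \<Rightarrow> 'w set \<Rightarrow> ('w list \<times> 'w list) set" where
  "coxeter_relation W S =
     {(u @ concat (replicate (coxeter_matrix W s t) [s, t]) @ v, u @ v) | u v s t.
        u \<in> lists S \<and> v \<in> lists S \<and> s \<in> S \<and> t \<in> S}"

text \<open>
  \<open>W\<close> is presented by the generators \<open>S\<close> and the relations \<open>(st)\<^bsup>m(s,t)\<^esup> = 1\<close>. Since the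
  generators are involutions (the case \<open>s = t\<close> of the relations), words without inverses suffice.
\<close>

definition coxeter_system :: "('w, 'x) monoid_scheme \<Rightarrow> 'w set \<Rightarrow> bool" where
  "coxeter_system W S \<longleftrightarrow>
     group W \<and> S \<subseteq> carrier W \<and> generate W S = carrier W \<and>
     (\<forall>s\<in>S. group.ord W s = 2) \<and>
     (\<forall>w\<in>lists S. foldr (monoid.mult W) w \<one>\<^bsub>W\<^esub> = \<one>\<^bsub>W\<^esub> \<longrightarrow>
        (w, []) \<in> (coxeter_relation W S \<union> (coxeter_relation W S)\<inverse>)\<^sup>*)"

definition coxeter_irreducible :: "('w, 'x) monoid_scheme \<Rightarrow> 'w set \<Rightarrow> bool" where
  "coxeter_irreducible W S \<longleftrightarrow>
     S \<noteq> {} \<and>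
     \<not> (\<exists>S1 S2. S1 \<noteq> {} \<and> S2 \<noteq> {} \<and> S1 \<inter> S2 = {} \<and> S1 \<union> S2 = S \<and>
          (\<forall>s\<in>S1. \<forall>t\<in>S2. coxeter_matrix W s t = 2))"

text \<open>\<open>G\<^sub>2\<close> is \<open>I\<^sub>2(6)\<close>; in \<open>I\<^sub>2(n)\<close> the index is the label rather than the rank.\<close>

datatype coxeter_type =
  Type_A nat | Type_B nat | Type_D nat | Type_E nat | Type_F4 | Type_H nat | Type_I2 nat

abbreviation Type_G2 :: coxeter_type where
  "Type_G2 \<equiv> Type_I2 6"

fun type_rank :: "coxeter_type \<Rightarrow> nat" where
  "type_rank (Type_A n) = n"
| "type_rank (Type_B n) = n"
| "type_rank (Type_D n) = n"
| "type_rank (Type_E n) = n"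
| "type_rank Type_F4 = 4"
| "type_rank (Type_H n) = n"
| "type_rank (Type_I2 n) = 2"

text \<open>The entries of the Coxeter matrix of a type at \<open>(i, j)\<close> with \<open>1 \<le> i < j\<close>.\<close>

fun type_entry :: "coxeter_type \<Rightarrow> nat \<Rightarrow> nat \<Rightarrow> nat" where
  "type_entry (Type_A n) i j = (if j = i + 1 then 3 else 2)"
| "type_entry (Type_B n) i j = (if j = i + 1 then if j = n then 4 else 3 else 2)"
| "type_entry (Type_D n) i j = (if j = i + 1 \<and> j < n \<or> i + 2 = n \<and> j = n then 3 else 2)"
| "type_entry (Type_E n) i j =
     (if i = 1 \<and> j = 3 \<or> i = 2 \<and> j = 4 \<or> 3 \<le> i \<and> j = i + 1 then 3 else 2)"
| "type_entry Type_F4 i j = (if j = i + 1 then if i = 2 then 4 else 3 else 2)"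
| "type_entry (Type_H n) i j = (if j = i + 1 then if j = n then 5 else 3 else 2)"
| "type_entry (Type_I2 n) i j = n"

definition of_type :: "('w, 'x) monoid_scheme \<Rightarrow> 'w set \<Rightarrow> coxeter_type \<Rightarrow> bool" where
  "of_type W S T \<longleftrightarrow>
     (\<exists>s. bij_betw s {1..type_rank T} S \<and>
        (\<forall>i j. 1 \<le> i \<and> i < j \<and> j \<le> type_rank T \<longrightarrow>
           coxeter_matrix W (s i) (s j) = type_entry T i j))"


section \<open>The algebras of a Coxeter system\<close>

text \<open>
  The edge \<open>y\<^sub>s\<^sub>t\<close> is the pair \<open>(s, t)\<close>; its inverse edge is \<open>(t, s)\<close>. The entry \<open>0\<close> stands
  for \<open>\<infinity>\<close>, hence also gives an edge.
\<close>

definition coxeter_graph :: "('w, 'x) monoid_scheme \<Rightarrow> 'w set \<Rightarrow> ('w, 'w \<times> 'w) pre_digraph" where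
  "coxeter_graph W S = \<lparr>
     verts = S,
     arcs = {(s, t). s \<in> S \<and> t \<in> S \<and> s \<noteq> t \<and>
               (coxeter_matrix W s t = 0 \<or> 3 \<le> coxeter_matrix W s t)},
     tail = fst,
     head = snd\<rparr>"

lemma coxeter_graph_bidirected:
  assumes "group W" "S \<subseteq> carrier W" "\<And>s. s \<in> S \<Longrightarrow> group.ord W s = 2"
  shows "bidirected_digraph (coxeter_graph W S)
    (\<lambda>e. if e \<in> arcs (coxeter_graph W S) then prod.swap e else e)"
proof -
  interpret group W by fact
  have inv: "inv\<^bsub>W\<^esub> s = s" if "s \<in> S" for s
    using assms(2) assms(3)[OF that] that pow_ord_eq_1[of s] inv_equality[of s s] by (auto simp: numeral_2_eq_2)
  have sym: "coxeter_matrix W s t = coxeter_matrix W t s" if "s \<in> S" "t \<in> S" for s t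
  proof -
    have "t \<otimes>\<^bsub>W\<^esub> s = inv\<^bsub>W\<^esub> (s \<otimes>\<^bsub>W\<^esub> t)" using that assms(2) by (metis inv inv_mult_group subsetD)
    then show ?thesis unfolding coxeter_matrix_def using that assms(2) ord_inv[of "s \<otimes>\<^bsub>W\<^esub> t"] by (metis m_closed subsetD)
  qed
  then show ?thesis by unfold_locales (auto simp: coxeter_graph_def split: if_splits)
qed

definition P_ring ::
  "('w, 'x) monoid_scheme \<Rightarrow> 'w set \<Rightarrow> (('w, 'w \<times> 'w) path \<Rightarrow>\<^sub>0 int) ring" where
  "P_ring W S = path_algebra (coxeter_graph W S)"

abbreviation y_edge ::
  "('w, 'x) monoid_scheme \<Rightarrow> 'w set \<Rightarrow> 'w \<Rightarrow> 'w \<Rightarrow> (('w, 'w \<times> 'w) path \<Rightarrow>\<^sub>0 int)" where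
  "y_edge W S s t \<equiv> edge_path (coxeter_graph W S) (s, t)"

text \<open>\<open>f(y\<^sub>t\<^sub>s y\<^sub>s\<^sub>t)\<close>, evaluated in the corner ring \<open>[t] P [t]\<close>.\<close>

definition loop_eval ::
  "('w, 'x) monoid_scheme \<Rightarrow> 'w set \<Rightarrow> int poly \<Rightarrow> 'w \<Rightarrow> 'w \<Rightarrow> (('w, 'w \<times> 'w) path \<Rightarrow>\<^sub>0 int)" where
  "loop_eval W S f s t =
     int_poly_eval (corner (P_ring W S) (vertex_path t)) f
       (y_edge W S t s \<otimes>\<^bsub>P_ring W S\<^esub> y_edge W S s t)"

text \<open>Below, \<open>2 < m\<close> excludes \<open>m = \<infinity>\<close>, which is encoded as \<open>0\<close>.\<close>

definition I_ideal ::
  "('w, 'x) monoid_scheme \<Rightarrow> 'w set \<Rightarrow> (('w, 'w \<times> 'w) path \<Rightarrow>\<^sub>0 int) set" where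
  "I_ideal W S = Idl\<^bsub>P_ring W S\<^esub>
     {loop_eval W S (C_poly (coxeter_matrix W s t)) s t | s t.
        s \<in> S \<and> t \<in> S \<and> 2 < coxeter_matrix W s t}"

definition I_tilde_ideal ::
  "('w, 'x) monoid_scheme \<Rightarrow> 'w set \<Rightarrow> (('w, 'w \<times> 'w) path \<Rightarrow>\<^sub>0 int) set" where
  "I_tilde_ideal W S = Idl\<^bsub>P_ring W S\<^esub>
     ({loop_eval W S (c_poly (coxeter_matrix W s t)) s t | s t.
         s \<in> S \<and> t \<in> S \<and> 2 < coxeter_matrix W s t \<and> odd (coxeter_matrix W s t)} \<union>
      {y_edge W S s t \<otimes>\<^bsub>P_ring W S\<^esub> loop_eval W S (c_poly (coxeter_matrix W s t)) s t | s t.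
         s \<in> S \<and> t \<in> S \<and> 2 < coxeter_matrix W s t \<and> even (coxeter_matrix W s t)})"

definition R_ring ::
  "('w, 'x) monoid_scheme \<Rightarrow> 'w set \<Rightarrow> (('w, 'w \<times> 'w) path \<Rightarrow>\<^sub>0 int) set ring" where
  "R_ring W S = P_ring W S Quot I_ideal W S"

definition R_tilde_ring ::
  "('w, 'x) monoid_scheme \<Rightarrow> 'w set \<Rightarrow> (('w, 'w \<times> 'w) path \<Rightarrow>\<^sub>0 int) set ring" where
  "R_tilde_ring W S = P_ring W S Quot I_tilde_ideal W S"

definition R_hat ::
  "('w, 'x) monoid_scheme \<Rightarrow> 'w set \<Rightarrow>
     ((('w, 'w \<times> 'w) path \<Rightarrow>\<^sub>0 int) set \<times> rat \<Rightarrow>\<^sub>0 int) set ring" where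
  "R_hat W S = tensor_ring (R_ring W S) Q_ring"

definition R_tilde_hat ::
  "('w, 'x) monoid_scheme \<Rightarrow> 'w set \<Rightarrow>
     ((('w, 'w \<times> 'w) path \<Rightarrow>\<^sub>0 int) set \<times> rat \<Rightarrow>\<^sub>0 int) set ring" where
  "R_tilde_hat W S = tensor_ring (R_tilde_ring W S) Q_ring"

end

theory Submission
  imports Defs
begin

text \<open>
  Except in rank one, each of the graphs is a tree in which all edges but one, \<open>{a, b}\<close>, carry the
  label \<open>3\<close>. Since \<open>C\<^sub>3 = t - 1\<close>, the two arcs of an edge labelled \<open>3\<close> are inverse to each other
  modulo the ideal, so there a path is determined by its end points and by the number \<open>k\<close> of its
  arcs from \<open>b\<close> to \<open>a\<close>. Sending the path to \<open>t\<^sup>k\<close> times a matrix unit represents the path algebra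
  by the matrices over \<open>\<int>[t]\<close> whose entries from the component of \<open>b\<close> to that of \<open>a\<close> are divisible
  by \<open>t\<close>. The relation at \<open>{a, b}\<close> with polynomial \<open>f\<close> makes every entry vanish that is divisible
  by \<open>f\<close>; for even labels of the second algebra it does so only for paths that cross the edge, and
  then an entry within one component also remembers its value at \<open>t = 0\<close>, which accounts for the
  two additional matrix blocks. As \<open>f\<close> is monic, the ideal is exactly the kernel of this
  representation, and as \<open>f(0) \<noteq> 0\<close>, its image spans the matrices over \<open>\<rat>[t]/(f)\<close> (and
  the additional blocks) over the rationals.
\<close>

text \<open>Everything before the tensor product is integral, while the answers are rational. The
  bridge is a criterion: if \<open>R\<close> embeds in a rational algebra \<open>T\<close> and every
  element of \<open>T\<close> has a positive integer multiple in the image, then \<open>T\<close> is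
  \<open>R\<close> tensored with the rationals. So what is needed is the kernel of one map out of
  the path algebra, and its image only up to denominators. The kernel must be found in \<int>[t]
  although the target is rational; Gauss's lemma for the monic f closes this gap. That the minimal
  polynomials are integral is itself derived, from Chebyshev polynomials. Next, f(0) \<noteq> 0
  because 4 cos^2(pi/n) > 0 for n \<ge> 3. So t and f are coprime over the rationals, and an entry
  can be prescribed modulo f together with its constant term: this reconciles the forced
  divisibility by t with an arbitrary target, and makes the blocks at t = 0 independent of the block
  modulo f. In a simply laced tree an arbitrary edge serves as \<open>{a, b}\<close>, with f = t -
  1. Rank one has no edge and is treated directly.\<close>

lemma finsum_ab_group_add:
  fixes R :: "('a::ab_group_add, 'm) ring_scheme"
  assumes "ring R" "add R = (+)" "ring.zero R = 0" "f \<in> A \<rightarrow> carrier R"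
  shows "finsum R f A = sum f A"
proof (cases "finite A")
  case True
  interpret ring R by fact
  from True assms(4) show ?thesis
    by (induction A rule: finite_induct) (auto simp: assms(2,3))
next
  case False
  interpret ring R by fact
  show ?thesis using False assms by (simp add: finsum_infinite)
qed

section \<open>Algebras with a multiplicative basis\<close>

text \<open>The product of \<open>basis_algebra\<close> detached from its record: it is bilinear on
  all finitely supported functions, so the computations can be done without carrier
  conditions.\<close>

definition basis_mult :: "('b \<Rightarrow> 'b \<Rightarrow> 'b option) \<Rightarrow> ('b \<Rightarrow>\<^sub>0 'a) \<Rightarrow> ('b \<Rightarrow>\<^sub>0 'a) \<Rightarrow> ('b \<Rightarrow>\<^sub>0 'a::comm_ring_1)"
  where "basis_mult m f g = (\<Sum>p\<in>Poly_Mapping.keys f. \<Sum>q\<in>Poly_Mapping.keys g.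
        (case m p q of None \<Rightarrow> 0
         | Some r \<Rightarrow> Poly_Mapping.single r (Poly_Mapping.lookup f p * Poly_Mapping.lookup g q)))"

lemma basis_algebra_sel [simp]:
  "carrier (basis_algebra B m e) = {f. Poly_Mapping.keys f \<subseteq> B}"
  "monoid.mult (basis_algebra B m e) = basis_mult m"
  "one (basis_algebra B m e) = e"
  "ring.zero (basis_algebra B m e) = 0"
  "add (basis_algebra B m e) = (+)"
  by (simp_all add: basis_algebra_def basis_mult_def fun_eq_iff)

text \<open>The supports over which the product is summed change under addition. Enlarging both
  ranges to fixed finite sets adds only terms with coefficient zero, and makes additivity a termwise
  statement.\<close>

lemma basis_mult_superset:
  assumes "finite A" "finite C" "Poly_Mapping.keys f \<subseteq> A" "Poly_Mapping.keys g \<subseteq> C"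
  shows "basis_mult m f g = (\<Sum>p\<in>A. \<Sum>q\<in>C. (case m p q of None \<Rightarrow> 0
         | Some r \<Rightarrow> Poly_Mapping.single r (Poly_Mapping.lookup f p * Poly_Mapping.lookup g q)))"
proof -
  let ?t = "\<lambda>p q. (case m p q of None \<Rightarrow> 0
         | Some r \<Rightarrow> Poly_Mapping.single r (Poly_Mapping.lookup f p * Poly_Mapping.lookup g q))"
  have "(\<Sum>q\<in>C. ?t p q) = (\<Sum>q\<in>Poly_Mapping.keys g. ?t p q)" for p
    by (rule sum.mono_neutral_right[OF assms(2,4)])
      (auto split: option.splits simp: in_keys_iff)
  moreover have "(\<Sum>p\<in>A. \<Sum>q\<in>Poly_Mapping.keys g. ?t p q)
      = (\<Sum>p\<in>Poly_Mapping.keys f. \<Sum>q\<in>Poly_Mapping.keys g. ?t p q)"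
    by (rule sum.mono_neutral_right[OF assms(1,3)])
      (auto split: option.splits simp: in_keys_iff intro!: sum.neutral)
  ultimately show ?thesis by (simp add: basis_mult_def)
qed

lemma basis_mult_add_left: "basis_mult m (f + f') g = basis_mult m f g + basis_mult m f' g"
proof -
  let ?A = "Poly_Mapping.keys f \<union> Poly_Mapping.keys f'" and ?C = "Poly_Mapping.keys g"
  have "Poly_Mapping.keys (f + f') \<subseteq> ?A" by (rule Poly_Mapping.keys_add)
  then show ?thesis
    by (simp add: basis_mult_superset[of ?A ?C] sum.distrib[symmetric])
      (auto intro!: sum.cong split: option.splits
        simp: lookup_add distrib_right single_add)
qed

lemma basis_mult_add_right: "basis_mult m g (f + f') = basis_mult m g f + basis_mult m g f'"
proof -
  let ?A = "Poly_Mapping.keys f \<union> Poly_Mapping.keys f'" and ?C = "Poly_Mapping.keys g"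
  have "Poly_Mapping.keys (f + f') \<subseteq> ?A" by (rule Poly_Mapping.keys_add)
  then show ?thesis
    by (simp add: basis_mult_superset[of ?C ?A] sum.distrib[symmetric])
      (auto intro!: sum.cong split: option.splits
        simp: lookup_add distrib_left single_add)
qed

lemma basis_mult_zero [simp]: "basis_mult m 0 g = 0" "basis_mult m g 0 = 0"
  by (simp_all add: basis_mult_def)

lemma basis_mult_uminus: "basis_mult m (- f) g = - basis_mult m f g" "basis_mult m g (- f) = - basis_mult m g f"
  using basis_mult_add_left[of m f "- f" g] basis_mult_add_right[of m g f "- f"]
  by (simp_all add: eq_neg_iff_add_eq_0 add.commute)

lemma basis_mult_diff:
  "basis_mult m (f - f') g = basis_mult m f g - basis_mult m f' g"
  "basis_mult m g (f - f') = basis_mult m g f - basis_mult m g f'"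
  using basis_mult_add_left[of m f "- f'" g] basis_mult_add_right[of m g f "- f'"]
  by (simp_all add: basis_mult_uminus)

lemma basis_mult_sum:
  "basis_mult m (sum F A) g = (\<Sum>i\<in>A. basis_mult m (F i) g)"
  "basis_mult m g (sum F A) = (\<Sum>i\<in>A. basis_mult m g (F i))"
  by (induction A rule: infinite_finite_induct) (auto simp: basis_mult_add_left basis_mult_add_right)

lemma basis_mult_single:
  "basis_mult m (Poly_Mapping.single p x) (Poly_Mapping.single q y) =
     (case m p q of None \<Rightarrow> 0 | Some r \<Rightarrow> Poly_Mapping.single r (x * y))"
  by (subst basis_mult_superset[of "{p}" "{q}"]) (auto split: option.splits)

lemma poly_mapping_sum_keys:
  fixes f :: "'b \<Rightarrow>\<^sub>0 'a::comm_monoid_add"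
  shows "f = (\<Sum>p\<in>Poly_Mapping.keys f. Poly_Mapping.single p (Poly_Mapping.lookup f p))"
proof (rule poly_mapping_eqI)
  fix k
  show "Poly_Mapping.lookup f k = Poly_Mapping.lookup (\<Sum>p\<in>Poly_Mapping.keys f. Poly_Mapping.single p (Poly_Mapping.lookup f p)) k"
    by (auto simp: lookup_sum lookup_single when_def in_keys_iff)
qed

text \<open>A finitely supported function is the sum of its one-point parts, so an additive
  statement needs to be checked on basis elements only. The support stays in \<open>B\<close>
  throughout because the basis facts used later hold for genuine paths, not for arbitrary
  pairs.\<close>

lemma poly_mapping_additive_induct [consumes 1, case_names zero single add]:
  fixes f :: "'b \<Rightarrow>\<^sub>0 'a::comm_monoid_add"
  assumes "Poly_Mapping.keys f \<subseteq> B" "P 0"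
    and "\<And>p c. p \<in> B \<Longrightarrow> P (Poly_Mapping.single p c)"
    and "\<And>f g. Poly_Mapping.keys f \<subseteq> B \<Longrightarrow> Poly_Mapping.keys g \<subseteq> B \<Longrightarrow> P f \<Longrightarrow> P g \<Longrightarrow> P (f + g)"
  shows "P f"
proof -
  have "P (\<Sum>p\<in>A. Poly_Mapping.single p (c p)) \<and> Poly_Mapping.keys (\<Sum>p\<in>A. Poly_Mapping.single p (c p)) \<subseteq> B"
    if "finite A" "A \<subseteq> B" for A and c :: "'b \<Rightarrow> 'a"
    using that
  proof (induction A rule: finite_induct)
    case (insert x F)
    have "Poly_Mapping.keys (Poly_Mapping.single x (c x) + (\<Sum>p\<in>F. Poly_Mapping.single p (c p)))
        \<subseteq> Poly_Mapping.keys (Poly_Mapping.single x (c x)) \<union> Poly_Mapping.keys (\<Sum>p\<in>F. Poly_Mapping.single p (c p))"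
      by (rule Poly_Mapping.keys_add)
    also have "\<dots> \<subseteq> B" using insert by (simp del: keys_single) (simp add: Poly_Mapping.keys_single)
    finally have "Poly_Mapping.keys (Poly_Mapping.single x (c x) + (\<Sum>p\<in>F. Poly_Mapping.single p (c p))) \<subseteq> B" .
    then show ?case using insert by (simp add: assms(3,4))
  qed (simp add: assms)
  from this[of "Poly_Mapping.keys f" "Poly_Mapping.lookup f"] show ?thesis
    using assms(1) poly_mapping_sum_keys[of f] by simp
qed

text \<open>By biadditivity the ring laws follow from the basis. Associativity uses
  \<open>Option.bind\<close>, so that both bracketings have to be undefined together. The unit laws
  are assumed for the element \<open>e\<close>, not for a basis element, because the unit of a path
  algebra is a sum of paths.\<close>

lemma ring_basis_algebra:
  fixes e :: "'b \<Rightarrow>\<^sub>0 'a::comm_ring_1"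
  assumes closed: "\<And>p q r. p \<in> B \<Longrightarrow> q \<in> B \<Longrightarrow> m p q = Some r \<Longrightarrow> r \<in> B"
    and assoc: "\<And>p q r. p \<in> B \<Longrightarrow> q \<in> B \<Longrightarrow> r \<in> B \<Longrightarrow>
          Option.bind (m p q) (\<lambda>x. m x r) = Option.bind (m q r) (m p)"
    and e: "Poly_Mapping.keys e \<subseteq> B"
    and one: "\<And>p c. p \<in> B \<Longrightarrow> basis_mult m e (Poly_Mapping.single p c) = Poly_Mapping.single p c"
       "\<And>p c. p \<in> B \<Longrightarrow> basis_mult m (Poly_Mapping.single p c) e = Poly_Mapping.single p c"
  shows "ring (basis_algebra B m e)"
proof (rule ringI)
  let ?R = "basis_algebra B m e"
  have clo: "Poly_Mapping.keys (f + g) \<subseteq> B" if "Poly_Mapping.keys f \<subseteq> B" "Poly_Mapping.keys g \<subseteq> B" for f g :: "'b \<Rightarrow>\<^sub>0 'a"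
    using that Poly_Mapping.keys_add[of f g] by blast
  have mclo: "Poly_Mapping.keys (basis_mult m f g) \<subseteq> B" if "Poly_Mapping.keys f \<subseteq> B" "Poly_Mapping.keys g \<subseteq> B" for f g :: "'b \<Rightarrow>\<^sub>0 'a"
    using that(1)
  proof (induction rule: poly_mapping_additive_induct)
    case (single p c)
    from that(2) show ?case
    proof (induction rule: poly_mapping_additive_induct)
      case (single q d)
      show ?case
      proof (cases "m p q")
        case (Some r)
        with closed[OF \<open>p \<in> B\<close> single] show ?thesis by (simp add: basis_mult_single)
      qed (simp add: basis_mult_single)
    next
      case (add f g)
      show ?case unfolding basis_mult_add_right by (rule clo[OF add(3,4)])
    qed simp
  next
    case (add f g)
    show ?case unfolding basis_mult_add_left by (rule clo[OF add(3,4)])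
  qed simp
  show "abelian_group ?R"
  proof (rule abelian_groupI)
    fix x assume "x \<in> carrier ?R"
    then show "\<exists>y\<in>carrier ?R. y \<oplus>\<^bsub>?R\<^esub> x = \<zero>\<^bsub>?R\<^esub>"
      by (intro bexI[of _ "- x"]) auto
  qed (simp_all add: add_ac clo)
  show "monoid ?R"
  proof (rule monoidI)
    fix x y z assume "x \<in> carrier ?R" "y \<in> carrier ?R" "z \<in> carrier ?R"
    then have x: "Poly_Mapping.keys x \<subseteq> B" and y: "Poly_Mapping.keys y \<subseteq> B" and z: "Poly_Mapping.keys z \<subseteq> B" by auto
    from x have "basis_mult m (basis_mult m x y) z = basis_mult m x (basis_mult m y z)"
    proof (induction rule: poly_mapping_additive_induct)
      case (single p c)
      note p = single
      from y show ?case
      proof (induction rule: poly_mapping_additive_induct)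
        case (single q d)
        note q = single
        from z show ?case
        proof (induction rule: poly_mapping_additive_induct)
          case (single r k)
          from assoc[OF p q single] show ?case
            by (auto simp: basis_mult_single mult.assoc split: option.splits)
        qed (auto simp: basis_mult_add_right)
      qed (auto simp: basis_mult_add_left basis_mult_add_right)
    qed (auto simp: basis_mult_add_left)
    then show "x \<otimes>\<^bsub>?R\<^esub> y \<otimes>\<^bsub>?R\<^esub> z = x \<otimes>\<^bsub>?R\<^esub> (y \<otimes>\<^bsub>?R\<^esub> z)" by simp
  next
    fix x assume "x \<in> carrier ?R"
    then have x: "Poly_Mapping.keys x \<subseteq> B" by auto
    from x have "basis_mult m e x = x"
      by (induction rule: poly_mapping_additive_induct) (auto simp: basis_mult_add_right one)
    then show "\<one>\<^bsub>?R\<^esub> \<otimes>\<^bsub>?R\<^esub> x = x" by simp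
    from x have "basis_mult m x e = x"
      by (induction rule: poly_mapping_additive_induct) (auto simp: basis_mult_add_left one)
    then show "x \<otimes>\<^bsub>?R\<^esub> \<one>\<^bsub>?R\<^esub> = x" by simp
  qed (use e mclo in auto)
qed (auto simp: basis_mult_add_left basis_mult_add_right)

lemma ring_pair_monoid_ring:
  assumes "ring R" "ring S"
  shows "ring (pair_monoid_ring R S)"
proof -
  interpret R: ring R by fact
  interpret S: ring S by fact
  show ?thesis
    unfolding pair_monoid_ring_def
    by (rule ring_basis_algebra) (auto simp: basis_mult_single R.m_assoc S.m_assoc)
qed

section \<open>Tensor products with the rationals\<close>

lemma ring_of_type_algebra_sel [simp]:
  "carrier (ring_of_type_algebra :: 'a::ring_1 ring) = UNIV"
  "monoid.mult (ring_of_type_algebra :: 'a ring) = (*)"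
  "one (ring_of_type_algebra :: 'a ring) = 1"
  "ring.zero (ring_of_type_algebra :: 'a ring) = 0"
  "add (ring_of_type_algebra :: 'a ring) = (+)"
  by (simp_all add: ring_of_type_algebra_def)

lemma a_inv_ab_group_add:
  fixes R :: "('a::ab_group_add, 'm) ring_scheme"
  assumes "ring R" "add R = (+)" "ring.zero R = 0" "x \<in> carrier R" "- x \<in> carrier R"
  shows "a_inv R x = - x"
proof -
  interpret ring R by fact
  show ?thesis by (rule minus_equality) (use assms in auto)
qed

text \<open>A rational algebra structure on a ring record. The product law distributes two scalars
  over two factors; taking one factor to be the unit yields both compatibility of iterated scalars
  and centrality.\<close>

definition rat_action :: "('t, 'm) ring_scheme \<Rightarrow> (rat \<Rightarrow> 't \<Rightarrow> 't) \<Rightarrow> bool" where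
  "rat_action T act \<longleftrightarrow>
     (\<forall>q. \<forall>x\<in>carrier T. act q x \<in> carrier T) \<and>
     (\<forall>q. \<forall>x\<in>carrier T. \<forall>y\<in>carrier T. act q (x \<oplus>\<^bsub>T\<^esub> y) = act q x \<oplus>\<^bsub>T\<^esub> act q y) \<and>
     (\<forall>q r. \<forall>x\<in>carrier T. act (q + r) x = act q x \<oplus>\<^bsub>T\<^esub> act r x) \<and>
     (\<forall>q r. \<forall>x\<in>carrier T. \<forall>y\<in>carrier T. act (q * r) (x \<otimes>\<^bsub>T\<^esub> y) = act q x \<otimes>\<^bsub>T\<^esub> act r y) \<and>
     (\<forall>x\<in>carrier T. act 1 x = x)"

locale rat_algebra = ring T for T (structure) +
  fixes act :: "rat \<Rightarrow> 'a \<Rightarrow> 'a"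
  assumes act: "rat_action T act"
begin

lemma act_closed [simp, intro]: "x \<in> carrier T \<Longrightarrow> act q x \<in> carrier T"
  using act by (simp add: rat_action_def)
lemma act_add: "x \<in> carrier T \<Longrightarrow> y \<in> carrier T \<Longrightarrow> act q (x \<oplus> y) = act q x \<oplus> act q y"
  using act by (simp add: rat_action_def)
lemma add_act: "x \<in> carrier T \<Longrightarrow> act (q + r) x = act q x \<oplus> act r x"
  using act by (simp add: rat_action_def)
lemma act_mult: "x \<in> carrier T \<Longrightarrow> y \<in> carrier T \<Longrightarrow> act (q * r) (x \<otimes> y) = act q x \<otimes> act r y"
  using act by (simp add: rat_action_def)
lemma act_1 [simp]: "x \<in> carrier T \<Longrightarrow> act 1 x = x"
  using act by (simp add: rat_action_def)

lemma act_0 [simp]: assumes "x \<in> carrier T" shows "act 0 x = \<zero>"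
  using add_act[OF assms, of 0 0] assms by (simp add: add.r_cancel_one')

lemma act_zero [simp]: "act q \<zero> = \<zero>"
  using act_add[of \<zero> \<zero> q] by (simp add: add.r_cancel_one')

lemma act_act: assumes "x \<in> carrier T" shows "act q (act r x) = act (q * r) x"
proof -
  have "act (q * r) x = act q \<one> \<otimes> act r x" using assms act_mult[of \<one> x q r] by simp
  also have "\<dots> = act q (act r x)" using assms act_mult[of \<one> "act r x" q 1] by simp
  finally show ?thesis by simp
qed

lemma act_eq_zero: assumes "x \<in> carrier T" "q \<noteq> 0" "act q x = \<zero>" shows "x = \<zero>"
proof -
  have "act (inverse q) (act q x) = x" using assms(1,2) by (simp add: act_act)
  then show ?thesis by (simp add: assms(3))
qed

end

lemma rat_algebraI: "ring T \<Longrightarrow> rat_action T act \<Longrightarrow> rat_algebra T act"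
  by (simp add: rat_algebra_def rat_algebra_axioms_def)

text \<open>The map (r, q) to q \<psi>(r) is well defined on the tensor product and onto. It is
  injective because a common denominator brings every tensor to the form of r tensored with 1/n,
  whose image \<psi>(r)/n vanishes only if r does.\<close>

theorem tensor_ring_Q_iso:
  fixes T :: "'t ring" and R :: "'r ring"
  assumes R: "ring R" and T: "rat_algebra T act" and psi: "\<psi> \<in> Ring.ring_hom R T"
    and inj: "inj_on \<psi> (carrier R)"
    and surj: "\<And>t. t \<in> carrier T \<Longrightarrow> \<exists>r\<in>carrier R. \<exists>n::nat. n \<ge> 1 \<and> t = act (1 / of_nat n) (\<psi> r)"
  shows "tensor_ring R Q_ring \<simeq> T"
proof -
  interpret R: ring R by fact
  interpret T: rat_algebra T act by fact
  interpret psi: ring_hom_ring R T \<psi> by (rule ring_hom_ringI2) (use psi R T.ring_axioms in auto)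
  let ?B = "carrier R \<times> (UNIV :: rat set)"
  define Z where "Z = pair_monoid_ring R Q_ring"
  have Zr: "ring Z" unfolding Z_def by (rule ring_pair_monoid_ring[OF R ring_from_type_algebra])
  interpret Z: ring Z by fact
  have Z_sel [simp]: "carrier Z = {f. Poly_Mapping.keys f \<subseteq> ?B}"
     "monoid.mult Z = basis_mult (\<lambda>p q. Some (fst p \<otimes>\<^bsub>R\<^esub> fst q, snd p * snd q))"
     "one Z = Poly_Mapping.single (\<one>\<^bsub>R\<^esub>, 1) 1" "ring.zero Z = 0" "add Z = (+)"
    by (simp_all add: Z_def pair_monoid_ring_def)
  define J where "J = Idl\<^bsub>Z\<^esub> (tensor_relations R Q_ring)"
  have plus_keys: "Poly_Mapping.keys (f + g) \<subseteq> ?B" if "Poly_Mapping.keys f \<subseteq> ?B" "Poly_Mapping.keys g \<subseteq> ?B"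
    for f g :: "'r \<times> rat \<Rightarrow>\<^sub>0 int" using Z.a_closed[of f g] that by simp
  have minus_keys: "Poly_Mapping.keys (f - g) \<subseteq> ?B" if "Poly_Mapping.keys f \<subseteq> ?B" "Poly_Mapping.keys g \<subseteq> ?B"
    for f g :: "'r \<times> rat \<Rightarrow>\<^sub>0 int" using plus_keys[of f "- g"] that by simp
  have rel_keys: "tensor_relations R Q_ring \<subseteq> carrier Z"
  proof
    fix z assume "z \<in> tensor_relations R Q_ring"
    then obtain u v w where "z = Poly_Mapping.single u 1 - Poly_Mapping.single v 1 - Poly_Mapping.single w 1"
      and "u \<in> ?B" "v \<in> ?B" "w \<in> ?B"
      unfolding tensor_relations_def by fastforce
    moreover from this have "Poly_Mapping.keys z \<subseteq> ?B"
      by (simp only:) (intro minus_keys, auto simp del: frag_of_eq)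
    ultimately show "z \<in> carrier Z" by simp
  qed
  interpret J: ideal J Z unfolding J_def by (rule Z.genideal_ideal[OF rel_keys])
  have rel_J: "tensor_relations R Q_ring \<subseteq> J" unfolding J_def by (rule Z.genideal_self[OF rel_keys])

  define g where "g c x = act (of_int c * snd x) (\<psi> (fst x))" for c :: int and x :: "'r \<times> rat"
  have g_closed: "g c x \<in> carrier T" if "x \<in> ?B" for c x using that by (auto simp: g_def)
  have g_add: "g (c + d) x = g c x \<oplus>\<^bsub>T\<^esub> g d x" if "x \<in> ?B" for c d x
    using that by (auto simp: g_def distrib_right T.add_act)
  have g_0: "g 0 x = \<zero>\<^bsub>T\<^esub>" if "x \<in> ?B" for x using that by (auto simp: g_def)
  define \<Phi> where "\<Phi> z = (\<Oplus>\<^bsub>T\<^esub>x\<in>Poly_Mapping.keys z. g (Poly_Mapping.lookup z x) x)" for z :: "'r \<times> rat \<Rightarrow>\<^sub>0 int"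
  have Phi_sup: "\<Phi> z = (\<Oplus>\<^bsub>T\<^esub>x\<in>A. g (Poly_Mapping.lookup z x) x)"
    if "finite A" "Poly_Mapping.keys z \<subseteq> A" "A \<subseteq> ?B" for z A
    unfolding \<Phi>_def
    by (rule T.add.finprod_mono_neutral_cong_left) (use that g_0 g_closed in \<open>auto simp: in_keys_iff Pi_def\<close>)
  have Phi_closed: "\<Phi> z \<in> carrier T" if "Poly_Mapping.keys z \<subseteq> ?B" for z
    unfolding \<Phi>_def using that g_closed by (intro T.finsum_closed) auto
  have Phi_add: "\<Phi> (z + w) = \<Phi> z \<oplus>\<^bsub>T\<^esub> \<Phi> w" if "Poly_Mapping.keys z \<subseteq> ?B" "Poly_Mapping.keys w \<subseteq> ?B" for z w
  proof -
    let ?A = "Poly_Mapping.keys z \<union> Poly_Mapping.keys w"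
    have A: "finite ?A" "?A \<subseteq> ?B" using that by auto
    have "\<Phi> (z + w) = (\<Oplus>\<^bsub>T\<^esub>x\<in>?A. g (Poly_Mapping.lookup (z + w) x) x)"
      by (rule Phi_sup[OF A(1) Poly_Mapping.keys_add A(2)])
    also have "\<dots> = (\<Oplus>\<^bsub>T\<^esub>x\<in>?A. g (Poly_Mapping.lookup z x) x \<oplus>\<^bsub>T\<^esub> g (Poly_Mapping.lookup w x) x)"
      by (rule T.finsum_cong') (use A g_closed in \<open>auto simp: lookup_add intro!: g_add\<close>)
    also have "\<dots> = \<Phi> z \<oplus>\<^bsub>T\<^esub> \<Phi> w"
      by (subst T.finsum_addf) (use A g_closed Phi_sup[OF A(1) _ A(2)] in auto)
    finally show ?thesis .
  qed
  have Phi_0: "\<Phi> 0 = \<zero>\<^bsub>T\<^esub>" by (simp add: \<Phi>_def)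
  have Phi_single: "\<Phi> (Poly_Mapping.single x c) = g c x" if "x \<in> ?B" for x c
    by (subst Phi_sup[of "{x}"]) (use that g_closed in \<open>auto split: if_splits\<close>)
  have g_mult: "g (c * d) (fst x \<otimes>\<^bsub>R\<^esub> fst y, snd x * snd y) = g c x \<otimes>\<^bsub>T\<^esub> g d y" if "x \<in> ?B" "y \<in> ?B" for c d x y
    using that by (auto simp: g_def T.act_mult[symmetric] mult_ac)
  have Phi_mult: "\<Phi> (z \<otimes>\<^bsub>Z\<^esub> w) = \<Phi> z \<otimes>\<^bsub>T\<^esub> \<Phi> w" if z: "Poly_Mapping.keys z \<subseteq> ?B" and w: "Poly_Mapping.keys w \<subseteq> ?B" for z w
    using z
  proof (induction rule: poly_mapping_additive_induct)
    case zero
    then show ?case using Phi_closed[OF w] by (simp add: Phi_0)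
  next
    case (single p c)
    note p = single
    from w show ?case
    proof (induction rule: poly_mapping_additive_induct)
      case zero
      then show ?case using g_closed[OF p] by (simp add: Phi_0 Phi_single p)
    next
      case (single q d)
      have "(fst p \<otimes>\<^bsub>R\<^esub> fst q, snd p * snd q) \<in> ?B" using p single by auto
      then show ?case using p single by (simp add: basis_mult_single Phi_single g_mult del: mem_Times_iff)
    next
      case (add f h)
      have p1: "Poly_Mapping.single p c \<in> carrier Z" using p by auto
      have "\<Phi> (Poly_Mapping.single p c \<otimes>\<^bsub>Z\<^esub> f) \<oplus>\<^bsub>T\<^esub> \<Phi> (Poly_Mapping.single p c \<otimes>\<^bsub>Z\<^esub> h)
        = \<Phi> (Poly_Mapping.single p c) \<otimes>\<^bsub>T\<^esub> \<Phi> (f + h)"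
        unfolding add.IH using add.hyps p1 by (simp add: Phi_add T.r_distr Phi_closed)
      then show ?case using Phi_add[of "Poly_Mapping.single p c \<otimes>\<^bsub>Z\<^esub> f" "Poly_Mapping.single p c \<otimes>\<^bsub>Z\<^esub> h"]
          Z.m_closed[OF p1, of f] Z.m_closed[OF p1, of h] add.hyps by (simp add: basis_mult_add_right)
    qed
  next
    case (add f h)
    have w1: "w \<in> carrier Z" using w by auto
    have "\<Phi> (f \<otimes>\<^bsub>Z\<^esub> w) \<oplus>\<^bsub>T\<^esub> \<Phi> (h \<otimes>\<^bsub>Z\<^esub> w) = \<Phi> (f + h) \<otimes>\<^bsub>T\<^esub> \<Phi> w"
      unfolding add.IH using add.hyps w1 by (simp add: Phi_add T.l_distr Phi_closed)
    then show ?case using Phi_add[of "f \<otimes>\<^bsub>Z\<^esub> w" "h \<otimes>\<^bsub>Z\<^esub> w"]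
        Z.m_closed[OF _ w1, of f] Z.m_closed[OF _ w1, of h] add.hyps by (simp add: basis_mult_add_left)
  qed
  have Phi_hom: "\<Phi> \<in> Ring.ring_hom Z T"
    by (rule ring_hom_memI) (use Phi_closed Phi_mult Phi_add in \<open>auto simp: Phi_single g_def\<close>)
  interpret Phi: ring_hom_ring Z T \<Phi>
    by (rule ring_hom_ringI2) (use Phi_hom Zr T.ring_axioms in auto)

  have Phi_surj: "\<Phi> ` carrier Z = carrier T"
  proof
    show "carrier T \<subseteq> \<Phi> ` carrier Z"
    proof
      fix t assume "t \<in> carrier T"
      with surj obtain r n where r: "r \<in> carrier R" and t: "t = act (1 / of_nat n) (\<psi> r)" by blast
      have "t = \<Phi> (Poly_Mapping.single (r, 1 / of_nat n) 1)"
        using r t by (subst Phi_single) (auto simp: g_def)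
      moreover have "Poly_Mapping.single (r, 1 / of_nat n) 1 \<in> carrier Z" using r by auto
      ultimately show "t \<in> \<Phi> ` carrier Z" by blast
    qed
  qed (use Phi_closed in auto)

  have gr1: "\<Phi> (Poly_Mapping.single (a \<oplus>\<^bsub>R\<^esub> a', b) 1) =
      \<Phi> (Poly_Mapping.single (a, b) 1) \<oplus>\<^bsub>T\<^esub> \<Phi> (Poly_Mapping.single (a', b) 1)"
    if "a \<in> carrier R" "a' \<in> carrier R" for a a' b
    using that by (subst (1 2 3) Phi_single) (auto simp: g_def T.act_add)
  have gr2: "\<Phi> (Poly_Mapping.single (a, b + b') 1) =
      \<Phi> (Poly_Mapping.single (a, b) 1) \<oplus>\<^bsub>T\<^esub> \<Phi> (Poly_Mapping.single (a, b') 1)"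
    if "a \<in> carrier R" for a b b'
    using that by (subst (1 2 3) Phi_single) (auto simp: g_def T.add_act)
  have rel_ker: "z \<in> a_kernel Z T \<Phi>" if "z \<in> tensor_relations R Q_ring" for z
  proof -
    have z: "z \<in> carrier Z" using that rel_keys by blast
    have "\<exists>u v w. z = u - v - w \<and> u \<in> carrier Z \<and> v \<in> carrier Z \<and> w \<in> carrier Z \<and> \<Phi> u = \<Phi> v \<oplus>\<^bsub>T\<^esub> \<Phi> w"
      using that unfolding tensor_relations_def
    proof (elim UnE CollectE exE conjE)
      fix a a' b assume z: "z = Poly_Mapping.single (a \<oplus>\<^bsub>R\<^esub> a', b) 1
          - Poly_Mapping.single (a, b) 1 - Poly_Mapping.single (a', b) 1" and "a \<in> carrier R" "a' \<in> carrier R"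
      then show ?thesis
        by (intro exI[of _ "Poly_Mapping.single (a \<oplus>\<^bsub>R\<^esub> a', b) 1"] exI[of _ "Poly_Mapping.single (a, b) 1"]
            exI[of _ "Poly_Mapping.single (a', b) 1"]) (simp add: gr1 del: frag_of_eq)
    next
      fix a b b' assume z: "z = Poly_Mapping.single (a, b \<oplus>\<^bsub>Q_ring\<^esub> b') 1
          - Poly_Mapping.single (a, b) 1 - Poly_Mapping.single (a, b') 1" and "a \<in> carrier R"
      then show ?thesis
        by (intro exI[of _ "Poly_Mapping.single (a, b + b') 1"] exI[of _ "Poly_Mapping.single (a, b) 1"]
            exI[of _ "Poly_Mapping.single (a, b') 1"]) (simp add: gr2 del: frag_of_eq)
    qed
    then obtain u v w where zz: "z = u - v - w" and *: "u \<in> carrier Z" "v \<in> carrier Z" "w \<in> carrier Z" and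
      e: "\<Phi> u = \<Phi> v \<oplus>\<^bsub>T\<^esub> \<Phi> w" by blast
    have p1: "\<Phi> (z + (v + w)) = \<Phi> z \<oplus>\<^bsub>T\<^esub> \<Phi> (v + w)"
      by (rule Phi_add) (use z * plus_keys[of v w] in auto)
    have p2: "\<Phi> (v + w) = \<Phi> u"
      unfolding e by (rule Phi_add) (use * in auto)
    have "\<Phi> z \<oplus>\<^bsub>T\<^esub> \<Phi> u = \<Phi> (z + (v + w))" by (simp only: p1 p2)
    also have "z + (v + w) = u" by (simp add: zz)
    finally have "\<Phi> z \<oplus>\<^bsub>T\<^esub> \<Phi> u = \<Phi> u" .
    moreover have "\<Phi> z \<in> carrier T" using z by (simp add: Phi_closed)
    moreover have "\<Phi> u \<in> carrier T" using *(1) by (simp add: Phi_closed)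
    ultimately have "\<Phi> z = \<zero>\<^bsub>T\<^esub>" using T.add.r_cancel_one[of "\<Phi> u" "\<Phi> z"] by simp
    then show ?thesis using z unfolding a_kernel_def' by blast
  qed
  have J_ker: "J \<subseteq> a_kernel Z T \<Phi>"
    unfolding J_def by (rule Z.genideal_minimal[OF Phi.kernel_is_ideal]) (use rel_ker in blast)

  have J_plus: "x + y \<in> J" if "x \<in> J" "y \<in> J" for x y using J.a_closed[OF that] by simp
  have J_uminus: "- x \<in> J" if "x \<in> J" for x
    using J.a_inv_closed[OF that] a_inv_ab_group_add[OF Zr, of x] J.Icarr[OF that] by simp
  \<comment> \<open>Equality in the tensor product, expressed on representatives in the free abelian
    group.\<close>
  define eqv (infix "\<sim>" 50) where "x \<sim> y \<longleftrightarrow> x - y \<in> J" for x y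
  have refl: "x \<sim> x" for x using J.zero_closed by (simp add: eqv_def)
  have sym: "y \<sim> x" if "x \<sim> y" for x y using J_uminus that by (fastforce simp: eqv_def)
  have trans: "x \<sim> z" if "x \<sim> y" "y \<sim> z" for x y z using J_plus[of "x - y" "y - z"] that by (simp add: eqv_def)
  have plus: "x + x' \<sim> y + y'" if "x \<sim> y" "x' \<sim> y'" for x x' y y'
    using J_plus[of "x - y" "x' - y'"] that by (simp add: eqv_def algebra_simps)
  have um: "- x \<sim> - y" if "x \<sim> y" for x y using J_uminus[of "x - y"] that by (simp add: eqv_def)
  let ?s = "Poly_Mapping.single"
  have B1: "?s (a \<oplus>\<^bsub>R\<^esub> a', b) 1 \<sim> ?s (a, b) 1 + ?s (a', b) (1::int)" if "a \<in> carrier R" "a' \<in> carrier R" for a a' b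
  proof -
    have "?s (a \<oplus>\<^bsub>R\<^esub> a', b) 1 - ?s (a, b) 1 - ?s (a', b) (1::int) \<in> tensor_relations R Q_ring"
      using that by (auto simp: tensor_relations_def)
    then show ?thesis using rel_J by (auto simp: eqv_def algebra_simps)
  qed
  have B2: "?s (a, b + b') 1 \<sim> ?s (a, b) 1 + ?s (a, b') (1::int)" if "a \<in> carrier R" for a b b'
  proof -
    have "?s (a, b + b') 1 - ?s (a, b) 1 - ?s (a, b') (1::int) \<in> tensor_relations R Q_ring"
      using that by (auto simp: tensor_relations_def)
    then show ?thesis using rel_J by (auto simp: eqv_def algebra_simps)
  qed
  \<comment> \<open>Additivity at \<zero> + \<zero> makes such a tensor congruent to twice itself,
    hence to 0.\<close>
  have Z1: "?s (\<zero>\<^bsub>R\<^esub>, b) 1 \<sim> (0::'r \<times> rat \<Rightarrow>\<^sub>0 int)" for b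
    using um[OF B1[of "\<zero>\<^bsub>R\<^esub>" "\<zero>\<^bsub>R\<^esub>" b]] by (simp add: eqv_def)
  have Z2: "?s (a, 0) 1 \<sim> (0::'r \<times> rat \<Rightarrow>\<^sub>0 int)" if "a \<in> carrier R" for a
    using um[OF B2[OF that, of 0 0]] by (simp add: eqv_def)
  have C2n: "?s (a, b) (int k) \<sim> ?s (a, of_nat k * b) 1" if "a \<in> carrier R" for a b k
  proof (induction k)
    case 0 show ?case using sym[OF Z2[OF that]] by simp
  next
    case (Suc k)
    have "?s (a, b) (int (Suc k)) = ?s (a, b) (int k) + ?s (a, b) 1" by (simp add: single_add[symmetric] add.commute)
    also have "\<dots> \<sim> ?s (a, of_nat k * b) 1 + ?s (a, b) 1" by (rule plus[OF Suc refl])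
    finally have "?s (a, b) (int (Suc k)) \<sim> ?s (a, of_nat k * b) 1 + ?s (a, b) 1" .
    from trans[OF this sym[OF B2[OF that, of "of_nat k * b" b]]]
    show ?case by (simp add: algebra_simps)
  qed
  \<comment> \<open>An integer coefficient can be absorbed into the rational factor;
    \<open>C1\<close> absorbs it into the ring factor instead. Together they move the numerator of a
    rational number over to \<open>R\<close>.\<close>
  have C2: "?s (a, b) c \<sim> ?s (a, of_int c * b) 1" if a: "a \<in> carrier R" for a b and c :: int
  proof (cases "c \<ge> 0")
    case True
    then show ?thesis using C2n[OF a, of b "nat c"] by simp
  next
    case False
    let ?k = "nat (- c)"
    from False have c: "- int ?k = c" by simp
    have "?s (a, b) c = - ?s (a, b) (int ?k)" by (simp only: single_uminus[symmetric] c)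
    also have "\<dots> \<sim> - ?s (a, of_nat ?k * b) 1" by (rule um[OF C2n[OF a]])
    finally have 1: "?s (a, b) c \<sim> - ?s (a, of_nat ?k * b) 1" .
    have "0 \<sim> ?s (a, of_nat ?k * b) 1 + ?s (a, - (of_nat ?k * b)) (1::int)"
      using trans[OF sym[OF Z2[OF a]], of "?s (a, of_nat ?k * b) 1 + ?s (a, - (of_nat ?k * b)) 1"] B2[OF a, of "of_nat ?k * b" "- (of_nat ?k * b)"] by simp
    from plus[OF refl[of "- ?s (a, of_nat ?k * b) 1"] this]
    have "- ?s (a, of_nat ?k * b) 1 \<sim> ?s (a, - (of_nat ?k * b)) (1::int)" by simp
    moreover have "- (of_nat ?k * b) = of_int c * b" using False by simp
    ultimately show ?thesis using trans[OF 1] by simp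
  qed
  have C1n: "\<exists>a'\<in>carrier R. ?s (a, b) (int k) \<sim> ?s (a', b) 1" if "a \<in> carrier R" for a b k
  proof (induction k)
    case 0 show ?case using sym[OF Z1[of b]] by (intro bexI[of _ "\<zero>\<^bsub>R\<^esub>"]) auto
  next
    case (Suc k)
    then obtain a' where a': "a' \<in> carrier R" "?s (a, b) (int k) \<sim> ?s (a', b) 1" by blast
    have "?s (a, b) (int (Suc k)) = ?s (a, b) (int k) + ?s (a, b) 1" by (simp add: single_add[symmetric] add.commute)
    also have "\<dots> \<sim> ?s (a', b) 1 + ?s (a, b) 1" by (rule plus[OF a'(2) refl])
    finally have "?s (a, b) (int (Suc k)) \<sim> ?s (a', b) 1 + ?s (a, b) 1" .
    from trans[OF this sym[OF B1[OF a'(1) that]]]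
    have "?s (a, b) (int (Suc k)) \<sim> ?s (a' \<oplus>\<^bsub>R\<^esub> a, b) 1" .
    then show ?case using a'(1) that by blast
  qed
  have C1: "\<exists>a'\<in>carrier R. ?s (a, b) c \<sim> ?s (a', b) 1" if a: "a \<in> carrier R" for a b and c :: int
  proof (cases "c \<ge> 0")
    case True
    then show ?thesis using C1n[OF a, of b "nat c"] by simp
  next
    case False
    let ?k = "nat (- c)"
    from False have c: "- int ?k = c" by simp
    obtain a' where a': "a' \<in> carrier R" "?s (a, b) (int ?k) \<sim> ?s (a', b) 1" using C1n[OF a] by blast
    have "?s (a, b) c = - ?s (a, b) (int ?k)" by (simp only: single_uminus[symmetric] c)
    also have "\<dots> \<sim> - ?s (a', b) 1" by (rule um[OF a'(2)])
    finally have 1: "?s (a, b) c \<sim> - ?s (a', b) 1" .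
    have "0 \<sim> ?s (a', b) 1 + ?s (\<ominus>\<^bsub>R\<^esub> a', b) (1::int)"
      by (rule trans[OF sym[OF Z1[of b]]])
        (use B1[OF a'(1) R.a_inv_closed[OF a'(1)], of b] a'(1) in \<open>simp add: R.r_neg\<close>)
    from plus[OF refl[of "- ?s (a', b) 1"] this]
    have "- ?s (a', b) 1 \<sim> ?s (\<ominus>\<^bsub>R\<^esub> a', b) (1::int)" by simp
    from trans[OF 1 this] show ?thesis using R.a_inv_closed[OF a'(1)] by blast
  qed
  \<comment> \<open>For one basis element the numerator travels to \<open>R\<close> and 1/n stays
    behind. For a sum both parts are first rewritten over the denominator \<open>n * n'\<close> and
    then added in the ring factor.\<close>
  have normal: "\<exists>r\<in>carrier R. \<exists>n::nat. n \<ge> 1 \<and> z \<sim> ?s (r, 1 / of_nat n) 1" if "Poly_Mapping.keys z \<subseteq> ?B" for z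
    using that
  proof (induction rule: poly_mapping_additive_induct)
    case zero
    show ?case using sym[OF Z1[of 1]] by (intro bexI[of _ "\<zero>\<^bsub>R\<^esub>"] exI[of _ "1::nat"]) auto
  next
    case (single p c)
    then obtain r q where p: "p = (r, q)" and r: "r \<in> carrier R" by auto
    obtain m n where mn: "quotient_of q = (m, n)" by fastforce
    then have n: "n > 0" and q: "q = of_int m / of_int n"
      using quotient_of_denom_pos quotient_of_div by blast+
    have "?s p c \<sim> ?s (r, of_int c * q) 1" unfolding p by (rule C2[OF r])
    moreover have "?s (r, of_int c * q) 1 \<sim> ?s (r, 1 / of_nat (nat n)) (c * m)"
      using sym[OF C2[OF r, of "1 / of_nat (nat n)" "c * m"]] n by (simp add: q)
    ultimately have 1: "?s p c \<sim> ?s (r, 1 / of_nat (nat n)) (c * m)" by (rule trans)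
    obtain r' where r': "r' \<in> carrier R" "?s (r, 1 / of_nat (nat n)) (c * m) \<sim> ?s (r', 1 / of_nat (nat n)) 1"
      using C1[OF r] by blast
    then have "r' \<in> carrier R \<and> nat n \<ge> 1 \<and> ?s p c \<sim> ?s (r', 1 / of_nat (nat n)) 1"
      using r'(1) n trans[OF 1 r'(2)] by simp
    then show ?case by blast
  next
    case (add f h)
    then obtain r n r' n' where r: "r \<in> carrier R" "n \<ge> 1" "f \<sim> ?s (r, 1 / of_nat n) 1"
      and r': "r' \<in> carrier R" "n' \<ge> 1" "h \<sim> ?s (r', 1 / of_nat n') 1" by blast
    let ?q = "1 / of_nat (n * n') :: rat"
    have "of_int (int n') * ?q = 1 / of_nat n" "of_int (int n) * ?q = 1 / of_nat n'"
      using r r' by (simp_all add: field_simps)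
    then have "?s (r, ?q) (int n') \<sim> ?s (r, 1 / of_nat n) 1" "?s (r', ?q) (int n) \<sim> ?s (r', 1 / of_nat n') 1"
      using C2[OF r(1), of ?q "int n'"] C2[OF r'(1), of ?q "int n"] by simp_all
    note e = this
    obtain r1 where r1: "r1 \<in> carrier R" "?s (r, ?q) (int n') \<sim> ?s (r1, ?q) 1" using C1[OF r(1)] by blast
    obtain r1' where r1': "r1' \<in> carrier R" "?s (r', ?q) (int n) \<sim> ?s (r1', ?q) 1" using C1[OF r'(1)] by blast
    have "f \<sim> ?s (r1, ?q) 1" by (rule trans[OF r(3) trans[OF sym[OF e(1)] r1(2)]])
    moreover have "h \<sim> ?s (r1', ?q) 1" by (rule trans[OF r'(3) trans[OF sym[OF e(2)] r1'(2)]])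
    ultimately have "f + h \<sim> ?s (r1 \<oplus>\<^bsub>R\<^esub> r1', ?q) 1"
      by (rule trans[OF plus sym[OF B1[OF r1(1) r1'(1)]]])
    then show ?case using r1(1) r1'(1) r(2) r'(2)
      by (intro bexI[of _ "r1 \<oplus>\<^bsub>R\<^esub> r1'"] exI[of _ "n * n'"]) auto
  qed
  have "a_kernel Z T \<Phi> \<subseteq> J"
  proof
    fix z assume "z \<in> a_kernel Z T \<Phi>"
    then have z: "Poly_Mapping.keys z \<subseteq> ?B" "\<Phi> z = \<zero>\<^bsub>T\<^esub>" unfolding a_kernel_def' by simp_all
    \<comment> \<open>With z in normal form, vanishing of its image says that \<psi>(r)/n = 0.
      Rational algebras have no torsion and \<psi> is injective, so r = 0 and z lies in
      \<open>J\<close>.\<close>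
    obtain r n where r: "r \<in> carrier R" "n \<ge> 1" "z \<sim> ?s (r, 1 / of_nat n) 1" using normal[OF z(1)] by blast
    have s: "?s (r, 1 / of_nat n) 1 \<in> carrier Z" using r by auto
    have "z - ?s (r, 1 / of_nat n) 1 \<in> a_kernel Z T \<Phi>" using r(3) J_ker unfolding eqv_def by blast
    then have d: "\<Phi> (z - ?s (r, 1 / of_nat n) 1) = \<zero>\<^bsub>T\<^esub>" "z - ?s (r, 1 / of_nat n) 1 \<in> carrier Z" unfolding a_kernel_def' by blast+
    have "\<Phi> (z - ?s (r, 1 / of_nat n) 1 + ?s (r, 1 / of_nat n) 1) =
        \<Phi> (z - ?s (r, 1 / of_nat n) 1) \<oplus>\<^bsub>T\<^esub> \<Phi> (?s (r, 1 / of_nat n) 1)"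
      by (rule Phi_add) (use d(2) s in simp_all)
    then have "\<Phi> (?s (r, 1 / of_nat n) 1) = \<zero>\<^bsub>T\<^esub>"
      using z(2) Phi_closed[of "?s (r, 1 / of_nat n) 1"] s by (simp add: d(1) del: frag_of_eq)
    then have "act (1 / of_nat n) (\<psi> r) = \<zero>\<^bsub>T\<^esub>" using r by (simp add: Phi_single g_def)
    then have "\<psi> r = \<psi> \<zero>\<^bsub>R\<^esub>" using T.act_eq_zero[of "\<psi> r" "1 / of_nat n"] r by simp
    then have "r = \<zero>\<^bsub>R\<^esub>" using inj_onD[OF inj, of r "\<zero>\<^bsub>R\<^esub>"] r(1) by simp
    with r(3) have "z \<sim> ?s (\<zero>\<^bsub>R\<^esub>, 1 / of_nat n) 1" by (simp only:)
    from trans[OF this Z1] have "z \<sim> 0" .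
    then show "z \<in> J" by (simp add: eqv_def)
  qed
  then have J: "J = a_kernel Z T \<Phi>" using J_ker by blast
  show ?thesis
    unfolding tensor_ring_def Z_def[symmetric] J_def[symmetric] J by (rule Phi.FactRing_iso[OF Phi_surj])
qed

text \<open>The preceding criterion applied to the injection of the quotient by the kernel. The map
  \<phi> itself has to reach the target only up to denominators.\<close>

theorem tensor_ring_Quot_Q_iso:
  fixes T :: "'t ring" and P :: "'r ring"
  assumes P: "ring P" and T: "rat_algebra T act" and phi: "\<phi> \<in> Ring.ring_hom P T"
    and ker: "I = a_kernel P T \<phi>"
    and surj: "\<And>t. t \<in> carrier T \<Longrightarrow> \<exists>x\<in>carrier P. \<exists>n::nat. n \<ge> 1 \<and> t = act (1 / of_nat n) (\<phi> x)"
  shows "tensor_ring (P Quot I) Q_ring \<simeq> T"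
proof -
  interpret T: rat_algebra T act by fact
  interpret phi: ring_hom_ring P T \<phi> by (rule ring_hom_ringI2) (use phi P T.ring_axioms in auto)
  interpret I: ideal I P unfolding ker by (rule phi.kernel_is_ideal)
  show ?thesis
  proof (rule tensor_ring_Q_iso[OF I.quotient_is_ring T, of "\<lambda>Y. the_elem (\<phi> ` Y)"])
    show "(\<lambda>Y. the_elem (\<phi> ` Y)) \<in> Ring.ring_hom (P Quot I) T"
      unfolding ker by (rule phi.the_elem_hom)
    show "inj_on (\<lambda>Y. the_elem (\<phi> ` Y)) (carrier (P Quot I))"
      unfolding ker by (rule inj_onI) (rule phi.the_elem_inj)
    fix t assume "t \<in> carrier T"
    then obtain x n where x: "x \<in> carrier P" "n \<ge> (1::nat)" "t = act (1 / of_nat n) (\<phi> x)" using surj by blast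
    have "I +>\<^bsub>P\<^esub> x \<in> carrier (P Quot I)"
      using x by (auto simp: FactRing_def A_RCOSETS_def')
    moreover have "the_elem (\<phi> ` (I +>\<^bsub>P\<^esub> x)) = \<phi> x"
      unfolding ker by (rule phi.the_elem_simp[OF x(1)])
    ultimately show "\<exists>r\<in>carrier (P Quot I). \<exists>n::nat. n \<ge> 1 \<and> t = act (1 / of_nat n) (the_elem (\<phi> ` r))"
      using x by (intro bexI[of _ "I +>\<^bsub>P\<^esub> x"] exI[of _ n]) simp_all
  qed
qed

section \<open>Matrix rings\<close>

lemma matrix_ring_sel [simp]:
  "A \<in> carrier (matrix_ring n R) \<longleftrightarrow> A \<in> carrier_mat n n \<and> (\<forall>i<n. \<forall>j<n. A $$ (i, j) \<in> carrier R)"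
  "A \<otimes>\<^bsub>matrix_ring n R\<^esub> B = mat n n (\<lambda>(i, j). \<Oplus>\<^bsub>R\<^esub>k\<in>{..<n}. A $$ (i, k) \<otimes>\<^bsub>R\<^esub> B $$ (k, j))"
  "\<one>\<^bsub>matrix_ring n R\<^esub> = mat n n (\<lambda>(i, j). if i = j then \<one>\<^bsub>R\<^esub> else \<zero>\<^bsub>R\<^esub>)"
  "\<zero>\<^bsub>matrix_ring n R\<^esub> = mat n n (\<lambda>_. \<zero>\<^bsub>R\<^esub>)"
  "A \<oplus>\<^bsub>matrix_ring n R\<^esub> B = mat n n (\<lambda>ij. A $$ ij \<oplus>\<^bsub>R\<^esub> B $$ ij)"
  by (auto simp: matrix_ring_def)

lemma (in ring) finsum_swap:
  assumes "finite A" "finite B" "\<And>i j. i \<in> A \<Longrightarrow> j \<in> B \<Longrightarrow> f i j \<in> carrier R"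
  shows "(\<Oplus>i\<in>A. \<Oplus>j\<in>B. f i j) = (\<Oplus>j\<in>B. \<Oplus>i\<in>A. f i j)"
  using assms(1,3)
proof (induction A rule: finite_induct)
  case (insert x F)
  then have "(\<Oplus>j\<in>B. \<Oplus>i\<in>insert x F. f i j) = (\<Oplus>j\<in>B. f x j \<oplus> (\<Oplus>i\<in>F. f i j))"
    by (intro finsum_cong') (auto intro!: finsum_closed)
  also have "\<dots> = (\<Oplus>j\<in>B. f x j) \<oplus> (\<Oplus>j\<in>B. \<Oplus>i\<in>F. f i j)"
    using insert by (intro finsum_addf) auto
  finally show ?case using insert by (subst finsum_insert) (auto intro!: finsum_closed)
qed simp

text \<open>One entry of the associative law for matrix products: distribute, reassociate and
  interchange the two sums.\<close>

lemma (in ring) finsum_mult_assoc: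
  fixes n :: nat
  assumes "\<And>l. l < n \<Longrightarrow> a l \<in> carrier R" "\<And>l k. l < n \<Longrightarrow> k < n \<Longrightarrow> b l k \<in> carrier R"
    "\<And>k. k < n \<Longrightarrow> c k \<in> carrier R"
  shows "(\<Oplus>k\<in>{..<n}. (\<Oplus>l\<in>{..<n}. a l \<otimes> b l k) \<otimes> c k) = (\<Oplus>l\<in>{..<n}. a l \<otimes> (\<Oplus>k\<in>{..<n}. b l k \<otimes> c k))"
proof -
  have "(\<Oplus>k\<in>{..<n}. (\<Oplus>l\<in>{..<n}. a l \<otimes> b l k) \<otimes> c k) = (\<Oplus>k\<in>{..<n}. \<Oplus>l\<in>{..<n}. a l \<otimes> (b l k \<otimes> c k))"
  proof (rule finsum_cong'[OF refl])
    fix k assume k: "k \<in> {..<n}"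
    have "(\<Oplus>l\<in>{..<n}. a l \<otimes> b l k) \<otimes> c k = (\<Oplus>l\<in>{..<n}. (a l \<otimes> b l k) \<otimes> c k)"
      by (rule finsum_ldistr) (use k assms in auto)
    also have "\<dots> = (\<Oplus>l\<in>{..<n}. a l \<otimes> (b l k \<otimes> c k))"
      by (rule finsum_cong'[OF refl]) (use k assms in \<open>auto simp: m_assoc\<close>)
    finally show "(\<Oplus>l\<in>{..<n}. a l \<otimes> b l k) \<otimes> c k = (\<Oplus>l\<in>{..<n}. a l \<otimes> (b l k \<otimes> c k))" .
  qed (use assms in \<open>auto intro!: finsum_closed\<close>)
  also have "\<dots> = (\<Oplus>l\<in>{..<n}. \<Oplus>k\<in>{..<n}. a l \<otimes> (b l k \<otimes> c k))"
    by (rule finsum_swap) (use assms in auto)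
  also have "\<dots> = (\<Oplus>l\<in>{..<n}. a l \<otimes> (\<Oplus>k\<in>{..<n}. b l k \<otimes> c k))"
  proof (rule finsum_cong'[OF refl])
    fix l assume l: "l \<in> {..<n}"
    show "(\<Oplus>k\<in>{..<n}. a l \<otimes> (b l k \<otimes> c k)) = a l \<otimes> (\<Oplus>k\<in>{..<n}. b l k \<otimes> c k)"
      by (rule finsum_rdistr[symmetric]) (use l assms in auto)
  qed (use assms in \<open>auto intro!: finsum_closed\<close>)
  finally show ?thesis .
qed

lemma ring_matrix_ring:
  fixes R (structure)
  assumes "ring R"
  shows "ring (matrix_ring n R)"
proof -
  interpret ring R by fact
  let ?M = "matrix_ring n R"
  have idx: "(A \<otimes>\<^bsub>?M\<^esub> B) $$ (i, j) = (\<Oplus>k\<in>{..<n}. A $$ (i, k) \<otimes> B $$ (k, j))"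
    "(A \<oplus>\<^bsub>?M\<^esub> B) $$ (i, j) = A $$ (i, j) \<oplus> B $$ (i, j)"
    "\<one>\<^bsub>?M\<^esub> $$ (i, j) = (if i = j then \<one> else \<zero>)"
    "\<zero>\<^bsub>?M\<^esub> $$ (i, j) = \<zero>" if "i < n" "j < n" for A B i j
    using that by auto
  have eqI: "A = B" if "A \<in> carrier ?M" "B \<in> carrier ?M" "\<And>i j. i < n \<Longrightarrow> j < n \<Longrightarrow> A $$ (i, j) = B $$ (i, j)" for A B
    using that by (intro eq_matI) auto
  have ent: "A $$ (i, j) \<in> carrier R" if "A \<in> carrier ?M" "i < n" "j < n" for A i j
    using that by auto
  have mclo: "A \<otimes>\<^bsub>?M\<^esub> B \<in> carrier ?M" if "A \<in> carrier ?M" "B \<in> carrier ?M" for A B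
    using that by (auto intro!: finsum_closed)
  have aclo: "A \<oplus>\<^bsub>?M\<^esub> B \<in> carrier ?M" if "A \<in> carrier ?M" "B \<in> carrier ?M" for A B
    using that by auto
  have uclo: "\<one>\<^bsub>?M\<^esub> \<in> carrier ?M" "\<zero>\<^bsub>?M\<^esub> \<in> carrier ?M" by auto
  note [simp del] = matrix_ring_sel
  note clo = mclo aclo uclo
  show ?thesis
  proof (rule ringI)
    show "abelian_group ?M"
    proof (rule abelian_groupI)
      fix A assume A: "A \<in> carrier ?M"
      have B: "mat n n (\<lambda>ij. \<ominus> (A $$ ij)) \<in> carrier ?M" using A by (auto simp: matrix_ring_sel)
      have "mat n n (\<lambda>ij. \<ominus> (A $$ ij)) \<oplus>\<^bsub>?M\<^esub> A = \<zero>\<^bsub>?M\<^esub>"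
        by (rule eqI) (use A B in \<open>auto simp: clo idx ent l_neg\<close>)
      then show "\<exists>B\<in>carrier ?M. B \<oplus>\<^bsub>?M\<^esub> A = \<zero>\<^bsub>?M\<^esub>" using B by blast
    next
      fix A B C assume A: "A \<in> carrier ?M" and B: "B \<in> carrier ?M" and C: "C \<in> carrier ?M"
      show "A \<oplus>\<^bsub>?M\<^esub> B \<oplus>\<^bsub>?M\<^esub> C = A \<oplus>\<^bsub>?M\<^esub> (B \<oplus>\<^bsub>?M\<^esub> C)"
        by (rule eqI) (use A B C in \<open>auto simp: clo idx ent a_assoc\<close>)
    next
      fix A B assume A: "A \<in> carrier ?M" and B: "B \<in> carrier ?M"
      show "A \<oplus>\<^bsub>?M\<^esub> B = B \<oplus>\<^bsub>?M\<^esub> A"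
        by (rule eqI) (use A B in \<open>auto simp: clo idx ent a_comm\<close>)
    next
      fix A assume A: "A \<in> carrier ?M"
      show "\<zero>\<^bsub>?M\<^esub> \<oplus>\<^bsub>?M\<^esub> A = A"
        by (rule eqI) (use A in \<open>auto simp: clo idx ent\<close>)
    qed (auto intro: clo)
    show "Group.monoid ?M"
    proof (rule monoidI)
      fix A B C assume A: "A \<in> carrier ?M" and B: "B \<in> carrier ?M" and C: "C \<in> carrier ?M"
      show "A \<otimes>\<^bsub>?M\<^esub> B \<otimes>\<^bsub>?M\<^esub> C = A \<otimes>\<^bsub>?M\<^esub> (B \<otimes>\<^bsub>?M\<^esub> C)"
      proof (rule eqI)
        fix i j assume ij: "i < n" "j < n"
        have "(A \<otimes>\<^bsub>?M\<^esub> B \<otimes>\<^bsub>?M\<^esub> C) $$ (i, j)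
            = (\<Oplus>k\<in>{..<n}. (\<Oplus>l\<in>{..<n}. A $$ (i, l) \<otimes> B $$ (l, k)) \<otimes> C $$ (k, j))"
          unfolding idx(1)[OF ij]
          by (rule finsum_cong'[OF refl]) (use ij A B C in \<open>auto simp: idx ent intro!: finsum_closed\<close>)
        also have "\<dots> = (\<Oplus>l\<in>{..<n}. A $$ (i, l) \<otimes> (\<Oplus>k\<in>{..<n}. B $$ (l, k) \<otimes> C $$ (k, j)))"
          by (rule finsum_mult_assoc) (use ij A B C in \<open>auto simp: ent\<close>)
        also have "\<dots> = (A \<otimes>\<^bsub>?M\<^esub> (B \<otimes>\<^bsub>?M\<^esub> C)) $$ (i, j)"
          unfolding idx(1)[OF ij]
          by (rule finsum_cong'[OF refl]) (use ij A B C mclo in \<open>auto simp: idx ent intro!: finsum_closed\<close>)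
        finally show "(A \<otimes>\<^bsub>?M\<^esub> B \<otimes>\<^bsub>?M\<^esub> C) $$ (i, j) = (A \<otimes>\<^bsub>?M\<^esub> (B \<otimes>\<^bsub>?M\<^esub> C)) $$ (i, j)" .
      qed (use A B C in \<open>auto intro!: clo\<close>)
    next
      fix A assume A: "A \<in> carrier ?M"
      show "\<one>\<^bsub>?M\<^esub> \<otimes>\<^bsub>?M\<^esub> A = A"
      proof (rule eqI)
        fix i j assume ij: "i < n" "j < n"
        have "(\<one>\<^bsub>?M\<^esub> \<otimes>\<^bsub>?M\<^esub> A) $$ (i, j) = (\<Oplus>k\<in>{..<n}. if i = k then A $$ (k, j) else \<zero>)"
          unfolding idx(1)[OF ij] by (rule finsum_cong'[OF refl]) (use ij A in \<open>auto simp: idx ent\<close>)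
        also have "\<dots> = A $$ (i, j)" by (rule finsum_singleton) (use ij A in \<open>auto simp: ent\<close>)
        finally show "(\<one>\<^bsub>?M\<^esub> \<otimes>\<^bsub>?M\<^esub> A) $$ (i, j) = A $$ (i, j)" .
      qed (use A in \<open>auto intro!: clo\<close>)
      show "A \<otimes>\<^bsub>?M\<^esub> \<one>\<^bsub>?M\<^esub> = A"
      proof (rule eqI)
        fix i j assume ij: "i < n" "j < n"
        have "(A \<otimes>\<^bsub>?M\<^esub> \<one>\<^bsub>?M\<^esub>) $$ (i, j) = (\<Oplus>k\<in>{..<n}. if j = k then A $$ (i, k) else \<zero>)"
          unfolding idx(1)[OF ij] by (rule finsum_cong'[OF refl]) (use ij A in \<open>auto simp: idx ent\<close>)
        also have "\<dots> = A $$ (i, j)" by (rule finsum_singleton) (use ij A in \<open>auto simp: ent\<close>)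
        finally show "(A \<otimes>\<^bsub>?M\<^esub> \<one>\<^bsub>?M\<^esub>) $$ (i, j) = A $$ (i, j)" .
      qed (use A in \<open>auto intro!: clo\<close>)
    qed (auto intro: clo)
  next
    fix A B C assume A: "A \<in> carrier ?M" and B: "B \<in> carrier ?M" and C: "C \<in> carrier ?M"
    show "(A \<oplus>\<^bsub>?M\<^esub> B) \<otimes>\<^bsub>?M\<^esub> C = A \<otimes>\<^bsub>?M\<^esub> C \<oplus>\<^bsub>?M\<^esub> B \<otimes>\<^bsub>?M\<^esub> C"
    proof (rule eqI)
      fix i j assume ij: "i < n" "j < n"
      have "((A \<oplus>\<^bsub>?M\<^esub> B) \<otimes>\<^bsub>?M\<^esub> C) $$ (i, j)
          = (\<Oplus>k\<in>{..<n}. A $$ (i, k) \<otimes> C $$ (k, j) \<oplus> B $$ (i, k) \<otimes> C $$ (k, j))"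
        unfolding idx(1)[OF ij] by (rule finsum_cong'[OF refl]) (use ij A B C in \<open>auto simp: idx ent l_distr\<close>)
      also have "\<dots> = (A \<otimes>\<^bsub>?M\<^esub> C \<oplus>\<^bsub>?M\<^esub> B \<otimes>\<^bsub>?M\<^esub> C) $$ (i, j)"
        unfolding idx(2)[OF ij] idx(1)[OF ij] by (rule finsum_addf) (use ij A B C in \<open>auto simp: ent\<close>)
      finally show "((A \<oplus>\<^bsub>?M\<^esub> B) \<otimes>\<^bsub>?M\<^esub> C) $$ (i, j) = (A \<otimes>\<^bsub>?M\<^esub> C \<oplus>\<^bsub>?M\<^esub> B \<otimes>\<^bsub>?M\<^esub> C) $$ (i, j)" .
    qed (use A B C in \<open>auto intro!: clo\<close>)
    show "C \<otimes>\<^bsub>?M\<^esub> (A \<oplus>\<^bsub>?M\<^esub> B) = C \<otimes>\<^bsub>?M\<^esub> A \<oplus>\<^bsub>?M\<^esub> C \<otimes>\<^bsub>?M\<^esub> B"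
    proof (rule eqI)
      fix i j assume ij: "i < n" "j < n"
      have "(C \<otimes>\<^bsub>?M\<^esub> (A \<oplus>\<^bsub>?M\<^esub> B)) $$ (i, j)
          = (\<Oplus>k\<in>{..<n}. C $$ (i, k) \<otimes> A $$ (k, j) \<oplus> C $$ (i, k) \<otimes> B $$ (k, j))"
        unfolding idx(1)[OF ij] by (rule finsum_cong'[OF refl]) (use ij A B C in \<open>auto simp: idx ent r_distr\<close>)
      also have "\<dots> = (C \<otimes>\<^bsub>?M\<^esub> A \<oplus>\<^bsub>?M\<^esub> C \<otimes>\<^bsub>?M\<^esub> B) $$ (i, j)"
        unfolding idx(2)[OF ij] idx(1)[OF ij] by (rule finsum_addf) (use ij A B C in \<open>auto simp: ent\<close>)
      finally show "(C \<otimes>\<^bsub>?M\<^esub> (A \<oplus>\<^bsub>?M\<^esub> B)) $$ (i, j) = (C \<otimes>\<^bsub>?M\<^esub> A \<oplus>\<^bsub>?M\<^esub> C \<otimes>\<^bsub>?M\<^esub> B) $$ (i, j)" .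
    qed (use A B C in \<open>auto intro!: clo\<close>)
  qed
qed

lemma rat_algebra_Q: "rat_algebra Q_ring (*)"
  by (rule rat_algebraI[OF ring_from_type_algebra]) (simp add: rat_action_def algebra_simps)

text \<open>Commutativity of \<open>K\<close> is what allows the scalar in front of the second
  factor to pass the first one, as the product law of \<open>rat_action\<close> demands.\<close>

lemma rat_algebra_hom:
  assumes "cring K" "j \<in> Ring.ring_hom Q_ring K"
  shows "rat_algebra K (\<lambda>q x. j q \<otimes>\<^bsub>K\<^esub> x)"
proof (rule rat_algebraI)
  interpret cring K by fact
  note [simp] = ring_hom_closed[OF assms(2)] ring_hom_add[OF assms(2), simplified] ring_hom_mult[OF assms(2), simplified]
  show "ring K" by (rule ring_axioms)
  show "rat_action K (\<lambda>q x. j q \<otimes>\<^bsub>K\<^esub> x)"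
    using ring_hom_one[OF assms(2)] by (simp add: rat_action_def l_distr r_distr m_ac)
qed

lemma rat_algebra_matrix:
  fixes R (structure)
  assumes "rat_algebra R act"
  shows "rat_algebra (matrix_ring n R) (\<lambda>q A. mat n n (\<lambda>ij. act q (A $$ ij)))"
proof (rule rat_algebraI)
  interpret rat_algebra R act by fact
  show "ring (matrix_ring n R)" by (rule ring_matrix_ring[OF ring_axioms])
  have act_sum: "act q (\<Oplus>k\<in>A. f k) = (\<Oplus>k\<in>A. act q (f k))" if "f \<in> A \<rightarrow> carrier R" for q f and A :: "nat set"
    using that
  proof (induction A rule: infinite_finite_induct)
    case (insert x F)
    then have "f \<in> F \<rightarrow> carrier R" "f x \<in> carrier R" by auto
    moreover have "(\<lambda>k. act q (f k)) \<in> F \<rightarrow> carrier R" using insert by auto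
    ultimately show ?case using insert by (simp add: act_add)
  qed auto
  have m: "act (q * r) (\<Oplus>k\<in>{..<n}. A $$ (i, k) \<otimes> B $$ (k, j)) =
      (\<Oplus>k\<in>{..<n}. mat n n (\<lambda>ij. act q (A $$ ij)) $$ (i, k) \<otimes> mat n n (\<lambda>ij. act r (B $$ ij)) $$ (k, j))"
    if "A \<in> carrier (matrix_ring n R)" "B \<in> carrier (matrix_ring n R)" "i < n" "j < n" for A B i j q r
  proof -
    have "act (q * r) (\<Oplus>k\<in>{..<n}. A $$ (i, k) \<otimes> B $$ (k, j)) = (\<Oplus>k\<in>{..<n}. act (q * r) (A $$ (i, k) \<otimes> B $$ (k, j)))"
      by (rule act_sum) (use that in auto)
    also have "\<dots> = (\<Oplus>k\<in>{..<n}. mat n n (\<lambda>ij. act q (A $$ ij)) $$ (i, k) \<otimes> mat n n (\<lambda>ij. act r (B $$ ij)) $$ (k, j))"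
      by (rule finsum_cong') (use that in \<open>auto simp: act_mult\<close>)
    finally show ?thesis .
  qed
  show "rat_action (matrix_ring n R) (\<lambda>q A. mat n n (\<lambda>ij. act q (A $$ ij)))"
    unfolding rat_action_def
  proof (intro conjI allI ballI)
    fix q r A B assume A: "A \<in> carrier (matrix_ring n R)" "B \<in> carrier (matrix_ring n R)"
    show "mat n n (\<lambda>ij. act (q * r) ((A \<otimes>\<^bsub>matrix_ring n R\<^esub> B) $$ ij)) =
       mat n n (\<lambda>ij. act q (A $$ ij)) \<otimes>\<^bsub>matrix_ring n R\<^esub> mat n n (\<lambda>ij. act r (B $$ ij))"
      by (rule eq_matI) (use m[OF A] in auto)
  qed (auto intro!: eq_matI simp: act_add add_act)
qed

lemma RDirProd_sel [simp]:
  "carrier (RDirProd R S) = carrier R \<times> carrier S"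
  "(a, b) \<otimes>\<^bsub>RDirProd R S\<^esub> (c, d) = (a \<otimes>\<^bsub>R\<^esub> c, b \<otimes>\<^bsub>S\<^esub> d)"
  "(a, b) \<oplus>\<^bsub>RDirProd R S\<^esub> (c, d) = (a \<oplus>\<^bsub>R\<^esub> c, b \<oplus>\<^bsub>S\<^esub> d)"
  "\<one>\<^bsub>RDirProd R S\<^esub> = (\<one>\<^bsub>R\<^esub>, \<one>\<^bsub>S\<^esub>)" "\<zero>\<^bsub>RDirProd R S\<^esub> = (\<zero>\<^bsub>R\<^esub>, \<zero>\<^bsub>S\<^esub>)"
  by (simp_all add: RDirProd_def DirProd_def monoid.defs)

lemma rat_algebra_RDirProd:
  assumes "rat_algebra R actR" "rat_algebra S actS"
  shows "rat_algebra (RDirProd R S) (\<lambda>q x. (actR q (fst x), actS q (snd x)))"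
proof (rule rat_algebraI)
  interpret R: rat_algebra R actR by fact
  interpret S: rat_algebra S actS by fact
  show "ring (RDirProd R S)" by (rule RDirProd_ring[OF R.ring_axioms S.ring_axioms])
  show "rat_action (RDirProd R S) (\<lambda>q x. (actR q (fst x), actS q (snd x)))"
    by (auto simp: rat_action_def R.act_add R.add_act R.act_mult S.act_add S.add_act S.act_mult)
qed

lemma ring_hom_RDirProd:
  assumes "f \<in> Ring.ring_hom P R" "g \<in> Ring.ring_hom P S"
  shows "(\<lambda>x. (f x, g x)) \<in> Ring.ring_hom P (RDirProd R S)"
  using assms by (auto simp: Ring.ring_hom_def)

text \<open>A component of the tree that consists of one vertex contributes a block of size 1, which
  the final statement lists as the ring of rationals itself.\<close>

lemma matrix_ring_1_iso:
  fixes R (structure)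
  assumes "ring R"
  shows "matrix_ring (Suc 0) R \<simeq> R"
proof -
  interpret ring R by fact
  have "(\<lambda>A. A $$ (0, 0)) \<in> ring_iso (matrix_ring (Suc 0) R) R"
    unfolding ring_iso_def
  proof (intro CollectI conjI)
    show "(\<lambda>A. A $$ (0, 0)) \<in> Ring.ring_hom (matrix_ring (Suc 0) R) R"
      by (rule ring_hom_memI) (auto simp: lessThan_Suc)
    show "bij_betw (\<lambda>A. A $$ (0, 0)) (carrier (matrix_ring (Suc 0) R)) (carrier R)"
      by (rule bij_betw_byWitness[of _ "\<lambda>x. mat (Suc 0) (Suc 0) (\<lambda>_. x)"]) (auto intro!: eq_matI)
  qed
  then show ?thesis by (auto simp: is_ring_iso_def)
qed

section \<open>Integer polynomials\<close>

abbreviation ipoly :: "int poly \<Rightarrow> 'a::comm_ring_1 poly" where "ipoly \<equiv> map_poly of_int"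

lemma map_poly_hom:
  fixes h :: "'a::comm_ring_1 \<Rightarrow> 'b::comm_ring_1"
  assumes "h 0 = 0" "\<And>x y. h (x + y) = h x + h y" "\<And>x y. h (x * y) = h x * h y"
  shows "map_poly h (p + q) = map_poly h p + map_poly h q"
    and "map_poly h (p * q) = map_poly h p * map_poly h q"
proof -
  have h_sum: "h (sum f A) = (\<Sum>i\<in>A. h (f i))" for f and A :: "nat set"
    by (induction A rule: infinite_finite_induct) (auto simp: assms)
  show "map_poly h (p + q) = map_poly h p + map_poly h q"
    by (rule poly_eqI) (simp add: coeff_map_poly assms)
  show "map_poly h (p * q) = map_poly h p * map_poly h q"
    by (rule poly_eqI) (simp add: coeff_map_poly assms coeff_mult h_sum)
qed

lemmas ipoly_add [simp] = map_poly_hom(1)[of of_int, simplified]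
lemmas ipoly_mult [simp] = map_poly_hom(2)[of of_int, simplified]

lemma ipoly_1 [simp]: "ipoly 1 = (1 :: 'a::comm_ring_1 poly)"
  by (simp add: map_poly_1)

lemma ipoly_diff [simp]: "ipoly (p - q) = (ipoly p - ipoly q :: 'a::comm_ring_1 poly)"
  using ipoly_add[of "p - q" q, where 'a = 'a] by (simp add: algebra_simps)

lemma ipoly_smult [simp]: "ipoly (Polynomial.smult c p) = (Polynomial.smult (of_int c) (ipoly p) :: 'a::comm_ring_1 poly)"
  by (rule poly_eqI) (simp add: coeff_map_poly)

lemma ipoly_pCons [simp]: "ipoly (pCons c p) = (pCons (of_int c) (ipoly p) :: 'a::comm_ring_1 poly)"
  by (rule poly_eqI) (simp add: coeff_map_poly coeff_pCons split: nat.splits)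

lemma ipoly_eq_iff [simp]: "ipoly p = (ipoly q :: 'a::{comm_ring_1,ring_char_0} poly) \<longleftrightarrow> p = q"
  by (auto simp: poly_eq_iff coeff_map_poly)

lemma rat_poly_common_denominator: "\<exists>n>0. \<exists>q. Polynomial.smult (rat_of_int n) p = ipoly q"
proof (induction p)
  case 0
  show ?case by (intro exI[of _ 1] conjI exI[of _ 0]) auto
next
  case (pCons a p)
  then obtain n q where n: "n > 0" "Polynomial.smult (rat_of_int n) p = ipoly q" by blast
  obtain m d where md: "quotient_of a = (m, d)" by fastforce
  then have d: "d > 0" and a: "a = of_int m / of_int d"
    using quotient_of_denom_pos quotient_of_div by blast+
  have "Polynomial.smult (rat_of_int (n * d)) (pCons a p) = pCons (of_int (n * m)) (Polynomial.smult (of_int d) (Polynomial.smult (of_int n) p))"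
    using d by (simp add: a mult_ac)
  also have "\<dots> = ipoly (pCons (n * m) (Polynomial.smult d q))" by (simp add: n)
  finally have "Polynomial.smult (rat_of_int (n * d)) (pCons a p) = ipoly (pCons (n * m) (Polynomial.smult d q))" .
  moreover have "n * d > 0" using n d by simp
  ultimately show ?case by blast
qed

lemma smult_left_cancel: "c \<noteq> 0 \<Longrightarrow> Polynomial.smult c p = Polynomial.smult c q \<Longrightarrow> p = (q :: 'a::idom poly)"
  by (simp add: poly_eq_iff)

lemma content_monic: "Polynomial.lead_coeff f = (1::int) \<Longrightarrow> content f = 1"
  by (metis is_unit_content_iff content_dvd_coeff)

text \<open>Gauss's lemma. Clearing denominators gives n h = f q' over the integers; f has content
  1, so n divides the content of q' and can be cancelled. This identifies the integral ideal with
  the kernel of a map into a rational algebra.\<close>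

lemma monic_dvd_int_of_dvd_rat:
  fixes f h :: "int poly"
  assumes f: "Polynomial.lead_coeff f = 1" and dvd: "ipoly f dvd (ipoly h :: rat poly)"
  shows "f dvd h"
proof -
  from dvd obtain q where q: "ipoly h = ipoly f * (q :: rat poly)" by (elim dvdE)
  obtain n q' where n: "n > 0" "Polynomial.smult (rat_of_int n) q = ipoly q'" using rat_poly_common_denominator by blast
  have "ipoly (Polynomial.smult n h) = (ipoly (f * q') :: rat poly)" by (simp add: q n(2)[symmetric])
  then have e: "Polynomial.smult n h = f * q'" by (simp only: ipoly_eq_iff)
  then have "content (Polynomial.smult n h) = content (f * q')" by simp
  then have "n * content h = content q'" using n(1) by (simp add: content_mult content_monic[OF f])
  then have "[:n:] dvd q'" unfolding const_poly_dvd_iff_dvd_content using dvd_triv_left[of n "content h"] by simp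
  then obtain r where "q' = [:n:] * r" by (elim dvdE)
  with e have "Polynomial.smult n h = Polynomial.smult n (f * r)" by simp
  then have "h = f * r" using n(1) smult_left_cancel[of n h "f * r"] by blast
  then show ?thesis by simp
qed

text \<open>Gauss's lemma for a factorization into monic factors p and q. Scaling by n and m gives
  integral P and Q whose contents multiply to n m. The leading coefficients of P and Q are n and m,
  so the contents divide n and m respectively and must equal them; thus n divides out of P.\<close>

lemma monic_rat_factor_integral:
  fixes p :: "rat poly"
  assumes p: "Polynomial.lead_coeff p = 1" and g: "Polynomial.lead_coeff g = (1::int)" and dvd: "p dvd ipoly g"
  shows "\<exists>P. ipoly P = p"
proof -
  from dvd obtain q where q: "ipoly g = p * q" by (elim dvdE)
  have lg: "Polynomial.lead_coeff (ipoly g :: rat poly) = 1"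
    using g by (simp add: degree_map_poly coeff_map_poly)
  have lq: "Polynomial.lead_coeff q = 1" using lg p by (simp add: q lead_coeff_mult)
  obtain n P where n: "n > 0" "Polynomial.smult (rat_of_int n) p = ipoly P" using rat_poly_common_denominator by blast
  obtain m Q where m: "m > 0" "Polynomial.smult (rat_of_int m) q = ipoly Q" using rat_poly_common_denominator by blast
  have "ipoly (P * Q) = Polynomial.smult (rat_of_int n) p * Polynomial.smult (rat_of_int m) q" by (simp add: n m)
  also have "\<dots> = ipoly (Polynomial.smult (n * m) g)" by (simp add: q mult_ac)
  finally have "P * Q = Polynomial.smult (n * m) g" by (simp only: ipoly_eq_iff)
  then have "content (P * Q) = content (Polynomial.smult (n * m) g)" by simp
  then have c: "content P * content Q = n * m" using n m by (simp add: content_mult content_monic[OF g])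
  have "rat_of_int (Polynomial.coeff P (Polynomial.degree p)) = of_int n" "rat_of_int (Polynomial.coeff Q (Polynomial.degree q)) = of_int m"
    using arg_cong[OF n(2), of "\<lambda>r. Polynomial.coeff r (Polynomial.degree p)"] arg_cong[OF m(2), of "\<lambda>r. Polynomial.coeff r (Polynomial.degree q)"] p lq
    by (simp_all add: coeff_map_poly)
  then have "Polynomial.coeff P (Polynomial.degree p) = n" "Polynomial.coeff Q (Polynomial.degree q) = m" by simp_all
  then have dv: "content P dvd n" "content Q dvd m" by (metis content_dvd_coeff)+
  obtain k where k: "n = content P * k" using dv(1) by (elim dvdE)
  obtain l where l: "m = content Q * l" using dv(2) by (elim dvdE)
  have "content P > 0" "content Q > 0"
    using n m k l normalize_content[of P] normalize_content[of Q] by (auto simp: abs_if less_le split: if_splits)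
  moreover have "content P * content Q * (k * l) = content P * content Q" using c k l by (simp add: mult_ac)
  ultimately have "k * l = 1" by (metis mult_cancel_left1 mult_pos_pos less_irrefl mult.right_neutral)
  moreover have "k > 0" using k n(1) \<open>content P > 0\<close> by (simp add: zero_less_mult_iff)
  ultimately have "k = 1" by (simp add: zmult_eq_1_iff)
  then have "content P = n" using k by simp
  then have "[:n:] dvd P" unfolding const_poly_dvd_iff_dvd_content by simp
  then obtain P' where "P = [:n:] * P'" by (elim dvdE)
  then have "Polynomial.smult (rat_of_int n) p = Polynomial.smult (rat_of_int n) (ipoly P')" using n(2) by simp
  then have "ipoly P' = p" using n(1) smult_left_cancel[of "rat_of_int n" p "ipoly P'"] by simp
  then show ?thesis by blast
qed

section \<open>Minimal polynomials of cosines\<close>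

lemma poly_of_rat_hom:
  "poly (map_poly of_rat (p + q)) x = poly (map_poly of_rat p) x + poly (map_poly of_rat q) (x::real)"
  "poly (map_poly of_rat (p * q)) x = poly (map_poly of_rat p) x * poly (map_poly of_rat q) x"
  "poly (map_poly of_rat (p - q)) x = poly (map_poly of_rat p) x - poly (map_poly of_rat q) x"
proof -
  note h = map_poly_hom[of "of_rat :: rat \<Rightarrow> real", OF of_rat_0 of_rat_add of_rat_mult]
  show "poly (map_poly of_rat (p + q)) x = poly (map_poly of_rat p) x + poly (map_poly of_rat q) x"
    "poly (map_poly of_rat (p * q)) x = poly (map_poly of_rat p) x * poly (map_poly of_rat q) x"
    by (simp_all add: h)
  show "poly (map_poly of_rat (p - q)) x = poly (map_poly of_rat p) x - poly (map_poly of_rat q) x"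
    using arg_cong[OF h(1)[of "p - q" q], of "\<lambda>r. poly r x"] by simp
qed

text \<open>The condition inside the definite description of \<open>rat_min_poly\<close>, named so
  that existence and uniqueness can be stated for it.\<close>

definition is_rat_min_poly :: "rat poly \<Rightarrow> real \<Rightarrow> bool" where
  "is_rat_min_poly p x \<longleftrightarrow> Polynomial.lead_coeff p = 1 \<and> poly (map_poly of_rat p) x = 0 \<and>
     (\<forall>q. q \<noteq> 0 \<and> poly (map_poly of_rat q) x = 0 \<longrightarrow> Polynomial.degree p \<le> Polynomial.degree q)"

text \<open>Minimality forces equal degrees. If the two monic polynomials differed, their leading
  terms would cancel, leaving a nonzero polynomial of smaller degree with the same root.\<close>

lemma is_rat_min_poly_unique:
  assumes "is_rat_min_poly p x" "is_rat_min_poly q x"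
  shows "p = q"
proof (rule ccontr)
  assume "p \<noteq> q"
  then have d: "p - q \<noteq> 0" by simp
  have deg: "Polynomial.degree p = Polynomial.degree q"
    using assms unfolding is_rat_min_poly_def by (metis le_antisym leading_coeff_0_iff zero_neq_one)
  have "poly (map_poly of_rat (p - q)) x = 0"
    using assms by (simp add: is_rat_min_poly_def poly_of_rat_hom)
  then have "Polynomial.degree p \<le> Polynomial.degree (p - q)" using assms(1) d by (simp add: is_rat_min_poly_def)
  moreover have "Polynomial.degree (p - q) \<le> Polynomial.degree p" using deg by (simp add: degree_diff_le)
  ultimately have "Polynomial.degree (p - q) = Polynomial.degree p" by simp
  then have "Polynomial.lead_coeff (p - q) = Polynomial.lead_coeff p - Polynomial.lead_coeff q" using deg by simp
  then have "Polynomial.lead_coeff (p - q) = 0"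
    using assms by (simp only: is_rat_min_poly_def diff_self)
  then show False using d by (simp only: leading_coeff_0_iff)
qed

lemma rat_min_poly_eqI: "is_rat_min_poly p x \<Longrightarrow> rat_min_poly x = p"
  unfolding rat_min_poly_def using is_rat_min_poly_unique
  by (intro the_equality) (auto simp: is_rat_min_poly_def)

lemma is_rat_min_poly_exists:
  assumes "q \<noteq> 0" "poly (map_poly of_rat q) x = 0"
  shows "\<exists>p. is_rat_min_poly p x"
proof -
  have "\<exists>q. (q \<noteq> 0 \<and> poly (map_poly of_rat q) x = 0) \<and>
      (\<forall>r. (r \<noteq> 0 \<and> poly (map_poly of_rat r) x = 0) \<longrightarrow> Polynomial.degree q \<le> Polynomial.degree r)"
    by (rule ex_has_least_nat[of "\<lambda>q. q \<noteq> 0 \<and> poly (map_poly of_rat q) x = 0" q Polynomial.degree]) (use assms in simp)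
  then obtain q where q: "q \<noteq> 0" "poly (map_poly of_rat q) x = 0"
    "\<And>r. r \<noteq> 0 \<Longrightarrow> poly (map_poly of_rat r) x = 0 \<Longrightarrow> Polynomial.degree q \<le> Polynomial.degree r" by blast
  have "is_rat_min_poly ([:inverse (Polynomial.lead_coeff q):] * q) x"
    unfolding is_rat_min_poly_def poly_of_rat_hom using q by (simp add: lead_coeff_mult)
  then show ?thesis by blast
qed

lemma is_rat_min_poly_dvd:
  assumes "is_rat_min_poly p x" "poly (map_poly of_rat q) x = 0"
  shows "p dvd q"
proof (rule ccontr)
  assume "\<not> p dvd q"
  then have r: "q mod p \<noteq> 0" by (simp add: dvd_eq_mod_eq_0)
  have p0: "p \<noteq> 0" using assms(1) by (auto simp: is_rat_min_poly_def)
  have "poly (map_poly of_rat (q - q div p * p)) x = 0"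
    using assms unfolding poly_of_rat_hom is_rat_min_poly_def by simp
  then have "poly (map_poly of_rat (q mod p)) x = 0" by (simp only: minus_div_mult_eq_mod)
  then have "Polynomial.degree p \<le> Polynomial.degree (q mod p)" using assms(1) r by (simp add: is_rat_min_poly_def)
  then show False using degree_mod_less[of p q] p0 r by simp
qed

text \<open>If t divided p, then p/t would still vanish at the nonzero number x and have smaller
  degree.\<close>

lemma is_rat_min_poly_nonzero_at_0:
  assumes "is_rat_min_poly p x" "x \<noteq> 0"
  shows "poly p 0 \<noteq> 0"
proof
  assume "poly p 0 = 0"
  then obtain q where q: "p = [:0, 1:] * q" unfolding poly_eq_0_iff_dvd by (auto elim: dvdE)
  have p0: "p \<noteq> 0" using assms(1) by (auto simp: is_rat_min_poly_def)
  then have q0: "q \<noteq> 0" by (auto simp: q)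
  have "poly (map_poly of_rat q) x = 0"
    using assms unfolding is_rat_min_poly_def q poly_of_rat_hom by (simp add: map_poly_pCons)
  then have "Polynomial.degree p \<le> Polynomial.degree q" using assms(1) q0 by (simp add: is_rat_min_poly_def)
  then show False using q0 by (simp add: q degree_mult_eq del: mult_pCons_left)
qed

text \<open>Chebyshev polynomials, shifted so that the variable is \<open>2 + 2 cos \<theta>\<close>.\<close>

fun cheb :: "nat \<Rightarrow> int poly" where
  "cheb 0 = 2"
| "cheb (Suc 0) = [:-2, 1:]"
| "cheb (Suc (Suc k)) = [:-2, 1:] * cheb (Suc k) - cheb k"

lemma ipoly_of_rat: "map_poly of_rat (ipoly p) = (ipoly p :: real poly)"
  by (rule poly_eqI) (simp add: coeff_map_poly)

text \<open>The recursion of \<open>cheb\<close> is cos((k+2)\<theta>) + cos(k\<theta>) = 2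
  cos(\<theta>) cos((k+1)\<theta>), with t - 2 standing for 2 cos(\<theta>).\<close>

lemma poly_cheb: "poly (ipoly (cheb k)) (2 + 2 * cos \<theta>) = 2 * cos (real k * \<theta>)"
proof (induction k rule: cheb.induct)
  case 1
  have "ipoly (2 :: int poly) = (2 :: real poly)"
    using ipoly_add[of 1 1, where 'a = real] by (simp only: ipoly_1 one_add_one)
  then show ?case by simp
next
  case (3 k)
  have "cos (real (Suc (Suc k)) * \<theta>) + cos (real k * \<theta>) = 2 * cos \<theta> * cos (real (Suc k) * \<theta>)"
    using cos_plus_cos[of "real (Suc (Suc k)) * \<theta>" "real k * \<theta>"] by (simp add: algebra_simps add_divide_distrib)
  then show ?case using 3 by (simp add: algebra_simps del: of_nat_Suc)
qed simp

text \<open>The index starts at 1 because \<open>cheb 0\<close> is the constant 2, which is not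
  monic. For the same reason the bound on the lower term of the recursion treats index 0
  separately.\<close>

lemma cheb_monic: "Polynomial.degree (cheb (Suc k)) = Suc k \<and> Polynomial.lead_coeff (cheb (Suc k)) = 1"
proof (induction k rule: less_induct)
  case (less k)
  show ?case
  proof (cases k)
    case (Suc j)
    have ih: "Polynomial.degree (cheb (Suc j)) = Suc j" "Polynomial.lead_coeff (cheb (Suc j)) = 1"
      using less[of j] Suc by auto
    then have nz: "cheb (Suc j) \<noteq> 0" by (metis degree_0 nat.distinct(1))
    have d1: "Polynomial.degree ([:-2, 1:] * cheb (Suc j)) = Suc (Suc j)"
      by (subst degree_mult_eq) (use nz ih in auto)
    have l1: "Polynomial.lead_coeff ([:-2, 1:] * cheb (Suc j)) = 1"
      unfolding lead_coeff_mult using ih by simp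
    have "Polynomial.degree (cheb j) < Suc (Suc j)"
    proof (cases j)
      case (Suc i)
      then show ?thesis using less[of i] \<open>k = Suc j\<close> by simp
    qed (use numeral_poly[of "num.Bit0 num.One"] in \<open>simp\<close>)
    then have dd: "Polynomial.degree (- cheb j) < Polynomial.degree ([:-2, 1:] * cheb (Suc j))" unfolding d1 by simp
    have e: "cheb (Suc k) = [:-2, 1:] * cheb (Suc j) + (- cheb j)" using Suc by simp
    have "Polynomial.coeff (- cheb j) (Suc (Suc j)) = 0" using dd unfolding d1 by (rule coeff_eq_0)
    then show ?thesis unfolding e degree_add_eq_left[OF dd] unfolding d1 coeff_add using Suc l1[unfolded d1] by simp
  qed simp
qed

lemma four_cos_square: "4 * (cos (pi / real n))\<^sup>2 = 2 + 2 * cos (2 * pi / real n)"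
  using cos_double_cos[of "pi / real n"] by (simp add: algebra_simps)

text \<open>At 2 + 2 cos(2 pi/n) the n-th shifted Chebyshev polynomial has the value 2 cos(2 pi) =
  2, so subtracting 2 gives a monic integral polynomial with the required root. Hence a minimal
  polynomial exists and divides it, and Gauss's lemma makes it integral. This settles both definite
  descriptions behind \<open>C_poly\<close>.\<close>

lemma is_rat_min_poly_C_poly:
  assumes "n \<ge> 1"
  shows "is_rat_min_poly (ipoly (C_poly n)) (4 * (cos (pi / real n))\<^sup>2)"
proof -
  define x where "x = 4 * (cos (pi / real n))\<^sup>2"
  define g where "g = cheb n + [:-2:]"
  obtain k where k: "n = Suc k" using assms by (cases n) auto
  have dl: "Polynomial.degree [:-2::int:] < Polynomial.degree (cheb n)" using cheb_monic[of k] k by simp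
  have dg: "Polynomial.degree g = n"
    unfolding g_def degree_add_eq_left[OF dl] using cheb_monic[of k] k by simp
  have "Polynomial.coeff [:-2::int:] n = 0" using k by simp
  then have lg: "Polynomial.lead_coeff g = 1"
    unfolding dg unfolding g_def coeff_add using cheb_monic[of k] k by (auto simp del: cheb.simps)
  have "poly (ipoly g) x = 2 * cos (real n * (2 * pi / real n)) - 2"
    unfolding x_def four_cos_square g_def by (simp add: poly_cheb)
  also have "\<dots> = 0" using assms by simp
  finally have root: "poly (map_poly of_rat (ipoly g)) x = 0" by (simp add: ipoly_of_rat)
  have "g \<noteq> 0" using lg by auto
  then have "ipoly g \<noteq> (0 :: rat poly)" using ipoly_eq_iff[of g 0, where 'a = rat] by simp
  from is_rat_min_poly_exists[OF this root] obtain p where p: "is_rat_min_poly p x" by blast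
  from monic_rat_factor_integral[OF _ lg is_rat_min_poly_dvd[OF p root]] p
  obtain P where P: "ipoly P = p" by (auto simp: is_rat_min_poly_def)
  have "C_poly n = P"
    unfolding C_poly_def x_def[symmetric] rat_min_poly_eqI[OF p] P[symmetric] by simp
  then show ?thesis using p P by (simp add: x_def)
qed

lemma C_poly_monic: "n \<ge> 1 \<Longrightarrow> Polynomial.lead_coeff (C_poly n) = 1"
  using is_rat_min_poly_C_poly[of n] by (simp add: is_rat_min_poly_def degree_map_poly coeff_map_poly)

text \<open>For n \<ge> 3 the angle pi/n lies strictly below pi/2, so the root 4 cos^2(pi/n) is not
  0.\<close>

lemma C_poly_0: assumes "n \<ge> 3" shows "poly (C_poly n) 0 \<noteq> 0"
proof -
  have "cos (pi / real n) > 0"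
    by (rule cos_gt_zero) (use assms in \<open>auto simp: field_simps\<close>)
  then have "poly (ipoly (C_poly n)) (0::rat) \<noteq> 0"
    using is_rat_min_poly_nonzero_at_0[OF is_rat_min_poly_C_poly[of n]] assms by simp
  then show ?thesis by (simp add: poly_0_coeff_0 coeff_map_poly)
qed

text \<open>No nonzero constant has a root, so the linear polynomial t - c has the least possible
  degree.\<close>

lemma C_poly_rational:
  assumes "n \<ge> 1" "4 * (cos (pi / real n))\<^sup>2 = of_int c"
  shows "C_poly n = [:- c, 1:]"
proof -
  have "is_rat_min_poly (ipoly [:- c, 1:]) (of_int c)"
    unfolding is_rat_min_poly_def
  proof (intro conjI allI impI)
    fix q assume q: "q \<noteq> 0 \<and> poly (map_poly of_rat q) (real_of_int c) = 0"
    show "Polynomial.degree (ipoly [:- c, 1:] :: rat poly) \<le> Polynomial.degree q"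
    proof (rule ccontr)
      assume "\<not> ?thesis"
      then have "Polynomial.degree q = 0" by simp
      then obtain a where "q = [:a:]" by (elim degree_eq_zeroE)
      then show False using q by (simp add: map_poly_pCons)
    qed
  qed (simp_all add: map_poly_pCons of_rat_minus)
  then have "ipoly (C_poly n) = (ipoly [:- c, 1:] :: rat poly)"
    using is_rat_min_poly_unique[OF is_rat_min_poly_C_poly[OF assms(1)]] assms(2) by metis
  then show ?thesis by (simp only: ipoly_eq_iff)
qed

lemma C_poly_3: "C_poly 3 = [:-1, 1:]"
  using C_poly_rational[of 3 1] by (simp add: cos_60 power2_eq_square)
lemma C_poly_4: "C_poly 4 = [:-2, 1:]"
  using C_poly_rational[of 4 2] by (simp add: cos_45 power_divide)
lemma C_poly_6: "C_poly 6 = [:-3, 1:]"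
  using C_poly_rational[of 6 3] by (simp add: cos_30 power_divide)

lemma c_poly_monic: assumes "n \<ge> 1" shows "Polynomial.lead_coeff (c_poly n) = 1"
  unfolding c_poly_def lead_coeff_prod by (rule prod.neutral) (auto simp: C_poly_monic)

lemma c_poly_0: assumes "n \<ge> 1" shows "poly (c_poly n) 0 \<noteq> 0"
proof -
  have "finite {N. 3 \<le> N \<and> N dvd n}" by (rule finite_subset[of _ "{..n}"]) (use assms in \<open>auto dest: dvd_imp_le\<close>)
  then show ?thesis unfolding c_poly_def poly_prod by (auto simp: C_poly_0)
qed

text \<open>Each of 3, 4 and 5 has only itself as a divisor \<ge> 3. At 6 this breaks down, since 3
  divides 6.\<close>

lemma c_poly_eq_C_poly: assumes "n \<in> {3, 4, 5}" shows "c_poly n = C_poly n"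
proof -
  have "{N. 3 \<le> N \<and> N dvd n} = {n}"
  proof -
    have "N = n" if N: "3 \<le> N" "N dvd n" for N
    proof -
      obtain k where k: "n = N * k" using N(2) by (elim dvdE)
      have "k < 2"
      proof (rule ccontr)
        assume "\<not> k < 2"
        then have "3 * 2 \<le> N * k" using N(1) by (intro mult_le_mono) auto
        then show False using assms k by auto
      qed
      moreover have "k \<noteq> 0"
      proof
        assume "k = 0"
        then show False using assms k by simp
      qed
      ultimately have "k = 1" by simp
      then show ?thesis using k by simp
    qed
    then show ?thesis using assms by auto
  qed
  then show ?thesis by (simp add: c_poly_def)
qed

section \<open>Path algebras\<close>

lemma (in pre_digraph) awlast_append: "awlast u (p @ q) = awlast (awlast u p) q"
  by (induction p arbitrary: u) auto

lemma (in pre_digraph) cas_awlast: "cas u p v \<Longrightarrow> awlast u p = v"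
  by (induction p arbitrary: u) auto

lemma (in wf_digraph) graph_paths_iff: "(u, p) \<in> graph_paths G \<longleftrightarrow> awalk u p (awlast u p)"
  by (auto simp: graph_paths_def awalk_def cas_awlast)

lemma path_algebra_sel [simp]:
  "carrier (path_algebra G) = {f. Poly_Mapping.keys f \<subseteq> graph_paths G}"
  "monoid.mult (path_algebra G) = basis_mult (path_concat G)"
  "one (path_algebra G) = (\<Sum>s\<in>verts G. vertex_path s)"
  "ring.zero (path_algebra G) = 0"
  "add (path_algebra G) = (+)"
  by (simp_all add: path_algebra_def)

lemma keys_sum_subset:
  "(\<And>i. i \<in> A \<Longrightarrow> Poly_Mapping.keys (f i) \<subseteq> B) \<Longrightarrow> Poly_Mapping.keys (sum f A) \<subseteq> B"
proof (induction A rule: infinite_finite_induct)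
  case (insert x F)
  then show ?case using Poly_Mapping.keys_add[of "f x" "sum f F"] by auto
qed auto

text \<open>In a product of the unit with a path exactly one vertex path survives: that of the
  origin on the left, that of the terminus on the right.\<close>

lemma ring_path_algebra:
  fixes G :: "('v, 'e) pre_digraph"
  assumes "wf_digraph G" "finite (verts G)"
  shows "ring (path_algebra G :: (('v, 'e) path \<Rightarrow>\<^sub>0 'a::comm_ring_1) ring)"
proof -
  interpret wf_digraph G by fact
  let ?e = "\<Sum>s\<in>verts G. vertex_path s :: ('v, 'e) path \<Rightarrow>\<^sub>0 'a"
  show ?thesis unfolding path_algebra_def
  proof (rule ring_basis_algebra)
    fix p q r assume "p \<in> graph_paths G" "q \<in> graph_paths G" and r: "path_concat G p q = Some r"
    moreover obtain u x v y where pq: "p = (u, x)" "q = (v, y)" by fastforce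
    ultimately have "awalk u x (awlast u x)" "awalk v y (awlast v y)" by (simp_all add: graph_paths_iff)
    moreover have "awlast u x = v" "r = (u, x @ y)" using r by (simp_all add: pq split: if_splits)
    ultimately show "r \<in> graph_paths G" by (auto simp: graph_paths_iff awlast_append intro: awalk_appendI)
  next
    fix p q r assume "p \<in> graph_paths G" "q \<in> graph_paths G" "r \<in> graph_paths G"
    obtain u x v y w z where "p = (u, x)" "q = (v, y)" "r = (w, z)" by (metis surj_pair)
    then show "Option.bind (path_concat G p q) (\<lambda>p. path_concat G p r) =
        Option.bind (path_concat G q r) (path_concat G p)"
      by (auto simp: awlast_append)
  next
    show "Poly_Mapping.keys ?e \<subseteq> graph_paths G"
      by (rule keys_sum_subset) (auto simp: graph_paths_iff awalk_def)
  next
    fix p and c :: 'a assume p: "p \<in> graph_paths G"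
    obtain u x where pu: "p = (u, x)" by fastforce
    have w: "awalk u x (awlast u x)" using p by (simp add: pu graph_paths_iff)
    have "basis_mult (path_concat G) ?e (Poly_Mapping.single p c) = (\<Sum>s\<in>verts G. if s = u then Poly_Mapping.single p c else 0)"
      unfolding basis_mult_sum by (rule sum.cong) (auto simp: basis_mult_single pu)
    also have "\<dots> = Poly_Mapping.single p c" using w assms(2) by (auto simp: awalk_def)
    finally show "basis_mult (path_concat G) ?e (Poly_Mapping.single p c) = Poly_Mapping.single p c" .
    have "basis_mult (path_concat G) (Poly_Mapping.single p c) ?e = (\<Sum>s\<in>verts G. if s = awlast u x then Poly_Mapping.single p c else 0)"
      unfolding basis_mult_sum by (rule sum.cong) (auto simp: basis_mult_single pu)
    also have "\<dots> = Poly_Mapping.single p c" using w assms(2) by (auto dest: awalkE)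
    finally show "basis_mult (path_concat G) (Poly_Mapping.single p c) ?e = Poly_Mapping.single p c" .
  qed
qed

text \<open>Substitutes the basis element \<open>w k\<close> for t^k. Relations at an edge, zigzags
  along \<open>{a, b}\<close> and normal forms of paths are all written this way, each with its own
  family \<open>w\<close>.\<close>

definition lift_poly :: "(nat \<Rightarrow> 'b) \<Rightarrow> int poly \<Rightarrow> ('b \<Rightarrow>\<^sub>0 int)" where
  "lift_poly w q = (\<Sum>k\<le>Polynomial.degree q. Poly_Mapping.single (w k) (Polynomial.coeff q k))"

lemma lift_poly_superset:
  "Polynomial.degree q \<le> n \<Longrightarrow> lift_poly w q = (\<Sum>k\<le>n. Poly_Mapping.single (w k) (Polynomial.coeff q k))"
  unfolding lift_poly_def by (rule sum.mono_neutral_left) (auto simp: coeff_eq_0)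

lemma lift_poly_add: "lift_poly w (p + q) = lift_poly w p + lift_poly w q"
proof -
  let ?n = "max (Polynomial.degree p) (Polynomial.degree q)"
  have "Polynomial.degree (p + q) \<le> ?n" by (rule degree_add_le_max)
  then show ?thesis
    by (simp add: lift_poly_superset[of _ ?n] single_add sum.distrib)
qed

lemma lift_poly_0 [simp]: "lift_poly w 0 = 0"
  by (simp add: lift_poly_def)

lemma lift_poly_sum: "lift_poly w (sum f A) = (\<Sum>i\<in>A. lift_poly w (f i))"
  by (induction A rule: infinite_finite_induct) (auto simp: lift_poly_add)

lemma lift_poly_monom_mult:
  "lift_poly w (Polynomial.monom c j * f) = (\<Sum>k\<le>Polynomial.degree f. Poly_Mapping.single (w (j + k)) (c * Polynomial.coeff f k))"
proof -
  have "Polynomial.degree (Polynomial.monom c j * f) \<le> j + Polynomial.degree f"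
    by (rule order.trans[OF degree_mult_le]) (simp add: degree_monom_le)
  then have "lift_poly w (Polynomial.monom c j * f) =
      (\<Sum>k\<le>j + Polynomial.degree f. Poly_Mapping.single (w k) (if k < j then 0 else c * Polynomial.coeff f (k - j)))"
    by (simp add: lift_poly_superset coeff_monom_mult)
  also have "\<dots> = (\<Sum>k\<in>{j..j + Polynomial.degree f}. Poly_Mapping.single (w k) (c * Polynomial.coeff f (k - j)))"
    by (rule sum.mono_neutral_cong_right) auto
  also have "\<dots> = (\<Sum>k\<le>Polynomial.degree f. Poly_Mapping.single (w (j + k)) (c * Polynomial.coeff f k))"
    by (rule sum.reindex_bij_witness[of _ "\<lambda>k. j + k" "\<lambda>k. k - j"]) auto
  finally show ?thesis .
qed

lemma lift_poly_monom: "lift_poly w (Polynomial.monom c j) = Poly_Mapping.single (w j) c"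
  using lift_poly_monom_mult[of w c j 1] by simp

text \<open>Each monomial of q contributes a copy of f shifted along the family \<open>w\<close>.
  This is the shape in which a multiple of a defining relation is recognized.\<close>

lemma lift_poly_mult:
  "lift_poly w (q * f) = (\<Sum>j\<le>Polynomial.degree q. \<Sum>k\<le>Polynomial.degree f.
     Poly_Mapping.single (w (j + k)) (Polynomial.coeff q j * Polynomial.coeff f k))"
proof -
  have "lift_poly w (q * f) = lift_poly w ((\<Sum>j\<le>Polynomial.degree q. Polynomial.monom (Polynomial.coeff q j) j) * f)"
    by (simp add: poly_as_sum_of_monoms)
  then show ?thesis by (simp add: sum_distrib_right lift_poly_sum lift_poly_monom_mult)
qed

section \<open>Trees with one distinguished edge\<close>

text \<open>
  Removing the edge \<open>{a, b}\<close> splits the tree into the component \<open>{v. side v}\<close> of \<open>a\<close> and that of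
  \<open>b\<close>; \<open>par\<close> points towards the root \<open>a\<close> or \<open>b\<close> of the component.
\<close>

locale edge_tree =
  fixes V :: "'v set" and E :: "('v \<times> 'v) set" and a b :: 'v
    and side :: "'v \<Rightarrow> bool" and par :: "'v \<Rightarrow> 'v" and dep :: "'v \<Rightarrow> nat"
  assumes finite_V: "finite V"
    and ab: "(a, b) \<in> E" "(b, a) \<in> E" "side a" "\<not> side b"
    and E_V: "\<And>u v. (u, v) \<in> E \<Longrightarrow> u \<in> V \<and> v \<in> V"
    and par: "\<And>v. v \<in> V \<Longrightarrow> v \<noteq> a \<Longrightarrow> v \<noteq> b \<Longrightarrow>
      (v, par v) \<in> E \<and> (par v, v) \<in> E \<and> dep (par v) < dep v \<and> side (par v) = side v"
    and E_cases: "\<And>u v. (u, v) \<in> E \<Longrightarrow> (u, v) = (a, b) \<or> (u, v) = (b, a) \<or>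
      u \<noteq> a \<and> u \<noteq> b \<and> v = par u \<or> v \<noteq> a \<and> v \<noteq> b \<and> u = par v"
begin

lemma ab_V [simp]: "a \<in> V" "b \<in> V" "a \<noteq> b" "b \<noteq> a"
  using ab E_V by auto

definition G :: "('v, 'v \<times> 'v) pre_digraph" where
  "G = \<lparr>verts = V, arcs = E, tail = fst, head = snd\<rparr>"

lemma G_sel [simp]: "verts G = V" "arcs G = E" "tail G = fst" "head G = snd"
  by (simp_all add: G_def)

sublocale wf_digraph G
  by unfold_locales (use E_V in auto)

abbreviation P :: "(('v, 'v \<times> 'v) path \<Rightarrow>\<^sub>0 int) ring" where "P \<equiv> path_algebra G"

abbreviation pmult (infixl "\<star>" 70) where "x \<star> y \<equiv> basis_mult (path_concat G) x y"

sublocale P: ring P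
  by (rule ring_path_algebra) (auto simp: finite_V wf_digraph_axioms)

lemma E_sym: "(s, t) \<in> E \<Longrightarrow> (t, s) \<in> E"
  using E_cases[of s t] par[of s] par[of t] ab E_V[of s t] by auto

definition special :: "'v \<times> 'v \<Rightarrow> bool" where "special e \<longleftrightarrow> e = (a, b) \<or> e = (b, a)"

lemma nonspecial_side: "(u, v) \<in> E \<Longrightarrow> \<not> special (u, v) \<Longrightarrow> side u = side v"
  using E_cases[of u v] par[of u] par[of v] E_V[of u v] by (auto simp: special_def)

definition crossings :: "('v \<times> 'v) list \<Rightarrow> nat" where "crossings es = length (filter special es)"
definition ba_crossings :: "('v \<times> 'v) list \<Rightarrow> nat" where "ba_crossings es = length (filter (\<lambda>e. e = (b, a)) es)"

lemma crossings_simps [simp]: "crossings [] = 0" "crossings (e # es) = (if special e then Suc (crossings es) else crossings es)"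
  "crossings (es @ fs) = crossings es + crossings fs"
  "ba_crossings [] = 0" "ba_crossings (e # es) = (if e = (b, a) then Suc (ba_crossings es) else ba_crossings es)"
  "ba_crossings (es @ fs) = ba_crossings es + ba_crossings fs"
  by (auto simp: crossings_def ba_crossings_def)

text \<open>The two directions of crossing \<open>{a, b}\<close> alternate along a walk, so k arcs
  from b to a and the sides of the ends determine all crossings: k in each direction between equal
  sides, one more from a to b when leaving the side of a for that of b, one fewer in the opposite
  case. There k \<ge> 1 for a genuine walk; at k = 0 the truncated subtraction gives 0.\<close>

definition ncross :: "'v \<Rightarrow> 'v \<Rightarrow> nat \<Rightarrow> nat" where
  "ncross u v k = (if side u = side v then 2 * k else if side u then 2 * k + 1 else 2 * k - 1)"

lemma awalk_ConsD: "awalk u (e # es) v \<Longrightarrow> \<exists>w. e = (u, w) \<and> (u, w) \<in> E \<and> awalk w es v"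
  by (cases e) (auto simp: awalk_def dest: E_V)

lemma awalk_ConsI: "(u, w) \<in> E \<Longrightarrow> awalk w es v \<Longrightarrow> awalk u ((u, w) # es) v"
  by (auto simp: awalk_def dest: E_V)

lemma awalk_Nil_iff: "awalk u [] v \<longleftrightarrow> u = v \<and> v \<in> V"
  by (auto simp: awalk_def)

text \<open>Induction from the first arc: an ordinary arc keeps the side, and a crossing changes it,
  which matches the case distinction in \<open>ncross\<close>.\<close>

lemma crossings_eq:
  assumes "awalk u es v"
  shows "crossings es = ncross u v (ba_crossings es)" and "\<not> side u \<Longrightarrow> side v \<Longrightarrow> ba_crossings es \<ge> 1"
proof -
  have "crossings es = ncross u v (ba_crossings es) \<and> (\<not> side u \<longrightarrow> side v \<longrightarrow> ba_crossings es \<ge> 1)"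
    using assms
  proof (induction es arbitrary: u)
    case Nil
    then show ?case by (auto simp: awalk_Nil_iff ncross_def)
  next
    case (Cons e es)
    obtain w where w: "e = (u, w)" "(u, w) \<in> E" "awalk w es v" using awalk_ConsD[OF Cons.prems] by blast
    note IH = Cons.IH[OF w(3)]
    show ?case
    proof (cases "special e")
      case True
      then show ?thesis using IH w ab by (auto simp: special_def ncross_def split: if_splits)
    next
      case False
      then show ?thesis using IH nonspecial_side[OF w(2)] w(1) by (auto simp: special_def ncross_def)
    qed
  qed
  then show "crossings es = ncross u v (ba_crossings es)" "\<not> side u \<Longrightarrow> side v \<Longrightarrow> ba_crossings es \<ge> 1" by auto
qed

text \<open>The (u, v) entry of the matrix over \<int>[t] that represents x. Only arcs from b to a
  are counted, so that a round trip along \<open>{a, b}\<close>, started at either end, counts as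
  t.\<close>

definition M :: "'v \<Rightarrow> 'v \<Rightarrow> (('v, 'v \<times> 'v) path \<Rightarrow>\<^sub>0 int) \<Rightarrow> int poly" where
  "M u v x = (\<Sum>p\<in>Poly_Mapping.keys x. if fst p = u \<and> awlast (fst p) (snd p) = v
      then Polynomial.monom (Poly_Mapping.lookup x p) (ba_crossings (snd p)) else 0)"

lemma M_superset:
  assumes "finite A" "Poly_Mapping.keys x \<subseteq> A"
  shows "M u v x = (\<Sum>p\<in>A. if fst p = u \<and> awlast (fst p) (snd p) = v
      then Polynomial.monom (Poly_Mapping.lookup x p) (ba_crossings (snd p)) else 0)"
  unfolding M_def by (rule sum.mono_neutral_left) (use assms in \<open>auto simp: in_keys_iff\<close>)

lemma M_add: "M u v (x + y) = M u v x + M u v y"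
proof -
  let ?A = "Poly_Mapping.keys x \<union> Poly_Mapping.keys y"
  have "Poly_Mapping.keys (x + y) \<subseteq> ?A" by (rule Poly_Mapping.keys_add)
  then show ?thesis
    by (simp add: M_superset[of ?A] sum.distrib[symmetric]) (auto intro!: sum.cong simp: lookup_add add_monom)
qed

lemma M_0 [simp]: "M u v 0 = 0" by (simp add: M_def)

lemma M_sum: "M u v (sum f A) = (\<Sum>i\<in>A. M u v (f i))"
  by (induction A rule: infinite_finite_induct) (auto simp: M_add)

lemma M_single: "M u v (Poly_Mapping.single p c) =
    (if fst p = u \<and> awlast (fst p) (snd p) = v then Polynomial.monom c (ba_crossings (snd p)) else 0)"
  by (subst M_superset[of "{p}"]) auto

text \<open>Exponents add under concatenation, and for two single paths the sum over v collapses to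
  the origin of the second one. The general case is bilinear in x and y.\<close>

lemma M_mult:
  assumes "x \<in> carrier P" "y \<in> carrier P"
  shows "M u w (x \<star> y) = (\<Sum>v\<in>V. M u v x * M v w y)"
proof -
  have x: "Poly_Mapping.keys x \<subseteq> graph_paths G" and y: "Poly_Mapping.keys y \<subseteq> graph_paths G" using assms by auto
  from x show ?thesis
  proof (induction rule: poly_mapping_additive_induct)
    case (single p c)
    from y show ?case
    proof (induction rule: poly_mapping_additive_induct)
      case (single q d)
      obtain s es t fs where pq: "p = (s, es)" "q = (t, fs)" by fastforce
      have t: "t \<in> V" using single by (simp add: pq graph_paths_iff awalk_def)
      have "(\<Sum>v\<in>V. M u v (Poly_Mapping.single p c) * M v w (Poly_Mapping.single q d)) =
          (\<Sum>v\<in>V. if v = t then M u v (Poly_Mapping.single p c) * M v w (Poly_Mapping.single q d) else 0)"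
        by (rule sum.cong) (auto simp: M_single pq)
      also have "\<dots> = M u t (Poly_Mapping.single p c) * M t w (Poly_Mapping.single q d)"
        using t finite_V by simp
      also have "\<dots> = M u w (Poly_Mapping.single p c \<star> Poly_Mapping.single q d)"
        by (auto simp: M_single pq basis_mult_single awlast_append mult_monom)
      finally show ?case by simp
    qed (simp_all add: basis_mult_add_right M_add distrib_left sum.distrib)
  qed (simp_all add: basis_mult_add_left M_add distrib_right sum.distrib)
qed

lemma M_one: "u \<in> V \<Longrightarrow> M u v \<one>\<^bsub>P\<^esub> = (if u = v then 1 else 0)"
proof -
  assume u: "u \<in> V"
  have "M u v \<one>\<^bsub>P\<^esub> = (\<Sum>s\<in>V. if s = u then (if u = v then 1 else 0) else 0)"
    unfolding path_algebra_sel M_sum by (rule sum.cong) (auto simp: M_single monom_0 one_pCons)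
  also have "\<dots> = (if u = v then 1 else 0)" using u finite_V by simp
  finally show ?thesis .
qed

text \<open>The only arc from the component of b to that of a is (b, a), so such a walk carries at
  least one factor t.\<close>

lemma M_coeff_0:
  assumes "x \<in> carrier P" "\<not> side u" "side v"
  shows "Polynomial.coeff (M u v x) 0 = 0"
proof -
  have x: "Poly_Mapping.keys x \<subseteq> graph_paths G" using assms by auto
  from x show ?thesis
  proof (induction rule: poly_mapping_additive_induct)
    case (single p c)
    obtain s es where p: "p = (s, es)" by fastforce
    then have "awalk s es (awlast s es)" using single by (simp add: graph_paths_iff)
    then show ?case using crossings_eq(2)[of s es v] assms by (auto simp: M_single p)
  qed (simp_all add: M_add)
qed

end

section \<open>Normal forms of paths and the image of the representation\<close>

context edge_tree begin

definition root :: "'v \<Rightarrow> 'v" where "root v = (if side v then a else b)"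
definition other :: "'v \<Rightarrow> 'v" where "other r = (if r = a then b else a)"

function up_path :: "'v \<Rightarrow> ('v \<times> 'v) list" where
  "up_path v = (if v \<in> V \<and> v \<noteq> a \<and> v \<noteq> b then (v, par v) # up_path (par v) else [])"
  by auto
termination by (relation "measure dep") (use par in auto)

function down_path :: "'v \<Rightarrow> ('v \<times> 'v) list" where
  "down_path v = (if v \<in> V \<and> v \<noteq> a \<and> v \<noteq> b then down_path (par v) @ [(par v, v)] else [])"
  by auto
termination by (relation "measure dep") (use par in auto)

declare up_path.simps [simp del] down_path.simps [simp del]

primrec zigzag :: "nat \<Rightarrow> 'v \<Rightarrow> ('v \<times> 'v) list" where
  "zigzag 0 r = []"
| "zigzag (Suc h) r = (r, other r) # zigzag h (other r)"

lemma up_down_simps [simp]: "up_path a = []" "up_path b = []" "down_path a = []" "down_path b = []"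
  "root a = a" "root b = b" "other a = b" "other b = a"
  using ab by (simp_all add: up_path.simps down_path.simps root_def other_def)

lemma root_ab: "root v \<in> {a, b}" by (auto simp: root_def)

lemma other_ab: "r \<in> {a, b} \<Longrightarrow> other r \<in> {a, b} \<and> (r, other r) \<in> E \<and> other (other r) = r \<and> special (r, other r)"
  using ab by (auto simp: special_def)

lemma awalk_append: "awalk u p v \<Longrightarrow> awalk v q w \<Longrightarrow> awalk u (p @ q) w"
  by (rule awalk_appendI)

lemma awalk_awlast: "awalk u p v \<Longrightarrow> awlast u p = v"
  unfolding awalk_def using cas_awlast by blast

lemma awalk_Nil: "v \<in> V \<Longrightarrow> awalk v [] v" by (simp only: awalk_Nil_iff)

lemma awalk_arc: "(u, w) \<in> E \<Longrightarrow> awalk u [(u, w)] w"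
  by (rule awalk_ConsI) (use E_V awalk_Nil in auto)

lemma awalk_end: "awalk u p v \<Longrightarrow> u \<in> V \<and> v \<in> V"
  by (induction p arbitrary: u) (auto simp: awalk_Nil_iff dest!: awalk_ConsD dest: E_V)

lemma par_V: "v \<in> V \<Longrightarrow> v \<noteq> a \<Longrightarrow> v \<noteq> b \<Longrightarrow> par v \<in> V"
  using par[of v] E_V by blast

lemma awalk_up_path: "v \<in> V \<Longrightarrow> awalk v (up_path v) (root v) \<and> ba_crossings (up_path v) = 0"
proof (induction v rule: up_path.induct)
  case (1 v)
  show ?case
  proof (cases "v \<noteq> a \<and> v \<noteq> b")
    case True
    then have "root (par v) = root v" "(v, par v) \<in> E" "par v \<in> V"
      using 1 par[of v] par_V[of v] by (auto simp: root_def)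
    then show ?thesis using True 1 by (subst (1 2) up_path.simps) (auto intro!: awalk_ConsI)
  qed (auto simp: awalk_Nil_iff)
qed

lemma awalk_down_path: "v \<in> V \<Longrightarrow> awalk (root v) (down_path v) v \<and> ba_crossings (down_path v) = 0"
proof (induction v rule: down_path.induct)
  case (1 v)
  show ?case
  proof (cases "v \<noteq> a \<and> v \<noteq> b")
    case True
    then have *: "root (par v) = root v" "(par v, v) \<in> E" "par v \<in> V"
      using 1 par[of v] par_V[of v] by (auto simp: root_def)
    have "awalk (root (par v)) (down_path (par v) @ [(par v, v)]) v"
      by (rule awalk_append[OF _ awalk_arc[OF *(2)]]) (use 1 True * in blast)
    then show ?thesis using True 1 * by (subst (1 2) down_path.simps) simp
  qed (auto simp: awalk_Nil_iff)
qed

lemma awalk_zigzag: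
  assumes "r \<in> {a, b}"
  shows "awalk r (zigzag h r) (if even h then r else other r)"
    and "ba_crossings (zigzag h r) = (if r = a then h div 2 else (h + 1) div 2)"
proof -
  have "awalk r (zigzag h r) (if even h then r else other r) \<and>
      ba_crossings (zigzag h r) = (if r = a then h div 2 else (h + 1) div 2)"
    using assms
  proof (induction h arbitrary: r)
    case (Suc h)
    from Suc.prems consider "r = a" | "r = b" by blast
    then show ?case
    proof cases
      case 1
      have w: "awalk b (zigzag h b) (if even h then b else a)" and c: "ba_crossings (zigzag h b) = (h + 1) div 2"
        using Suc.IH[of b] by (auto split: if_splits)
      show ?thesis using awalk_ConsI[OF ab(1) w] c unfolding 1 by auto
    next
      case 2
      have w: "awalk a (zigzag h a) (if even h then a else b)" and c: "ba_crossings (zigzag h a) = h div 2"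
        using Suc.IH[of a] by (auto split: if_splits)
      show ?thesis using awalk_ConsI[OF ab(2) w] c unfolding 2 by auto
    qed
  qed (auto simp: awalk_Nil_iff)
  then show "awalk r (zigzag h r) (if even h then r else other r)"
    "ba_crossings (zigzag h r) = (if r = a then h div 2 else (h + 1) div 2)" by auto
qed

lemma zigzag_add:
  assumes "r \<in> {a, b}"
  shows "zigzag (m + n) r = zigzag m r @ zigzag n (if even m then r else other r)"
  using assms
proof (induction m arbitrary: r)
  case (Suc m)
  from Suc.IH[of "other r"] other_ab[OF Suc.prems] show ?case by auto
qed simp

text \<open>The representative of the class of walks from u to v with k arcs (b, a): climb to the
  root of u, cross back and forth, descend to v. From the side of b to that of a the value at k = 0
  is not a walk, so the facts about it assume k \<ge> 1 or a zero coefficient there.\<close>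

definition normal_path :: "'v \<Rightarrow> 'v \<Rightarrow> nat \<Rightarrow> ('v, 'v \<times> 'v) path" where
  "normal_path u v k = (u, up_path u @ zigzag (ncross u v k) (root u) @ down_path v)"

text \<open>\<open>ncross\<close> is even exactly when both ends lie on the same side, so the zigzag
  stops at the root from which v is reached.\<close>

lemma ncross_end:
  assumes "\<not> side u \<longrightarrow> side v \<longrightarrow> k \<ge> 1"
  shows "(if even (ncross u v k) then root u else other (root u)) = root v"
  using assms by (auto simp: ncross_def root_def)

lemma awalk_normal_path:
  assumes "u \<in> V" "v \<in> V" "\<not> side u \<longrightarrow> side v \<longrightarrow> k \<ge> 1"
  shows "awalk u (up_path u @ zigzag (ncross u v k) (root u) @ down_path v) v"
    and "ba_crossings (up_path u @ zigzag (ncross u v k) (root u) @ down_path v) = k"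
proof -
  note up = awalk_up_path[OF assms(1)] and down = awalk_down_path[OF assms(2)]
  have z: "awalk (root u) (zigzag (ncross u v k) (root u)) (root v)"
    using awalk_zigzag(1)[OF root_ab[of u], of "ncross u v k"] unfolding ncross_end[OF assms(3)] .
  show "awalk u (up_path u @ zigzag (ncross u v k) (root u) @ down_path v) v"
    by (rule awalk_append[OF conjunct1[OF up] awalk_append[OF z conjunct1[OF down]]])
  show "ba_crossings (up_path u @ zigzag (ncross u v k) (root u) @ down_path v) = k"
    using conjunct2[OF up] conjunct2[OF down] awalk_zigzag(2)[OF root_ab, of "ncross u v k" u] assms(3)
    by (auto simp: ncross_def root_def simp del: zigzag.simps)
qed

lemma awalk_path_mem: "awalk u p v \<Longrightarrow> (u, p) \<in> graph_paths G"
  by (auto simp: graph_paths_def)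

lemma M_normal:
  assumes "u \<in> V" "v \<in> V" "\<not> side u \<longrightarrow> side v \<longrightarrow> Polynomial.coeff q 0 = 0"
  shows "lift_poly (normal_path u v) q \<in> carrier P"
    and "M u' v' (lift_poly (normal_path u v) q) = (if u' = u \<and> v' = v then q else 0)"
proof -
  let ?t = "\<lambda>k. Poly_Mapping.single (normal_path u v k) (Polynomial.coeff q k)"
  \<comment> \<open>The index at which \<open>normal_path\<close> is not a walk occurs with
    coefficient 0 only.\<close>
  have zero: "Polynomial.coeff q k = 0 \<or> (\<not> side u \<longrightarrow> side v \<longrightarrow> k \<ge> 1)" for k
    using assms(3) by (cases k) auto
  have k: "Poly_Mapping.keys (?t k) \<subseteq> graph_paths G \<and>
      M u' v' (?t k) = (if u' = u \<and> v' = v then Polynomial.monom (Polynomial.coeff q k) k else 0)" for k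
  proof (cases "Polynomial.coeff q k = 0")
    case False
    then have "\<not> side u \<longrightarrow> side v \<longrightarrow> k \<ge> 1" using zero[of k] by blast
    note n = awalk_normal_path[OF assms(1,2) this]
    define es where "es = up_path u @ zigzag (ncross u v k) (root u) @ down_path v"
    have es: "normal_path u v k = (u, es)" "awalk u es v" "ba_crossings es = k"
      using n by (simp_all only: normal_path_def es_def)
    have "(u, es) \<in> graph_paths G" by (rule awalk_path_mem[OF es(2)])
    then show ?thesis using awalk_awlast[OF es(2)] es(3) by (simp add: M_single es(1))
  qed simp
  then show "lift_poly (normal_path u v) q \<in> carrier P"
    unfolding lift_poly_def path_algebra_sel mem_Collect_eq by (intro keys_sum_subset) blast
  show "M u' v' (lift_poly (normal_path u v) q) = (if u' = u \<and> v' = v then q else 0)"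
    using k by (auto simp: lift_poly_def M_sum poly_as_sum_of_monoms intro!: sum.neutral)
qed

text \<open>The converse of \<open>M_coeff_0\<close>: divisibility by t from the side of b to that
  of a is the only restriction on the entries, since normal paths realize every other
  monomial.\<close>

lemma exists_M_eq:
  assumes "\<And>u v. \<not> side u \<longrightarrow> side v \<longrightarrow> Polynomial.coeff (Y u v) 0 = 0"
  shows "\<exists>x\<in>carrier P. \<forall>u\<in>V. \<forall>v\<in>V. M u v x = Y u v"
proof -
  let ?x = "\<Sum>u\<in>V. \<Sum>v\<in>V. lift_poly (normal_path u v) (Y u v)"
  have "?x \<in> carrier P"
    unfolding path_algebra_sel mem_Collect_eq
    by (intro keys_sum_subset M_normal(1)[OF _ _ assms, unfolded path_algebra_sel mem_Collect_eq])
  moreover have "M u v ?x = Y u v" if uv: "u \<in> V" "v \<in> V" for u v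
  proof -
    have n: "M u v (lift_poly (normal_path u' v') (Y u' v')) = (if u = u' \<and> v = v' then Y u' v' else 0)"
      if "u' \<in> V" "v' \<in> V" for u' v' by (rule M_normal(2)) (use that assms in auto)
    have "M u v ?x = (\<Sum>u'\<in>V. \<Sum>v'\<in>V. if u = u' \<and> v = v' then Y u' v' else 0)"
      unfolding M_sum by (intro sum.cong refl) (simp add: n)
    also have "\<dots> = (\<Sum>u'\<in>V. if u' = u then (\<Sum>v'\<in>V. if v' = v then Y u' v' else 0) else 0)"
      by (intro sum.cong refl) (auto intro!: sum.cong)
    also have "\<dots> = Y u v" using uv finite_V by simp
    finally show ?thesis .
  qed
  ultimately show ?thesis by blast
qed

end

text \<open>Only the relations at ordinary edges are fixed here. The relation at
  \<open>{a, b}\<close> has a different form in the two algebras and enters later, through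
  hypotheses on zigzags.\<close>

locale edge_tree_ideal = edge_tree +
  fixes I
  assumes ideal_I: "ideal I P"
    and cancel: "\<And>s t. (s, t) \<in> E \<Longrightarrow> \<not> special (s, t) \<Longrightarrow>
      Poly_Mapping.single (s, [(s, t), (t, s)]) 1 - Poly_Mapping.single (s, []) 1 \<in> I"
begin

sublocale I: ideal I P by (rule ideal_I)

lemma I_plus: "x \<in> I \<Longrightarrow> y \<in> I \<Longrightarrow> x + y \<in> I" using I.a_closed by simp

lemma I_uminus: assumes "x \<in> I" shows "- x \<in> I"
proof -
  have "x \<in> carrier P" by (rule I.Icarr[OF assms])
  then show ?thesis
    using I.a_inv_closed[OF assms] a_inv_ab_group_add[OF P.ring_axioms, of x] by simp
qed

lemma I_0: "0 \<in> I" using I.zero_closed by simp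

lemma I_sum: "(\<And>i. i \<in> A \<Longrightarrow> f i \<in> I) \<Longrightarrow> sum f A \<in> I"
  by (induction A rule: infinite_finite_induct) (auto simp: I_0 I_plus)

lemma I_left: "x \<in> carrier P \<Longrightarrow> y \<in> I \<Longrightarrow> x \<star> y \<in> I" using I.I_l_closed by simp
lemma I_right: "x \<in> carrier P \<Longrightarrow> y \<in> I \<Longrightarrow> y \<star> x \<in> I" using I.I_r_closed by simp

text \<open>Congruence of paths modulo \<open>I\<close>, with all integer coefficients at once so
  that it can be applied to any term of a linear combination.\<close>

definition eqv (infix "\<sim>" 50) where
  "p \<sim> q \<longleftrightarrow> (\<forall>c. Poly_Mapping.single p c - Poly_Mapping.single q c \<in> I)"

lemma eqv_refl: "p \<sim> p" by (simp add: eqv_def I_0)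
lemma eqv_sym: "p \<sim> q \<Longrightarrow> q \<sim> p" unfolding eqv_def using I_uminus by (metis minus_diff_eq)
lemma eqv_trans: assumes "p \<sim> q" "q \<sim> r" shows "p \<sim> r"
proof -
  have "Poly_Mapping.single p c - Poly_Mapping.single r c \<in> I" for c
    using I_plus[of "Poly_Mapping.single p c - Poly_Mapping.single q c" "Poly_Mapping.single q c - Poly_Mapping.single r c"]
      assms by (simp add: eqv_def)
  then show ?thesis by (simp add: eqv_def)
qed

lemma single_carrier: "awalk u p v \<Longrightarrow> Poly_Mapping.single (u, p) c \<in> carrier P"
  using awalk_path_mem by auto

text \<open>Multiply the difference by the path \<open>xs\<close> on the left and by
  \<open>ys\<close> on the right. The walk conditions ensure that neither product is 0.\<close>

lemma eqv_context:
  assumes "(s, x) \<sim> (s, y)" "awalk u xs s" "awalk s x t" "awalk s y t" "awalk t ys v"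
  shows "(u, xs @ x @ ys) \<sim> (u, xs @ y @ ys)"
proof -
  have "Poly_Mapping.single (u, xs @ x @ ys) c - Poly_Mapping.single (u, xs @ y @ ys) c \<in> I" for c
  proof -
    have "Poly_Mapping.single (u, xs) 1 \<star> (Poly_Mapping.single (s, x) c - Poly_Mapping.single (s, y) c)
        \<star> Poly_Mapping.single (t, ys) 1 \<in> I"
      by (intro I_left I_right single_carrier[OF assms(2)] single_carrier[OF assms(5)])
        (use assms(1) in \<open>simp add: eqv_def\<close>)
    then show ?thesis
      using assms(2-5)[THEN awalk_awlast]
      by (simp add: basis_mult_diff basis_mult_single awlast_append)
  qed
  then show ?thesis by (simp add: eqv_def)
qed

lemma cancel_eqv:
  assumes "(s, t) \<in> E" "\<not> special (s, t)"
  shows "(s, [(s, t), (t, s)]) \<sim> (s, [])"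
proof -
  have s: "s \<in> V" "(t, s) \<in> E" using assms E_V E_sym by auto
  have "Poly_Mapping.single (s, [(s, t), (t, s)]) c - Poly_Mapping.single (s, []) c \<in> I" for c
  proof -
    have "Poly_Mapping.single (s, []) c \<star> (Poly_Mapping.single (s, [(s, t), (t, s)]) 1 - Poly_Mapping.single (s, []) 1) \<in> I"
      by (rule I_left[OF single_carrier[OF awalk_Nil[OF s(1)]] cancel[OF assms]])
    then show ?thesis by (simp add: basis_mult_diff basis_mult_single)
  qed
  then show ?thesis by (simp add: eqv_def)
qed

text \<open>Induction on the depth: the detour from the parent to the root and back cancels first,
  then the step to the parent and back.\<close>

lemma up_down_eqv: "v \<in> V \<Longrightarrow> (v, up_path v @ down_path v) \<sim> (v, [])"
proof (induction v rule: up_path.induct)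
  case (1 v)
  show ?case
  proof (cases "v \<noteq> a \<and> v \<noteq> b")
    case True
    then have *: "(v, par v) \<in> E" "(par v, v) \<in> E" "par v \<in> V" "root (par v) = root v"
      using 1 par[of v] par_V[of v] by (auto simp: root_def)
    have ns: "\<not> special (v, par v)" using True by (auto simp: special_def)
    have IH: "(par v, up_path (par v) @ down_path (par v)) \<sim> (par v, [])" using 1 True * by blast
    have "(v, [(v, par v)] @ (up_path (par v) @ down_path (par v)) @ [(par v, v)]) \<sim> (v, [(v, par v)] @ [] @ [(par v, v)])"
      by (rule eqv_context[OF IH awalk_arc[OF *(1)]
            awalk_append[OF conjunct1[OF awalk_up_path[OF *(3)]] conjunct1[OF awalk_down_path[OF *(3)]]]
            awalk_Nil[OF *(3)] awalk_arc[OF *(2)]])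
    then have "(v, [(v, par v)] @ (up_path (par v) @ down_path (par v)) @ [(par v, v)]) \<sim> (v, [])"
      using eqv_trans[OF _ cancel_eqv[OF *(1) ns]] by simp
    then show ?thesis
      using True 1(2) by (subst up_path.simps, subst down_path.simps) simp
  qed (auto simp: eqv_refl)
qed

text \<open>Induction from the front, with the remaining walk already in normal form. The first arc
  either crosses \<open>{a, b}\<close> and lengthens the zigzag, or climbs and lengthens the ascent,
  or descends and cancels against the first arc of the ascent. The empty walk is
  \<open>up_down_eqv\<close>.\<close>

lemma normal_eqv: "awalk u es v \<Longrightarrow> (u, es) \<sim> (u, up_path u @ zigzag (crossings es) (root u) @ down_path v)"
proof (induction es arbitrary: u)
  case Nil
  then show ?case using up_down_eqv[of v] eqv_sym by (auto simp: awalk_Nil_iff)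
next
  case (Cons e es)
  obtain w where w: "e = (u, w)" "(u, w) \<in> E" "awalk w es v" using awalk_ConsD[OF Cons.prems] by blast
  have uw: "u \<in> V" "w \<in> V" "v \<in> V" using w(2) E_V awalk_end[OF w(3)] by auto
  let ?z = "zigzag (crossings es) (root w) @ down_path v"
  have wend: "awalk w (up_path w @ ?z) v"
    using awalk_normal_path(1)[OF uw(2,3), of "ba_crossings es"] crossings_eq[OF w(3)] by simp
  have zend: "awalk (root w) ?z v"
    using wend awalk_awlast[OF conjunct1[OF awalk_up_path[OF uw(2)]]] by (metis awalk_append_iff)
  have "(u, [(u, w)] @ es @ []) \<sim> (u, [(u, w)] @ (up_path w @ ?z) @ [])"
    by (rule eqv_context[OF Cons.IH[OF w(3)] awalk_arc[OF w(2)] w(3) wend awalk_Nil[OF uw(3)]])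
  then have step: "(u, e # es) \<sim> (u, e # up_path w @ ?z)" unfolding w(1) by simp
  show ?case
  proof (cases "special e")
    case True
    then have "u \<in> {a, b}" "w = other u" by (auto simp: w(1) special_def)
    then show ?thesis using step other_ab[of u] by (auto simp: True w(1))
  next
    case False
    then have nsp: "\<not> special (u, w)" by (simp add: w(1))
    with False have r: "root w = root u" using nonspecial_side[OF w(2)] w(1) by (simp add: root_def)
    have "(u, e # up_path w @ ?z) \<sim> (u, up_path u @ ?z)"
    proof (cases "u \<noteq> a \<and> u \<noteq> b \<and> w = par u")
      case True
      then show ?thesis using uw by (subst (2) up_path.simps) (simp add: w(1) eqv_refl)
    next
      \<comment> \<open>The arc descends to a child w of u, so the ascent from w begins by returning
        to u, and the two arcs cancel.\<close>
      case nu: False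
      then have wu: "w \<noteq> a \<and> w \<noteq> b \<and> u = par w"
        using E_cases[OF w(2)] False by (auto simp: w(1) special_def)
      have upr: "awalk u (up_path u) (root w)" using awalk_up_path[OF uw(1)] unfolding r by blast
      have "(u, [] @ [(u, w), (w, u)] @ up_path u @ ?z) \<sim> (u, [] @ [] @ up_path u @ ?z)"
        by (rule eqv_context[OF cancel_eqv[OF w(2)] awalk_Nil[OF uw(1)]
            awalk_ConsI[OF w(2) awalk_arc[OF E_sym[OF w(2)]]] awalk_Nil[OF uw(1)]
            awalk_append[OF upr zend]])
          (use nsp in simp)
      then show ?thesis using wu uw by (subst up_path.simps) (simp add: w(1))
    qed
    then show ?thesis using eqv_trans[OF step] r False by simp
  qed
qed

text \<open>Modulo \<open>I\<close> an element is determined by its matrix \<open>M\<close>: each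
  path is congruent to the normal path with the same ends and the same exponent, by
  \<open>normal_eqv\<close> and \<open>crossings_eq\<close>.\<close>

lemma reduce:
  assumes "x \<in> carrier P"
  shows "x - (\<Sum>u\<in>V. \<Sum>v\<in>V. lift_poly (normal_path u v) (M u v x)) \<in> I"
proof -
  have "Poly_Mapping.keys x \<subseteq> graph_paths G" using assms by auto
  then show ?thesis
  proof (induction rule: poly_mapping_additive_induct)
    case (single p c)
    obtain s es where p: "p = (s, es)" by fastforce
    define t where "t = awlast s es"
    have w: "awalk s es t" using single by (simp add: p graph_paths_iff t_def)
    have st: "s \<in> V" "t \<in> V" using w by (auto dest: awalk_end)
    have "(\<Sum>u\<in>V. \<Sum>v\<in>V. lift_poly (normal_path u v) (M u v (Poly_Mapping.single p c))) =
        (\<Sum>u\<in>V. if u = s then (\<Sum>v\<in>V. if v = t then lift_poly (normal_path u v) (M u v (Poly_Mapping.single p c)) else 0) else 0)"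
      by (intro sum.cong refl) (auto simp: M_single p t_def intro!: sum.cong)
    also have "\<dots> = lift_poly (normal_path s t) (M s t (Poly_Mapping.single p c))"
      using st finite_V by simp
    also have "\<dots> = Poly_Mapping.single (s, up_path s @ zigzag (crossings es) (root s) @ down_path t) c"
      by (simp add: M_single p t_def[symmetric] lift_poly_monom normal_path_def crossings_eq(1)[OF w])
    finally show ?case using normal_eqv[OF w] by (simp add: p eqv_def)
  next
    case (add f g)
    then show ?case using I_plus[OF add.IH] by (simp add: M_add lift_poly_add sum.distrib algebra_simps)
  qed (simp add: I_0)
qed

text \<open>
  The factor \<open>f\<close> is moved next to a vertex \<open>a\<close> or \<open>b\<close>; if there is at least one crossing, then an
  edge from \<open>{a, b}\<close> is available as well.
\<close>

lemma lift_normal_in_I: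
  assumes uv: "u \<in> V" "v \<in> V"
    and odd: "\<And>r. r \<in> {a, b} \<Longrightarrow> lift_poly (\<lambda>k. (r, zigzag (2 * k + 1) r)) f \<in> I"
    and q: "\<And>j. Polynomial.coeff q j \<noteq> 0 \<Longrightarrow> ncross u v j \<ge> 1 \<or>
        side u = side v \<and> (\<forall>r\<in>{a, b}. lift_poly (\<lambda>k. (r, zigzag (2 * k) r)) f \<in> I)"
  shows "lift_poly (normal_path u v) (q * f) \<in> I"
  unfolding lift_poly_mult
proof (rule I_sum)
  fix j assume "j \<in> {..Polynomial.degree q}"
  let ?c = "Polynomial.coeff q j"
  let ?r = "root u"
  have wu: "awalk u (up_path u) ?r" and wv: "awalk (root v) (down_path v) v" using awalk_up_path awalk_down_path uv by auto
  show "(\<Sum>k\<le>Polynomial.degree f. Poly_Mapping.single (normal_path u v (j + k)) (?c * Polynomial.coeff f k)) \<in> I"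
  proof (cases "?c = 0")
    case True
    then show ?thesis by (simp add: I_0)
  next
    case c: False
    show ?thesis
    proof (cases "ncross u v j \<ge> 1")
      case True
      \<comment> \<open>One crossing is handed over to the odd zigzags of the relation. The other m
        crossings are placed after them, so that every term of f lengthens the zigzag by two arcs
        per power of t.\<close>
      define m where "m = ncross u v j - 1"
      have nc: "ncross u v (j + k) = (2 * k + 1) + m" for k
        using True by (auto simp: m_def ncross_def)
      have "\<not> side u \<longrightarrow> side v \<longrightarrow> j \<ge> 1" using True by (auto simp: ncross_def)
      note e = ncross_end[OF this]
      have "ncross u v j = Suc m" using True by (simp add: m_def)
      with e have em: "(if even m then other ?r else other (other ?r)) = root v"
        using other_ab[OF root_ab, of u] by (auto split: if_splits)
      have "awalk (other ?r) (zigzag m (other ?r)) (root v)"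
        using awalk_zigzag(1)[of "other ?r" m] other_ab[OF root_ab, of u] unfolding em by blast
      from awalk_append[OF this wv]
      have wz: "awalk (other ?r) (zigzag m (other ?r) @ down_path v) v" .
      have "Poly_Mapping.single (u, up_path u) ?c \<star> lift_poly (\<lambda>k. (?r, zigzag (2 * k + 1) ?r)) f
          \<star> Poly_Mapping.single (other ?r, zigzag m (other ?r) @ down_path v) 1 \<in> I"
        by (intro I_left I_right single_carrier[OF wu] single_carrier[OF wz] odd root_ab)
      also have "Poly_Mapping.single (u, up_path u) ?c \<star> lift_poly (\<lambda>k. (?r, zigzag (2 * k + 1) ?r)) f
          \<star> Poly_Mapping.single (other ?r, zigzag m (other ?r) @ down_path v) 1 =
          (\<Sum>k\<le>Polynomial.degree f. Poly_Mapping.single (normal_path u v (j + k)) (?c * Polynomial.coeff f k))"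
        unfolding lift_poly_def basis_mult_sum
      proof (rule sum.cong[OF refl])
        fix k
        have "awalk ?r (zigzag (2 * k + 1) ?r) (other ?r)" using awalk_zigzag(1)[OF root_ab, of u "2 * k + 1"] by simp
        then have "awlast ?r (zigzag (2 * k + 1) ?r) = other ?r" by (rule awalk_awlast)
        moreover have "zigzag (2 * k + 1 + m) ?r = zigzag (2 * k + 1) ?r @ zigzag m (other ?r)"
          by (subst zigzag_add[OF root_ab]) simp
        ultimately show "Poly_Mapping.single (u, up_path u) ?c \<star>
            Poly_Mapping.single (?r, zigzag (2 * k + 1) ?r) (Polynomial.coeff f k) \<star>
            Poly_Mapping.single (other ?r, zigzag m (other ?r) @ down_path v) 1 =
            Poly_Mapping.single (normal_path u v (j + k)) (?c * Polynomial.coeff f k)"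
          unfolding normal_path_def nc
          by (simp add: basis_mult_single awlast_append awalk_awlast[OF wu] del: zigzag.simps)
      qed
      finally show ?thesis .
    next
      case False
      then have s: "side u = side v" and ev: "\<forall>r\<in>{a, b}. lift_poly (\<lambda>k. (r, zigzag (2 * k) r)) f \<in> I"
        using q[OF c] by auto
      \<comment> \<open>Between equal sides \<open>ncross\<close> is 2 j. No crossing is available,
        so the relation on even zigzags is inserted directly at the common root.\<close>
      then have j: "j = 0" using False by (simp add: ncross_def)
      have r: "root v = ?r" using s by (simp add: root_def)
      have "Poly_Mapping.single (u, up_path u) ?c \<star> lift_poly (\<lambda>k. (?r, zigzag (2 * k) ?r)) f
          \<star> Poly_Mapping.single (root v, down_path v) 1 \<in> I"
        by (intro I_left I_right single_carrier[OF wu] single_carrier[OF wv] bspec[OF ev] root_ab)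
      also have "Poly_Mapping.single (u, up_path u) ?c \<star> lift_poly (\<lambda>k. (?r, zigzag (2 * k) ?r)) f
          \<star> Poly_Mapping.single (root v, down_path v) 1 =
          (\<Sum>k\<le>Polynomial.degree f. Poly_Mapping.single (normal_path u v (j + k)) (?c * Polynomial.coeff f k))"
        unfolding lift_poly_def basis_mult_sum
      proof (rule sum.cong[OF refl])
        fix k
        have "awalk ?r (zigzag (2 * k) ?r) ?r" using awalk_zigzag(1)[OF root_ab, of u "2 * k"] by simp
        then have "awlast ?r (zigzag (2 * k) ?r) = ?r" by (rule awalk_awlast)
        then show "Poly_Mapping.single (u, up_path u) ?c \<star>
            Poly_Mapping.single (?r, zigzag (2 * k) ?r) (Polynomial.coeff f k) \<star>
            Poly_Mapping.single (root v, down_path v) 1 =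
            Poly_Mapping.single (normal_path u v (j + k)) (?c * Polynomial.coeff f k)"
          using s by (simp add: basis_mult_single awlast_append awalk_awlast[OF wu] normal_path_def j r ncross_def del: zigzag.simps)
      qed
      finally show ?thesis .
    qed
  qed
qed

text \<open>Write each entry as q f and lift it. The only monomial of q that offers no crossing is
  the constant one between equal sides. It is covered by the even zigzags, or it is absent because
  the entry, and hence q, has constant term 0.\<close>

lemma in_I_if_M_dvd:
  assumes x: "x \<in> carrier P"
    and odd: "\<And>r. r \<in> {a, b} \<Longrightarrow> lift_poly (\<lambda>k. (r, zigzag (2 * k + 1) r)) f \<in> I"
    and f0: "Polynomial.coeff f 0 \<noteq> 0"
    and dvd: "\<And>u v. u \<in> V \<Longrightarrow> v \<in> V \<Longrightarrow> f dvd M u v x"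
    and even: "(\<forall>r\<in>{a, b}. lift_poly (\<lambda>k. (r, zigzag (2 * k) r)) f \<in> I) \<or>
      (\<forall>u\<in>V. \<forall>v\<in>V. side u = side v \<longrightarrow> Polynomial.coeff (M u v x) 0 = 0)"
  shows "x \<in> I"
proof -
  have "lift_poly (normal_path u v) (M u v x) \<in> I" if uv: "u \<in> V" "v \<in> V" for u v
  proof -
    obtain q where q: "M u v x = q * f" using dvd[OF uv] by (metis dvdE mult.commute)
    \<comment> \<open>The constant term of q f is q(0) f(0) with f(0) \<noteq> 0.\<close>
    have q0: "Polynomial.coeff q 0 = 0" if "Polynomial.coeff (M u v x) 0 = 0"
      using that f0 by (simp add: q coeff_mult)
    have "lift_poly (normal_path u v) (q * f) \<in> I"
    proof (rule lift_normal_in_I[OF uv odd])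
      fix j assume j: "Polynomial.coeff q j \<noteq> 0"
      show "1 \<le> ncross u v j \<or> side u = side v \<and> (\<forall>r\<in>{a, b}. lift_poly (\<lambda>k. (r, zigzag (2 * k) r)) f \<in> I)"
      proof (cases "j = 0")
        case True
        then have "Polynomial.coeff (M u v x) 0 \<noteq> 0" using q0 j by auto
        then show ?thesis using even uv M_coeff_0[OF x, of u v] by (auto simp: ncross_def)
      qed (auto simp: ncross_def)
    qed
    then show ?thesis by (simp add: q)
  qed
  then have "(\<Sum>u\<in>V. \<Sum>v\<in>V. lift_poly (normal_path u v) (M u v x)) \<in> I" by (intro I_sum)
  from I_plus[OF reduce[OF x] this] show ?thesis by simp
qed

end

section \<open>Matrix representations of the path algebra\<close>

lemma common_denominator:
  fixes A :: "rat poly set"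
  assumes "finite A"
  shows "\<exists>n::nat. n \<ge> 1 \<and> (\<forall>p\<in>A. \<exists>q. Polynomial.smult (of_nat n) p = ipoly q)"
  using assms
proof (induction A rule: finite_induct)
  case (insert p A)
  then obtain n where n: "n \<ge> (1::nat)" "\<And>p. p \<in> A \<Longrightarrow> \<exists>q. Polynomial.smult (of_nat n) p = ipoly q" by blast
  obtain m q where m: "m > 0" "Polynomial.smult (rat_of_int m) p = ipoly q" using rat_poly_common_denominator by blast
  define k where "k = n * nat m"
  have "Polynomial.smult (of_nat k) p = ipoly (Polynomial.smult (int n) q)"
    using m by (simp add: k_def m(2)[symmetric])
  moreover have "\<exists>q. Polynomial.smult (of_nat k) r = ipoly q" if r: "r \<in> A" for r
  proof -
    obtain s where "Polynomial.smult (of_nat n) r = ipoly s" using n(2)[OF r] by blast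
    then have "ipoly (Polynomial.smult m s) = Polynomial.smult (rat_of_int m) (Polynomial.smult (of_nat n) r)" by simp
    also have "\<dots> = Polynomial.smult (of_nat k) r" using m by (simp add: k_def mult.commute)
    finally show ?thesis by metis
  qed
  moreover have "k \<ge> 1" using n m by (simp add: k_def)
  ultimately show ?case by blast
qed auto

lemma hom_finsum:
  assumes "ring R" "h \<in> Ring.ring_hom (ring_of_type_algebra :: 'a::comm_ring_1 ring) R"
  shows "h (sum g A) = (\<Oplus>\<^bsub>R\<^esub>i\<in>A. h (g i))"
proof -
  interpret ring R by fact
  interpret h: ring_hom_ring ring_of_type_algebra R h
    by (rule ring_hom_ringI2) (use assms ring_from_type_algebra in auto)
  have clo: "h p \<in> carrier R" for p using ring_hom_closed[OF assms(2)] by simp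
  have add: "h (p + q) = h p \<oplus>\<^bsub>R\<^esub> h q" for p q using ring_hom_add[OF assms(2)] by simp
  have zero: "h 0 = \<zero>\<^bsub>R\<^esub>" using h.hom_zero by simp
  show ?thesis by (induction A rule: infinite_finite_induct) (simp_all add: zero add clo)
qed

lemma a_kernel_iff: "x \<in> a_kernel R S h \<longleftrightarrow> x \<in> carrier R \<and> h x = \<zero>\<^bsub>S\<^esub>"
  unfolding a_kernel_def' by blast

context edge_tree begin

text \<open>Restricting a matrix to the rows and columns in \<open>U\<close> is multiplicative as
  soon as h kills every product that passes through a vertex outside \<open>U\<close>. It is used
  for all of \<open>V\<close>, and for one component with evaluation at t = 0.\<close>

lemma ring_hom_matrix:
  fixes h :: "int poly \<Rightarrow> 'r" and R :: "'r ring" and e :: "nat \<Rightarrow> 'v"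
  assumes R: "ring R" and h: "h \<in> Ring.ring_hom ring_of_type_algebra R"
    and e: "bij_betw e {..<n} U" "U \<subseteq> V"
    and vanish: "\<And>u v w x y. u \<in> U \<Longrightarrow> w \<in> U \<Longrightarrow> v \<in> V - U \<Longrightarrow> x \<in> carrier P \<Longrightarrow> y \<in> carrier P \<Longrightarrow>
      h (M u v x * M v w y) = \<zero>\<^bsub>R\<^esub>"
  shows "(\<lambda>x. mat n n (\<lambda>(i, j). h (M (e i) (e j) x))) \<in> Ring.ring_hom P (matrix_ring n R)"
proof (rule ring_hom_memI)
  interpret ring R by fact
  interpret h: ring_hom_ring ring_of_type_algebra R h
    by (rule ring_hom_ringI2) (use assms ring_from_type_algebra in auto)
  have clo: "h p \<in> carrier R" for p using ring_hom_closed[OF h] by simp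
  have add: "h (p + q) = h p \<oplus>\<^bsub>R\<^esub> h q" for p q using ring_hom_add[OF h] by simp
  have mult: "h (p * q) = h p \<otimes>\<^bsub>R\<^esub> h q" for p q using ring_hom_mult[OF h] by simp
  have zero: "h 0 = \<zero>\<^bsub>R\<^esub>" using h.hom_zero by simp
  have one: "h 1 = \<one>\<^bsub>R\<^esub>" using ring_hom_one[OF h] by simp
  have eU: "e i \<in> U" "e i \<in> V" if "i < n" for i using e that by (auto simp: bij_betw_def)
  have inj: "e i = e j \<longleftrightarrow> i = j" if "i < n" "j < n" for i j using e(1) that by (auto simp: bij_betw_def inj_on_def)
  let ?\<phi> = "\<lambda>x. mat n n (\<lambda>(i, j). h (M (e i) (e j) x))"
  show "?\<phi> x \<in> carrier (matrix_ring n R)" for x by (auto simp: clo)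
  show "?\<phi> (x \<oplus>\<^bsub>P\<^esub> y) = ?\<phi> x \<oplus>\<^bsub>matrix_ring n R\<^esub> ?\<phi> y" for x y
    by (auto simp: M_add add intro!: eq_matI)
  show "?\<phi> \<one>\<^bsub>P\<^esub> = \<one>\<^bsub>matrix_ring n R\<^esub>"
    by (rule eq_matI) (auto simp: M_one eU inj one zero simp del: path_algebra_sel)
  fix x y assume x: "x \<in> carrier P" and y: "y \<in> carrier P"
  have "h (M (e i) (e j) (x \<star> y)) = (\<Oplus>\<^bsub>R\<^esub>k\<in>{..<n}. ?\<phi> x $$ (i, k) \<otimes>\<^bsub>R\<^esub> ?\<phi> y $$ (k, j))" if ij: "i < n" "j < n" for i j
  proof -
    let ?g = "\<lambda>v. M (e i) v x * M v (e j) y"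
    have "h (\<Sum>v\<in>V - U. ?g v) = (\<Oplus>\<^bsub>R\<^esub>v\<in>V - U. h (?g v))" by (rule hom_finsum[OF R h])
    also have "\<dots> = (\<Oplus>\<^bsub>R\<^esub>v\<in>V - U. \<zero>\<^bsub>R\<^esub>)"
      by (rule finsum_cong'[OF refl]) (use vanish eU ij x y in auto)
    finally have z: "h (\<Sum>v\<in>V - U. ?g v) = \<zero>\<^bsub>R\<^esub>" by simp
    have "h (M (e i) (e j) (x \<star> y)) = h ((\<Sum>v\<in>U. ?g v) + (\<Sum>v\<in>V - U. ?g v))"
      unfolding M_mult[OF x y] using sum.subset_diff[OF e(2) finite_V, of ?g] by (simp add: add.commute)
    also have "\<dots> = h (\<Sum>v\<in>U. ?g v)" by (simp add: add z clo)
    also have "(\<Sum>v\<in>U. ?g v) = (\<Sum>k\<in>{..<n}. ?g (e k))" by (rule sum.reindex_bij_betw[OF e(1), symmetric])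
    also have "h \<dots> = (\<Oplus>\<^bsub>R\<^esub>k\<in>{..<n}. h (?g (e k)))" by (rule hom_finsum[OF R h])
    also have "\<dots> = (\<Oplus>\<^bsub>R\<^esub>k\<in>{..<n}. ?\<phi> x $$ (i, k) \<otimes>\<^bsub>R\<^esub> ?\<phi> y $$ (k, j))"
      by (rule finsum_cong'[OF refl]) (use ij in \<open>auto simp: mult clo\<close>)
    finally show ?thesis .
  qed
  then show "?\<phi> (x \<otimes>\<^bsub>P\<^esub> y) = ?\<phi> x \<otimes>\<^bsub>matrix_ring n R\<^esub> ?\<phi> y"
    by (intro eq_matI) auto
qed

end

text \<open>The quotient of the rational polynomials by f, characterized by a surjection \<kappa>
  with kernel (f). Leaving \<open>K\<close> abstract lets the rationals themselves serve when f is
  linear.\<close>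

locale poly_quotient =
  fixes f :: "int poly" and K :: "'k ring" and actK :: "rat \<Rightarrow> 'k \<Rightarrow> 'k" and \<kappa> :: "rat poly \<Rightarrow> 'k"
  assumes alg: "rat_algebra K actK"
    and hom: "\<kappa> \<in> Ring.ring_hom Qt_ring K"
    and surj: "\<And>k. k \<in> carrier K \<Longrightarrow> \<exists>p. k = \<kappa> p"
    and ker: "\<And>p. \<kappa> p = \<zero>\<^bsub>K\<^esub> \<longleftrightarrow> ipoly f dvd p"
    and actK: "\<And>q p. actK q (\<kappa> p) = \<kappa> (Polynomial.smult q p)"
    and monic: "Polynomial.lead_coeff f = 1"
    and f0: "Polynomial.coeff f 0 \<noteq> 0"
begin

sublocale K: rat_algebra K actK by (rule alg)

lemma kappa_closed [simp]: "\<kappa> p \<in> carrier K" using ring_hom_closed[OF hom] by simp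

lemma kappa_shift: "\<kappa> (p + Polynomial.smult c (ipoly f)) = \<kappa> p"
proof -
  have "\<kappa> (Polynomial.smult c (ipoly f)) = \<zero>\<^bsub>K\<^esub>" unfolding ker by (rule dvd_smult) simp
  then show ?thesis using ring_hom_add[OF hom] by simp
qed

lemma ipoly_hom: "(\<lambda>p. \<kappa> (ipoly p)) \<in> Ring.ring_hom ring_of_type_algebra K"
proof (rule ring_hom_memI)
  show "\<kappa> (ipoly (p \<otimes>\<^bsub>ring_of_type_algebra\<^esub> q)) = \<kappa> (ipoly p) \<otimes>\<^bsub>K\<^esub> \<kappa> (ipoly q)" for p q
    using ring_hom_mult[OF hom] by simp
  show "\<kappa> (ipoly (p \<oplus>\<^bsub>ring_of_type_algebra\<^esub> q)) = \<kappa> (ipoly p) \<oplus>\<^bsub>K\<^esub> \<kappa> (ipoly q)" for p q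
    using ring_hom_add[OF hom] by simp
  show "\<kappa> (ipoly \<one>\<^bsub>ring_of_type_algebra\<^esub>) = \<one>\<^bsub>K\<^esub>" using ring_hom_one[OF hom] by simp
qed simp

lemma kappa_ipoly_eq_0: "\<kappa> (ipoly p) = \<zero>\<^bsub>K\<^esub> \<longleftrightarrow> f dvd p"
proof -
  have "ipoly f dvd (ipoly p :: rat poly)" if "f dvd p"
    using that by (auto elim!: dvdE)
  then show ?thesis unfolding ker using monic_dvd_int_of_dvd_rat[OF monic] by blast
qed

end

locale edge_tree_quotient = edge_tree V E a b side par dep + poly_quotient f K actK \<kappa>
  for V :: "'v set" and E a b side par dep and f and K :: "'k ring" and actK \<kappa>
begin

text \<open>The Chinese remainder theorem for the coprime polynomials f and t, entry by entry:
  \<open>t\<close> prescribes the class modulo f and \<open>c\<close> the constant term. The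
  condition on \<open>c\<close> is the one that the image of the path algebra satisfies; one common
  denominator makes all entries integral.\<close>

lemma exists_matrix_coefficients:
  fixes c :: "'v \<Rightarrow> 'v \<Rightarrow> rat"
  assumes t: "\<And>u v. u \<in> V \<Longrightarrow> v \<in> V \<Longrightarrow> t u v \<in> carrier K"
    and c: "\<And>u v. \<not> side u \<Longrightarrow> side v \<Longrightarrow> c u v = 0"
  shows "\<exists>x\<in>carrier P. \<exists>n::nat. n \<ge> 1 \<and> (\<forall>u\<in>V. \<forall>v\<in>V.
    t u v = actK (1 / of_nat n) (\<kappa> (ipoly (M u v x))) \<and>
    c u v = 1 / of_nat n * of_int (poly (M u v x) 0))"
proof -
  have "\<exists>p. (u \<in> V \<longrightarrow> v \<in> V \<longrightarrow> t u v = \<kappa> p) \<and> Polynomial.coeff p 0 = c u v" for u v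
  proof (cases "u \<in> V \<and> v \<in> V")
    case True
    then obtain p where p: "t u v = \<kappa> p" using surj t by blast
    \<comment> \<open>The multiple of f is chosen to correct the constant term without changing the
      class modulo f.\<close>
    let ?p = "p + Polynomial.smult ((c u v - Polynomial.coeff p 0) / of_int (Polynomial.coeff f 0)) (ipoly f)"
    have "Polynomial.coeff ?p 0 = c u v" using f0 by (simp add: coeff_map_poly)
    moreover have "t u v = \<kappa> ?p" unfolding kappa_shift by (rule p)
    ultimately show ?thesis by blast
  next
    case False
    then show ?thesis by (intro exI[of _ "[:c u v:]"]) auto
  qed
  then obtain p where p: "\<And>u v. u \<in> V \<Longrightarrow> v \<in> V \<Longrightarrow> t u v = \<kappa> (p u v)" "\<And>u v. Polynomial.coeff (p u v) 0 = c u v"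
    by metis
  have "finite ((\<lambda>(u, v). p u v) ` (V \<times> V))" using finite_V by simp
  from common_denominator[OF this] obtain n where n: "n \<ge> (1::nat)"
    "\<And>u v. u \<in> V \<Longrightarrow> v \<in> V \<Longrightarrow> \<exists>q. Polynomial.smult (of_nat n) (p u v) = ipoly q" by fastforce
  then have "\<exists>q. u \<in> V \<longrightarrow> v \<in> V \<longrightarrow> Polynomial.smult (of_nat n) (p u v) = ipoly q" for u v by blast
  then obtain q where q: "\<And>u v. u \<in> V \<Longrightarrow> v \<in> V \<Longrightarrow> Polynomial.smult (of_nat n) (p u v) = ipoly (q u v)" by metis
  have q0: "rat_of_int (Polynomial.coeff (q u v) 0) = of_nat n * c u v" if "u \<in> V" "v \<in> V" for u v
    using arg_cong[OF q[OF that], of "\<lambda>r. Polynomial.coeff r 0"] by (simp add: coeff_map_poly p)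
  let ?q = "\<lambda>u v. if u \<in> V \<and> v \<in> V then q u v else 0"
  have "\<exists>x\<in>carrier P. \<forall>u\<in>V. \<forall>v\<in>V. M u v x = ?q u v"
  proof (rule exists_M_eq)
    fix u v show "\<not> side u \<longrightarrow> side v \<longrightarrow> Polynomial.coeff (?q u v) 0 = 0"
      using q0[of u v] c[of u v] by auto
  qed
  then obtain x where x: "x \<in> carrier P" "\<And>u v. u \<in> V \<Longrightarrow> v \<in> V \<Longrightarrow> M u v x = q u v" by auto
  have "t u v = actK (1 / of_nat n) (\<kappa> (ipoly (M u v x))) \<and> c u v = 1 / of_nat n * of_int (poly (M u v x) 0)"
    if uv: "u \<in> V" "v \<in> V" for u v
  proof
    have "actK (1 / of_nat n) (\<kappa> (ipoly (M u v x))) = \<kappa> (Polynomial.smult (1 / of_nat n) (Polynomial.smult (of_nat n) (p u v)))"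
      by (simp add: x(2)[OF uv] q[OF uv] actK)
    also have "\<dots> = t u v" using n(1) p(1)[OF uv] by simp
    finally show "t u v = actK (1 / of_nat n) (\<kappa> (ipoly (M u v x)))" by simp
    show "c u v = 1 / of_nat n * of_int (poly (M u v x) 0)"
      using n(1) q0[OF uv] by (simp add: x(2)[OF uv] poly_0_coeff_0)
  qed
  then show ?thesis using x(1) n(1) by blast
qed

definition rep :: "nat \<Rightarrow> (nat \<Rightarrow> 'v) \<Rightarrow> (('v, 'v \<times> 'v) path \<Rightarrow>\<^sub>0 int) \<Rightarrow> 'k mat" where
  "rep n e x = mat n n (\<lambda>(i, j). \<kappa> (ipoly (M (e i) (e j) x)))"

definition rep0 :: "nat \<Rightarrow> (nat \<Rightarrow> 'v) \<Rightarrow> (('v, 'v \<times> 'v) path \<Rightarrow>\<^sub>0 int) \<Rightarrow> rat mat" where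
  "rep0 n e x = mat n n (\<lambda>(i, j). of_int (poly (M (e i) (e j) x) 0))"

lemma rep_hom:
  assumes "bij_betw e {..<n} V"
  shows "rep n e \<in> Ring.ring_hom P (matrix_ring n K)"
  unfolding rep_def[abs_def] by (rule ring_hom_matrix[OF K.ring_axioms ipoly_hom assms]) auto

lemma eval_0_hom: "(\<lambda>p. rat_of_int (poly p 0)) \<in> Ring.ring_hom ring_of_type_algebra Q_ring"
  by (rule ring_hom_memI) auto

text \<open>A walk that leaves a component and returns to it uses (b, a), so its contribution is
  divisible by t. At t = 0 each component therefore multiplies by itself.\<close>

lemma rep0_hom:
  assumes "bij_betw e {..<n} {v\<in>V. side v = s}"
  shows "rep0 n e \<in> Ring.ring_hom P (matrix_ring n Q_ring)"
  unfolding rep0_def[abs_def]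
proof (rule ring_hom_matrix[OF ring_from_type_algebra eval_0_hom assms])
  fix u v w x y
  assume *: "u \<in> {v \<in> V. side v = s}" "w \<in> {v \<in> V. side v = s}" "v \<in> V - {v \<in> V. side v = s}"
    "x \<in> carrier P" "y \<in> carrier P"
  show "rat_of_int (poly (M u v x * M v w y) 0) = \<zero>\<^bsub>Q_ring\<^esub>"
    using M_coeff_0[OF *(4), of u v] M_coeff_0[OF *(5), of v w] * by (cases s) (auto simp: poly_0_coeff_0 coeff_mult)
qed auto

lemma rep_eq_0:
  assumes "bij_betw e {..<n} V"
  shows "rep n e x = \<zero>\<^bsub>matrix_ring n K\<^esub> \<longleftrightarrow> (\<forall>u\<in>V. \<forall>v\<in>V. f dvd M u v x)"
proof -
  have "V = e ` {..<n}" using assms by (simp add: bij_betw_def)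
  moreover have "rep n e x = \<zero>\<^bsub>matrix_ring n K\<^esub> \<longleftrightarrow> (\<forall>i<n. \<forall>j<n. \<kappa> (ipoly (M (e i) (e j) x)) = \<zero>\<^bsub>K\<^esub>)"
    by (auto simp: rep_def mat_eq_iff)
  ultimately show ?thesis by (auto simp: kappa_ipoly_eq_0)
qed

lemma rep0_eq_0:
  assumes "bij_betw e {..<n} U"
  shows "rep0 n e x = \<zero>\<^bsub>matrix_ring n Q_ring\<^esub> \<longleftrightarrow> (\<forall>u\<in>U. \<forall>v\<in>U. Polynomial.coeff (M u v x) 0 = 0)"
proof -
  have "U = e ` {..<n}" using assms by (simp add: bij_betw_def)
  moreover have "rep0 n e x = \<zero>\<^bsub>matrix_ring n Q_ring\<^esub> \<longleftrightarrow> (\<forall>i<n. \<forall>j<n. Polynomial.coeff (M (e i) (e j) x) 0 = 0)"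
    by (auto simp: rep0_def mat_eq_iff poly_0_coeff_0)
  ultimately show ?thesis by auto
qed

end

text \<open>What the two algebras share: every generator has entries divisible by f, and the odd
  zigzags lie in the ideal. They differ in whether the even zigzags do as well.\<close>

locale edge_tree_gens = edge_tree_quotient V E a b side par dep f K actK \<kappa> +
    edge_tree_ideal V E a b side par dep I
  for V :: "'v set" and E a b side par dep and f and K :: "'k ring" and actK \<kappa> I +
  fixes Gs and N :: nat and e :: "nat \<Rightarrow> 'v"
  assumes I_gens: "I = Idl\<^bsub>P\<^esub> Gs" and Gs: "Gs \<subseteq> carrier P"
    and e: "bij_betw e {..<N} V"
    and oddI: "\<And>r. r \<in> {a, b} \<Longrightarrow> lift_poly (\<lambda>k. (r, zigzag (2 * k + 1) r)) f \<in> I"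
    and gens_dvd: "\<And>g u v. g \<in> Gs \<Longrightarrow> u \<in> V \<Longrightarrow> v \<in> V \<Longrightarrow> f dvd M u v g"
begin

lemma e_inv: "i < N \<Longrightarrow> inv_into {..<N} e (e i) = i" "i < N \<Longrightarrow> e i \<in> V"
  "v \<in> V \<Longrightarrow> inv_into {..<N} e v < N" "v \<in> V \<Longrightarrow> e (inv_into {..<N} e v) = v"
  using e bij_betw_inv_into_left[OF e] bij_betw_inv_into_right[OF e] bij_betw_apply[OF bij_betw_inv_into[OF e]]
  by (auto simp: bij_betw_def)

theorem tensor_iso_matrix:
  assumes evenI: "\<And>r. r \<in> {a, b} \<Longrightarrow> lift_poly (\<lambda>k. (r, zigzag (2 * k) r)) f \<in> I"
  shows "tensor_ring (P Quot I) Q_ring \<simeq> matrix_ring N K"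
proof (rule tensor_ring_Quot_Q_iso[OF P.ring_axioms rat_algebra_matrix[OF alg] rep_hom[OF e]])
  interpret h: ring_hom_ring P "matrix_ring N K" "rep N e"
    by (rule ring_hom_ringI2[OF P.ring_axioms ring_matrix_ring[OF K.ring_axioms] rep_hom[OF e]])
  show "I = a_kernel P (matrix_ring N K) (rep N e)"
  proof
    show "I \<subseteq> a_kernel P (matrix_ring N K) (rep N e)"
      unfolding I_gens
    proof (rule P.genideal_minimal[OF h.kernel_is_ideal], rule subsetI)
      fix g assume g: "g \<in> Gs"
      then have "g \<in> carrier P" using Gs by blast
      then show "g \<in> a_kernel P (matrix_ring N K) (rep N e)"
        unfolding a_kernel_iff rep_eq_0[OF e] using gens_dvd[OF g] by blast
    qed
    show "a_kernel P (matrix_ring N K) (rep N e) \<subseteq> I"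
    proof
      fix x assume "x \<in> a_kernel P (matrix_ring N K) (rep N e)"
      then have x: "x \<in> carrier P" "\<forall>u\<in>V. \<forall>v\<in>V. f dvd M u v x"
        unfolding a_kernel_iff rep_eq_0[OF e] by blast+
      show "x \<in> I"
        by (rule in_I_if_M_dvd[OF x(1) oddI f0]) (use x evenI in auto)
    qed
  qed
  fix t assume t: "t \<in> carrier (matrix_ring N K)"
  \<comment> \<open>Only classes modulo f are to be matched here. Constant terms 0 are prescribed
    everywhere, which meets the condition on entries from the side of b to that of a.\<close>
  have "\<exists>x\<in>carrier P. \<exists>n::nat. n \<ge> 1 \<and> (\<forall>u\<in>V. \<forall>v\<in>V.
    t $$ (inv_into {..<N} e u, inv_into {..<N} e v) = actK (1 / of_nat n) (\<kappa> (ipoly (M u v x))) \<and>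
    (0::rat) = 1 / of_nat n * of_int (poly (M u v x) 0))"
    by (rule exists_matrix_coefficients[where c = "\<lambda>_ _. 0"]) (use t e_inv in auto)
  then obtain x n where x: "x \<in> carrier P" "n \<ge> (1::nat)"
    "\<And>u v. u \<in> V \<Longrightarrow> v \<in> V \<Longrightarrow> t $$ (inv_into {..<N} e u, inv_into {..<N} e v) = actK (1 / of_nat n) (\<kappa> (ipoly (M u v x)))"
    by blast
  have "t = mat N N (\<lambda>ij. actK (1 / of_nat n) (rep N e x $$ ij))"
  proof (rule eq_matI)
    fix i j assume "i < dim_row (mat N N (\<lambda>ij. actK (1 / of_nat n) (rep N e x $$ ij)))"
      "j < dim_col (mat N N (\<lambda>ij. actK (1 / of_nat n) (rep N e x $$ ij)))"
    then have "i < N" "j < N" by auto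
    then show "t $$ (i, j) = mat N N (\<lambda>ij. actK (1 / of_nat n) (rep N e x $$ ij)) $$ (i, j)"
      using x(3)[of "e i" "e j"] by (simp add: e_inv rep_def)
  qed (use t in auto)
  then show "\<exists>x\<in>carrier P. \<exists>n::nat. n \<ge> 1 \<and> t = mat N N (\<lambda>ij. actK (1 / of_nat n) (rep N e x $$ ij))"
    using x(1,2) by blast
qed

text \<open>The kernel consists of the elements whose entries are divisible by f and, within a
  component, also by t. These are independent conditions over the rationals, so the blocks at t = 0
  split off as direct factors.\<close>

theorem tensor_iso_matrix_product:
  assumes e1: "bij_betw e1 {..<n1} {v\<in>V. side v = True}" and e2: "bij_betw e2 {..<n2} {v\<in>V. side v = False}"
    and gens_0: "\<And>g u v. g \<in> Gs \<Longrightarrow> u \<in> V \<Longrightarrow> v \<in> V \<Longrightarrow> side u = side v \<Longrightarrow> Polynomial.coeff (M u v g) 0 = 0"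
  shows "tensor_ring (P Quot I) Q_ring \<simeq>
    RDirProd (matrix_ring N K) (RDirProd (matrix_ring n1 Q_ring) (matrix_ring n2 Q_ring))"
proof -
  let ?T = "RDirProd (matrix_ring N K) (RDirProd (matrix_ring n1 Q_ring) (matrix_ring n2 Q_ring))"
  define \<phi> where "\<phi> x = (rep N e x, (rep0 n1 e1 x, rep0 n2 e2 x))" for x
  have phi: "\<phi> \<in> Ring.ring_hom P ?T"
    unfolding \<phi>_def[abs_def] by (intro ring_hom_RDirProd rep_hom[OF e] rep0_hom[OF e1] rep0_hom[OF e2])
  note alg = rat_algebra_RDirProd[OF rat_algebra_matrix[OF alg, of N]
      rat_algebra_RDirProd[OF rat_algebra_matrix[OF rat_algebra_Q, of n1] rat_algebra_matrix[OF rat_algebra_Q, of n2]]]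
  have phi_0: "\<phi> x = \<zero>\<^bsub>?T\<^esub> \<longleftrightarrow> (\<forall>u\<in>V. \<forall>v\<in>V. f dvd M u v x) \<and>
      (\<forall>u\<in>V. \<forall>v\<in>V. side u = side v \<longrightarrow> Polynomial.coeff (M u v x) 0 = 0)" for x
    unfolding \<phi>_def RDirProd_sel prod.inject rep_eq_0[OF e] rep0_eq_0[OF e1] rep0_eq_0[OF e2]
    by auto
  have ringT: "ring ?T"
    by (intro RDirProd_ring ring_matrix_ring K.ring_axioms ring_from_type_algebra)
  interpret h: ring_hom_ring P ?T \<phi>
    by (rule ring_hom_ringI2[OF P.ring_axioms ringT phi])
  have I: "I = a_kernel P ?T \<phi>"
  proof
    show "I \<subseteq> a_kernel P ?T \<phi>"
      unfolding I_gens
    proof (rule P.genideal_minimal[OF h.kernel_is_ideal], rule subsetI)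
      fix g assume g: "g \<in> Gs"
      then have "g \<in> carrier P" using Gs by blast
      then show "g \<in> a_kernel P ?T \<phi>"
        unfolding a_kernel_iff phi_0 using gens_dvd[OF g] gens_0[OF g] by blast
    qed
    show "a_kernel P ?T \<phi> \<subseteq> I"
    proof
      fix x assume "x \<in> a_kernel P ?T \<phi>"
      then have x: "x \<in> carrier P" "\<forall>u\<in>V. \<forall>v\<in>V. f dvd M u v x"
        "\<forall>u\<in>V. \<forall>v\<in>V. side u = side v \<longrightarrow> Polynomial.coeff (M u v x) 0 = 0"
        unfolding a_kernel_iff phi_0 by blast+
      show "x \<in> I"
        by (rule in_I_if_M_dvd[OF x(1) oddI f0]) (use x in auto)
    qed
  qed
  show ?thesis
  proof (rule tensor_ring_Quot_Q_iso[OF P.ring_axioms alg phi I])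
    fix t assume t: "t \<in> carrier ?T"
    obtain A B C where abc: "t = (A, (B, C))" by (metis surj_pair)
    have A: "A \<in> carrier (matrix_ring N K)" and B: "B \<in> carrier (matrix_ring n1 Q_ring)"
      and C: "C \<in> carrier (matrix_ring n2 Q_ring)" using t by (simp_all add: abc)
    \<comment> \<open>The constant terms demanded by the two blocks at t = 0. Between different
      components 0 is prescribed: from b to a it is forced, from a to b it is a choice.\<close>
    define c where "c u v = (if side u \<and> side v then B $$ (inv_into {..<n1} e1 u, inv_into {..<n1} e1 v)
      else if \<not> side u \<and> \<not> side v then C $$ (inv_into {..<n2} e2 u, inv_into {..<n2} e2 v) else 0)" for u v
    have "\<exists>x\<in>carrier P. \<exists>n::nat. n \<ge> 1 \<and> (\<forall>u\<in>V. \<forall>v\<in>V.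
      A $$ (inv_into {..<N} e u, inv_into {..<N} e v) = actK (1 / of_nat n) (\<kappa> (ipoly (M u v x))) \<and>
      c u v = 1 / of_nat n * of_int (poly (M u v x) 0))"
      by (rule exists_matrix_coefficients) (use A e_inv in \<open>auto simp: c_def\<close>)
    then obtain x n where x: "x \<in> carrier P" "n \<ge> (1::nat)"
      "\<And>u v. u \<in> V \<Longrightarrow> v \<in> V \<Longrightarrow> A $$ (inv_into {..<N} e u, inv_into {..<N} e v) = actK (1 / of_nat n) (\<kappa> (ipoly (M u v x)))"
      "\<And>u v. u \<in> V \<Longrightarrow> v \<in> V \<Longrightarrow> c u v = 1 / of_nat n * of_int (poly (M u v x) 0)"
      by blast
    have "A = mat N N (\<lambda>ij. actK (1 / of_nat n) (rep N e x $$ ij))"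
    proof (rule eq_matI)
      fix i j assume "i < dim_row (mat N N (\<lambda>ij. actK (1 / of_nat n) (rep N e x $$ ij)))"
        "j < dim_col (mat N N (\<lambda>ij. actK (1 / of_nat n) (rep N e x $$ ij)))"
      then have "i < N" "j < N" by auto
      then show "A $$ (i, j) = mat N N (\<lambda>ij. actK (1 / of_nat n) (rep N e x $$ ij)) $$ (i, j)"
        using x(3)[of "e i" "e j"] by (simp add: e_inv rep_def)
    qed (use A in auto)
    moreover have "B = mat n1 n1 (\<lambda>ij. 1 / of_nat n * (rep0 n1 e1 x $$ ij))"
    proof (rule eq_matI)
      fix i j assume "i < dim_row (mat n1 n1 (\<lambda>ij. 1 / of_nat n * (rep0 n1 e1 x $$ ij)))"
        "j < dim_col (mat n1 n1 (\<lambda>ij. 1 / of_nat n * (rep0 n1 e1 x $$ ij)))"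
      then have ij: "i < n1" "j < n1" by auto
      then have "e1 i \<in> V" "e1 j \<in> V" "side (e1 i)" "side (e1 j)" using e1 by (auto simp: bij_betw_def)
      moreover have "inv_into {..<n1} e1 (e1 i) = i" "inv_into {..<n1} e1 (e1 j) = j"
        using bij_betw_inv_into_left[OF e1] ij by auto
      ultimately show "B $$ (i, j) = mat n1 n1 (\<lambda>ij. 1 / of_nat n * (rep0 n1 e1 x $$ ij)) $$ (i, j)"
        using x(4)[of "e1 i" "e1 j"] ij by (simp add: c_def rep0_def)
    qed (use B in auto)
    moreover have "C = mat n2 n2 (\<lambda>ij. 1 / of_nat n * (rep0 n2 e2 x $$ ij))"
    proof (rule eq_matI)
      fix i j assume "i < dim_row (mat n2 n2 (\<lambda>ij. 1 / of_nat n * (rep0 n2 e2 x $$ ij)))"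
        "j < dim_col (mat n2 n2 (\<lambda>ij. 1 / of_nat n * (rep0 n2 e2 x $$ ij)))"
      then have ij: "i < n2" "j < n2" by auto
      then have "e2 i \<in> V" "e2 j \<in> V" "\<not> side (e2 i)" "\<not> side (e2 j)" using e2 by (auto simp: bij_betw_def)
      moreover have "inv_into {..<n2} e2 (e2 i) = i" "inv_into {..<n2} e2 (e2 j) = j"
        using bij_betw_inv_into_left[OF e2] ij by auto
      ultimately show "C $$ (i, j) = mat n2 n2 (\<lambda>ij. 1 / of_nat n * (rep0 n2 e2 x $$ ij)) $$ (i, j)"
        using x(4)[of "e2 i" "e2 j"] ij by (simp add: c_def rep0_def)
    qed (use C in auto)
    ultimately show "\<exists>x\<in>carrier P. \<exists>n::nat. n \<ge> 1 \<and> t =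
      (mat N N (\<lambda>ij. actK (1 / of_nat n) (fst (\<phi> x) $$ ij)),
        (mat n1 n1 (\<lambda>ij. 1 / of_nat n * (fst (snd (\<phi> x)) $$ ij)), mat n2 n2 (\<lambda>ij. 1 / of_nat n * (snd (snd (\<phi> x)) $$ ij))))"
      using x(1,2) unfolding abc \<phi>_def fst_conv snd_conv by blast
  qed
qed

end

section \<open>The coefficient rings\<close>

text \<open>For the linear polynomial t - c the quotient map is evaluation at c; the assumption on c
  is that the polynomial has nonzero constant term.\<close>

lemma poly_quotient_Q:
  assumes "c \<noteq> 0"
  shows "poly_quotient [:- c, 1:] Q_ring (*) (\<lambda>p. poly p (of_int c))"
proof (rule poly_quotient.intro)
  show "rat_algebra Q_ring (*)" by (rule rat_algebra_Q)
  show "(\<lambda>p. poly p (of_int c)) \<in> Ring.ring_hom Qt_ring Q_ring"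
    by (rule ring_hom_memI) auto
  show "\<exists>p. k = poly p (of_int c)" for k :: rat by (rule exI[of _ "[:k:]"]) simp
  show "poly p (rat_of_int c) = \<zero>\<^bsub>Q_ring\<^esub> \<longleftrightarrow> ipoly [:- c, 1:] dvd p" for p
    by (simp add: poly_eq_0_iff_dvd)
qed (use assms in auto)

lemma poly_quotient_Quot:
  fixes f :: "int poly"
  defines "K \<equiv> Qt_ring Quot PIdl\<^bsub>Qt_ring\<^esub> (ipoly f)"
    and "\<kappa> \<equiv> \<lambda>p. PIdl\<^bsub>Qt_ring\<^esub> (ipoly f) +>\<^bsub>Qt_ring\<^esub> p"
  assumes "Polynomial.lead_coeff f = 1" "Polynomial.coeff f 0 \<noteq> 0"
  shows "poly_quotient f K (\<lambda>q x. \<kappa> [:q:] \<otimes>\<^bsub>K\<^esub> x) \<kappa>"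
proof (rule poly_quotient.intro)
  define J where "J = PIdl\<^bsub>Qt_ring\<^esub> (ipoly f)"
  interpret Qt: cring Qt_ring by (rule cring_from_type_algebra)
  interpret J: ideal J Qt_ring unfolding J_def by (rule Qt.cgenideal_ideal) simp
  have K: "K = Qt_ring Quot J" and k: "\<kappa> = (+>\<^bsub>Qt_ring\<^esub>) J"
    by (simp_all add: K_def \<kappa>_def J_def fun_eq_iff)
  have cr: "cring K" unfolding K by (rule J.quotient_is_cring[OF Qt.is_cring])
  show hom: "\<kappa> \<in> Ring.ring_hom Qt_ring K" unfolding K k by (rule J.rcos_ring_hom)
  have mem: "p \<in> J \<longleftrightarrow> ipoly f dvd p" for p
    unfolding J_def cgenideal_def by (auto simp: dvd_def mult.commute)
  show "rat_algebra K (\<lambda>q x. \<kappa> [:q:] \<otimes>\<^bsub>K\<^esub> x)"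
  proof (rule rat_algebra_hom[OF cr])
    show "(\<lambda>q. \<kappa> [:q:]) \<in> Ring.ring_hom Q_ring K"
    proof (rule ring_hom_memI)
      show "\<kappa> [:q:] \<in> carrier K" for q using ring_hom_closed[OF hom] by simp
      show "\<kappa> [:q \<otimes>\<^bsub>Q_ring\<^esub> r:] = \<kappa> [:q:] \<otimes>\<^bsub>K\<^esub> \<kappa> [:r:]" for q r
        using ring_hom_mult[OF hom, of "[:q:]" "[:r:]"] by (simp add: mult.commute)
      show "\<kappa> [:q \<oplus>\<^bsub>Q_ring\<^esub> r:] = \<kappa> [:q:] \<oplus>\<^bsub>K\<^esub> \<kappa> [:r:]" for q r
        using ring_hom_add[OF hom, of "[:q:]" "[:r:]"] by simp
      show "\<kappa> [:\<one>\<^bsub>Q_ring\<^esub>:] = \<one>\<^bsub>K\<^esub>"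
        using ring_hom_one[OF hom] by (simp add: one_pCons)
    qed
  qed
  show "\<exists>p. x = \<kappa> p" if "x \<in> carrier K" for x
    using that unfolding K k FactRing_def A_RCOSETS_def' by auto
  show "\<kappa> p = \<zero>\<^bsub>K\<^esub> \<longleftrightarrow> ipoly f dvd p" for p
  proof -
    have "\<kappa> p = \<zero>\<^bsub>K\<^esub> \<longleftrightarrow> J +>\<^bsub>Qt_ring\<^esub> p = J" by (simp add: K k FactRing_def)
    also have "\<dots> \<longleftrightarrow> p \<in> J"
      using J.rcos_const_imp_mem[of p] J.a_rcos_const[of p] by auto
    finally show ?thesis by (simp add: mem)
  qed
  show "\<kappa> [:q:] \<otimes>\<^bsub>K\<^esub> \<kappa> p = \<kappa> (Polynomial.smult q p)" for q p
    using ring_hom_mult[OF hom, of "[:q:]" p] by simp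
qed (use assms in auto)

section \<open>Evaluation in corner rings\<close>

lemma ring_corner:
  fixes R (structure)
  assumes "ring R" "e \<in> carrier R" "e \<otimes> e = e"
  shows "ring (corner R e)"
proof -
  interpret ring R by fact
  let ?C = "corner R e"
  have sel: "carrier ?C = {e \<otimes> x \<otimes> e | x. x \<in> carrier R}" "monoid.mult ?C = monoid.mult R" "add ?C = add R"
    "one ?C = e" "ring.zero ?C = ring.zero R"
    by (simp_all add: corner_def)
  have ee: "e \<otimes> (e \<otimes> x) = e \<otimes> x" if "x \<in> carrier R" for x
    using that assms by (simp add: m_assoc[symmetric])
  \<comment> \<open>Membership in the corner is recast as being fixed by e from both sides, which is
    visibly preserved by the operations.\<close>
  have mem: "x \<in> carrier ?C \<longleftrightarrow> x \<in> carrier R \<and> e \<otimes> x = x \<and> x \<otimes> e = x" for x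
  proof
    assume "x \<in> carrier ?C"
    then obtain y where y: "x = e \<otimes> y \<otimes> e" "y \<in> carrier R" unfolding sel by blast
    show "x \<in> carrier R \<and> e \<otimes> x = x \<and> x \<otimes> e = x"
      unfolding y(1) using y(2) assms(2,3) ee[of "y \<otimes> e"] by (simp add: m_assoc)
  next
    assume x: "x \<in> carrier R \<and> e \<otimes> x = x \<and> x \<otimes> e = x"
    then have "e \<otimes> x \<otimes> e = x" by simp
    then show "x \<in> carrier ?C" unfolding sel using x by force
  qed
  show ?thesis
  proof (rule ringI)
    show "abelian_group ?C"
    proof (rule abelian_groupI)
      fix x assume x: "x \<in> carrier ?C"
      then have "\<ominus> x \<in> carrier ?C" unfolding mem using assms(2) by (simp add: r_minus l_minus)
      moreover have "\<ominus> x \<oplus>\<^bsub>?C\<^esub> x = \<zero>\<^bsub>?C\<^esub>" using x unfolding mem sel(2-5) by (simp add: l_neg)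
      ultimately show "\<exists>y\<in>carrier ?C. y \<oplus>\<^bsub>?C\<^esub> x = \<zero>\<^bsub>?C\<^esub>" by blast
    next
      show "\<And>x y. x \<in> carrier ?C \<Longrightarrow> y \<in> carrier ?C \<Longrightarrow> x \<oplus>\<^bsub>?C\<^esub> y \<in> carrier ?C"
        unfolding mem sel(2-5) using assms(2) by (simp add: r_distr l_distr)
      show "\<zero>\<^bsub>?C\<^esub> \<in> carrier ?C" unfolding mem sel(2-5) using assms(2) by simp
      show "\<And>x y z. x \<in> carrier ?C \<Longrightarrow> y \<in> carrier ?C \<Longrightarrow> z \<in> carrier ?C \<Longrightarrow>
          x \<oplus>\<^bsub>?C\<^esub> y \<oplus>\<^bsub>?C\<^esub> z = x \<oplus>\<^bsub>?C\<^esub> (y \<oplus>\<^bsub>?C\<^esub> z)"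
        unfolding mem sel(2-5) by (simp add: a_assoc)
      show "\<And>x y. x \<in> carrier ?C \<Longrightarrow> y \<in> carrier ?C \<Longrightarrow> x \<oplus>\<^bsub>?C\<^esub> y = y \<oplus>\<^bsub>?C\<^esub> x"
        unfolding mem sel(2-5) by (simp add: a_comm)
      show "\<And>x. x \<in> carrier ?C \<Longrightarrow> \<zero>\<^bsub>?C\<^esub> \<oplus>\<^bsub>?C\<^esub> x = x"
        unfolding mem sel(2-5) by simp
    qed
    show "Group.monoid ?C"
    proof (rule monoidI)
      show "x \<otimes>\<^bsub>?C\<^esub> y \<in> carrier ?C" if "x \<in> carrier ?C" "y \<in> carrier ?C" for x y
        using that assms(2) m_assoc[of e x y] m_assoc[of x y e] unfolding mem sel(2-5) by simp
      show "\<one>\<^bsub>?C\<^esub> \<in> carrier ?C" unfolding mem sel(2-5) using assms(2,3) by simp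
      show "\<And>x y z. x \<in> carrier ?C \<Longrightarrow> y \<in> carrier ?C \<Longrightarrow> z \<in> carrier ?C \<Longrightarrow>
          x \<otimes>\<^bsub>?C\<^esub> y \<otimes>\<^bsub>?C\<^esub> z = x \<otimes>\<^bsub>?C\<^esub> (y \<otimes>\<^bsub>?C\<^esub> z)"
        unfolding mem sel(2-5) by (simp add: m_assoc)
    qed (unfold mem sel(2-5), simp_all)
  next
    show "\<And>x y z. x \<in> carrier ?C \<Longrightarrow> y \<in> carrier ?C \<Longrightarrow> z \<in> carrier ?C \<Longrightarrow>
        (x \<oplus>\<^bsub>?C\<^esub> y) \<otimes>\<^bsub>?C\<^esub> z = x \<otimes>\<^bsub>?C\<^esub> z \<oplus>\<^bsub>?C\<^esub> y \<otimes>\<^bsub>?C\<^esub> z"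
      unfolding mem sel(2-5) by (simp add: l_distr)
    show "\<And>x y z. x \<in> carrier ?C \<Longrightarrow> y \<in> carrier ?C \<Longrightarrow> z \<in> carrier ?C \<Longrightarrow>
        z \<otimes>\<^bsub>?C\<^esub> (x \<oplus>\<^bsub>?C\<^esub> y) = z \<otimes>\<^bsub>?C\<^esub> x \<oplus>\<^bsub>?C\<^esub> z \<otimes>\<^bsub>?C\<^esub> y"
      unfolding mem sel(2-5) by (simp add: r_distr)
  qed
qed

lemma add_pow_single:
  fixes R :: "('b \<Rightarrow>\<^sub>0 int) ring"
  assumes "ring R" "add R = (+)" "ring.zero R = 0" "\<And>c. Poly_Mapping.single p c \<in> carrier R"
  shows "[c] \<cdot>\<^bsub>R\<^esub> Poly_Mapping.single p 1 = Poly_Mapping.single p (c :: int)"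
proof -
  interpret ring R by fact
  have n: "[n] \<cdot>\<^bsub>R\<^esub> Poly_Mapping.single p 1 = Poly_Mapping.single p (int n)" for n :: nat
  proof (induction n)
    case (Suc n)
    have "[Suc n] \<cdot>\<^bsub>R\<^esub> Poly_Mapping.single p 1 = [n] \<cdot>\<^bsub>R\<^esub> Poly_Mapping.single p 1 \<oplus>\<^bsub>R\<^esub> Poly_Mapping.single p 1"
      by (rule add.nat_pow_Suc)
    then show ?case unfolding Suc assms(2) by (simp add: single_add[symmetric] add.commute del: frag_of_eq)
  qed (simp add: assms(3))
  show ?thesis
  proof (cases "c \<ge> 0")
    case True
    then have "[c] \<cdot>\<^bsub>R\<^esub> Poly_Mapping.single p 1 = [nat c] \<cdot>\<^bsub>R\<^esub> Poly_Mapping.single p 1"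
      by (rule add_pow_int_ge)
    then show ?thesis unfolding n using True by simp
  next
    case False
    then have "[c] \<cdot>\<^bsub>R\<^esub> Poly_Mapping.single p 1 = \<ominus>\<^bsub>R\<^esub> ([nat (- c)] \<cdot>\<^bsub>R\<^esub> Poly_Mapping.single p 1)"
      by (intro add_pow_int_lt) simp
    also have "\<dots> = - Poly_Mapping.single p (int (nat (- c)))"
      unfolding n by (rule a_inv_ab_group_add[OF assms(1-4)])
        (use assms(4)[of "- int (nat (- c))"] in \<open>simp only: single_uminus\<close>)
    finally show ?thesis using False by (simp add: single_uminus[symmetric])
  qed
qed

lemma const_poly_sum: "[:sum g A:] = (\<Sum>k\<in>A. [:g k :: int:])"
proof (induction A rule: infinite_finite_induct)
  case (insert x F)
  have "[:sum g (insert x F):] = [:g x:] + [:sum g F:]" using insert(1,2) by simp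
  also have "\<dots> = (\<Sum>k\<in>insert x F. [:g k:])" unfolding insert(3) using insert(1,2) by simp
  finally show ?case .
qed auto

context edge_tree begin

definition loop :: "'v \<Rightarrow> 'v \<Rightarrow> nat \<Rightarrow> ('v \<times> 'v) list" where
  "loop t s k = concat (replicate k [(t, s), (s, t)])"

lemma loop_Suc: "loop t s (Suc k) = loop t s k @ [(t, s), (s, t)]"
  by (induction k) (simp_all add: loop_def)

lemma loop_awalk: "(s, t) \<in> E \<Longrightarrow> (t, s) \<in> E \<Longrightarrow> awalk t (loop t s k) t"
  by (induction k) (auto simp: loop_def awalk_Nil_iff dest: E_V intro!: awalk_ConsI)

text \<open>Powers of the round trip from t to s and back are its repetitions. The zeroth power is
  the vertex path of t, since that is the unit of the corner, so it fits the family
  \<open>loop\<close> at index 0.\<close>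

lemma eval_loop:
  assumes E: "(s, t) \<in> E" "(t, s) \<in> E"
  shows "int_poly_eval (corner P (vertex_path t)) F
      (edge_path G (t, s) \<otimes>\<^bsub>P\<^esub> edge_path G (s, t)) = lift_poly (\<lambda>k. (t, loop t s k)) F"
proof -
  let ?e = "vertex_path t :: ('v, 'v \<times> 'v) path \<Rightarrow>\<^sub>0 int" and ?C = "corner P (vertex_path t)"
  have t: "t \<in> V" using E E_V by blast
  have e: "?e \<in> carrier P" "?e \<otimes>\<^bsub>P\<^esub> ?e = ?e"
    using awalk_path_mem[OF awalk_Nil[OF t]] by (auto simp: basis_mult_single)
  have sel: "monoid.mult ?C = basis_mult (path_concat G)" "add ?C = (+)" "one ?C = ?e" "ring.zero ?C = 0"
    by (simp_all add: corner_def)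
  have mem: "Poly_Mapping.single (t, loop t s k) c \<in> carrier ?C" for k c
  proof -
    note w = loop_awalk[OF E, of k]
    have "Poly_Mapping.single (t, loop t s k) c = ?e \<otimes>\<^bsub>P\<^esub> Poly_Mapping.single (t, loop t s k) c \<otimes>\<^bsub>P\<^esub> ?e"
      using awalk_awlast[OF w] by (simp add: basis_mult_single del: frag_of_eq)
    moreover have "Poly_Mapping.single (t, loop t s k) c \<in> carrier P" using awalk_path_mem[OF w] by simp
    ultimately have "\<exists>x. Poly_Mapping.single (t, loop t s k) c = ?e \<otimes>\<^bsub>P\<^esub> x \<otimes>\<^bsub>P\<^esub> ?e \<and> x \<in> carrier P" by blast
    then show ?thesis unfolding corner_def by simp
  qed
  have z: "edge_path G (t, s) \<otimes>\<^bsub>P\<^esub> edge_path G (s, t) = Poly_Mapping.single (t, loop t s 1) (1::int)"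
    by (simp add: basis_mult_single loop_def)
  have C: "ring ?C" by (rule ring_corner[OF P.ring_axioms e])
  note pow_rules = monoid.nat_pow_0[OF ring.is_monoid[OF C]] monoid.nat_pow_Suc[OF ring.is_monoid[OF C]]
  have pow: "Poly_Mapping.single (t, loop t s 1) 1 [^]\<^bsub>?C\<^esub> k = Poly_Mapping.single (t, loop t s k) (1::int)" for k :: nat
  proof (induction k)
    case 0
    show ?case unfolding pow_rules sel by (simp add: loop_def)
  next
    case (Suc k)
    show ?case
      unfolding pow_rules Suc sel loop_Suc using awalk_awlast[OF loop_awalk[OF E, of k]]
      by (simp add: basis_mult_single loop_def)
  qed
  have "int_poly_eval ?C F (Poly_Mapping.single (t, loop t s 1) 1) =
      (\<Oplus>\<^bsub>?C\<^esub>k\<in>{..Polynomial.degree F}. Poly_Mapping.single (t, loop t s k) (Polynomial.coeff F k))"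
    unfolding int_poly_eval_def
  proof (rule abelian_monoid.finsum_cong'[OF abelian_group.axioms(1)[OF ring.is_abelian_group[OF C]] refl])
    show "[Polynomial.coeff F k] \<cdot>\<^bsub>?C\<^esub> (Poly_Mapping.single (t, loop t s 1) 1 [^]\<^bsub>?C\<^esub> k) =
        Poly_Mapping.single (t, loop t s k) (Polynomial.coeff F k)" for k
      unfolding pow by (rule add_pow_single[OF C sel(2,4) mem])
  qed (use mem in auto)
  also have "\<dots> = lift_poly (\<lambda>k. (t, loop t s k)) F"
    unfolding lift_poly_def by (rule finsum_ab_group_add[OF C sel(2,4)]) (use mem in auto)
  finally show ?thesis by (simp only: z)
qed

text \<open>A round trip along \<open>{a, b}\<close> has one arc (b, a), a round trip along any
  other edge has none. Hence an ordinary edge sees only the value at t = 1, which is 0 for the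
  relation t - 1 of label 3.\<close>

lemma M_loop:
  assumes E: "(s, t) \<in> E" "(t, s) \<in> E"
  shows "M u v (lift_poly (\<lambda>k. (t, loop t s k)) F) =
    (if u = t \<and> v = t then (if special (s, t) then F else [:poly F 1:]) else 0)"
proof -
  have bc: "ba_crossings (loop t s k) = (if special (s, t) then k else 0)" for k
    by (induction k) (auto simp: loop_def special_def)
  have m: "M u v (Poly_Mapping.single (t, loop t s k) c) =
     (if u = t \<and> v = t then Polynomial.monom c (if special (s, t) then k else 0) else 0)" for k c
    using awalk_awlast[OF loop_awalk[OF E, of k]] by (auto simp: M_single bc)
  have "[:poly F 1:] = (\<Sum>k\<le>Polynomial.degree F. Polynomial.monom (Polynomial.coeff F k) 0)"
    by (simp add: poly_altdef monom_0 const_poly_sum)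
  then show ?thesis
    by (auto simp: lift_poly_def M_sum m poly_as_sum_of_monoms intro!: sum.neutral)
qed

lemma zigzag_even: "r \<in> {a, b} \<Longrightarrow> zigzag (2 * k) r = loop r (other r) k"
proof (induction k)
  case (Suc k)
  then show ?case using other_ab[OF Suc.prems] by (simp add: loop_def)
qed (simp add: loop_def)

text \<open>Of the 2 k + 1 arcs, k run from b to a if the zigzag starts at a and k + 1 if it starts
  at b, whence the extra factor t.\<close>

lemma M_zigzag_odd:
  assumes r: "r \<in> {a, b}"
  shows "M u v (lift_poly (\<lambda>k. (r, zigzag (2 * k + 1) r)) F) =
    (if u = r \<and> v = other r then (if r = a then F else [:0, 1:] * F) else 0)"
proof -
  have m: "M u v (Poly_Mapping.single (r, zigzag (2 * k + 1) r) c) =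
     (if u = r \<and> v = other r then Polynomial.monom c (if r = a then k else Suc k) else 0)" for k c
  proof -
    have w: "awlast r (zigzag (2 * k + 1) r) = other r"
      using awalk_awlast[OF awalk_zigzag(1)[OF r, of "2 * k + 1"]] by (simp del: zigzag.simps)
    have c: "ba_crossings (zigzag (2 * k + 1) r) = (if r = a then k else Suc k)"
      unfolding awalk_zigzag(2)[OF r] by simp
    show ?thesis unfolding M_single fst_conv snd_conv w c by (rule if_cong) auto
  qed
  have "(\<Sum>k\<le>Polynomial.degree F. Polynomial.monom (Polynomial.coeff F k) (Suc k)) =
      [:0, 1:] * (\<Sum>k\<le>Polynomial.degree F. Polynomial.monom (Polynomial.coeff F k) k)"
    unfolding sum_distrib_left by (simp add: monom_Suc)
  then show ?thesis
    unfolding lift_poly_def M_sum m by (auto simp: poly_as_sum_of_monoms intro!: sum.neutral)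
qed

text \<open>These are the generators of the second algebra at an even label: the leading arc turns
  the round trips into zigzags of odd length.\<close>

lemma edge_zigzag:
  assumes "r \<in> {a, b}"
  shows "edge_path G (r, other r) \<otimes>\<^bsub>P\<^esub> lift_poly (\<lambda>k. (other r, loop (other r) r k)) F =
    lift_poly (\<lambda>k. (r, zigzag (2 * k + 1) r)) F"
  using zigzag_even[of "other r"] other_ab[OF assms]
  by (auto simp: lift_poly_def basis_mult_sum basis_mult_single intro!: sum.cong)

end

section \<open>The tensor isomorphisms for explicitly given relations\<close>

context edge_tree_quotient begin

lemma ex_enumeration: "finite U \<Longrightarrow> card U = n \<Longrightarrow> \<exists>e :: nat \<Rightarrow> 'v. bij_betw e {..<n} U"
  using ex_bij_betw_nat_finite[of U] by (auto simp: atLeast0LessThan)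

lemma loop_carrier:
  assumes "(s, t) \<in> E"
  shows "lift_poly (\<lambda>k. (t, loop t s k)) F \<in> carrier P"
  unfolding lift_poly_def path_algebra_sel mem_Collect_eq
  using awalk_path_mem[OF loop_awalk[OF assms E_sym[OF assms]]] by (intro keys_sum_subset) auto

lemma zigzag_carrier:
  assumes "r \<in> {a, b}"
  shows "lift_poly (\<lambda>k. (r, zigzag (2 * k + 1) r)) F \<in> carrier P"
  unfolding lift_poly_def path_algebra_sel mem_Collect_eq
proof (rule keys_sum_subset)
  fix k
  show "Poly_Mapping.keys (Poly_Mapping.single (r, zigzag (2 * k + 1) r) (Polynomial.coeff F k)) \<subseteq> graph_paths G"
    using awalk_path_mem[OF awalk_zigzag(1)[OF assms, of "2 * k + 1"]] by (simp del: zigzag.simps)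
qed

lemma lift_poly_linear: "lift_poly w [:-1, 1:] = Poly_Mapping.single (w 1) 1 - Poly_Mapping.single (w 0) 1"
  by (simp add: lift_poly_def single_uminus)

lemma edge_tree_idealI:
  assumes "ideal I P"
    and "\<And>s t. (s, t) \<in> E \<Longrightarrow> \<not> special (s, t) \<Longrightarrow> lift_poly (\<lambda>k. (t, loop t s k)) [:-1, 1:] \<in> I"
  shows "edge_tree_ideal V E a b side par dep I"
proof (rule edge_tree_ideal.intro[OF edge_tree_axioms edge_tree_ideal_axioms.intro[OF assms(1)]])
  fix s t assume st: "(s, t) \<in> E" "\<not> special (s, t)"
  \<comment> \<open>The relation at an arc is based at its head, so the opposite arc is taken to
    obtain a round trip at s.\<close>
  then have "lift_poly (\<lambda>k. (s, loop s t k)) [:-1, 1:] \<in> I"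
    using assms(2)[OF E_sym[OF st(1)]] by (auto simp: special_def)
  then show "Poly_Mapping.single (s, [(s, t), (t, s)]) 1 - Poly_Mapping.single (s, []) 1 \<in> I"
    by (simp add: lift_poly_linear loop_def)
qed

text \<open>All relations are round trips. At \<open>{a, b}\<close> they are the even zigzags; the
  odd ones follow by multiplication with an arc.\<close>

theorem tensor_iso_matrix_loops:
  assumes I: "I = Idl\<^bsub>P\<^esub> {lift_poly (\<lambda>k. (t, loop t s k)) (if special (s, t) then f else [:-1, 1:]) | s t. (s, t) \<in> E}"
    and N: "card V = N"
  shows "tensor_ring (P Quot I) Q_ring \<simeq> matrix_ring N K"
proof -
  define Gs where "Gs = {lift_poly (\<lambda>k. (t, loop t s k)) (if special (s, t) then f else [:-1, 1:]) | s t. (s, t) \<in> E}"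
  have I': "I = Idl\<^bsub>P\<^esub> Gs" by (simp only: I Gs_def)
  have Gs: "Gs \<subseteq> carrier P"
  proof
    fix g assume "g \<in> Gs"
    then obtain s t where "g = lift_poly (\<lambda>k. (t, loop t s k)) (if special (s, t) then f else [:-1, 1:])" "(s, t) \<in> E"
      unfolding Gs_def by blast
    then show "g \<in> carrier P" using loop_carrier by blast
  qed
  have id: "ideal I P" unfolding I' by (rule P.genideal_ideal[OF Gs])
  have GI: "lift_poly (\<lambda>k. (t, loop t s k)) (if special (s, t) then f else [:-1, 1:]) \<in> I" if "(s, t) \<in> E" for s t
    using P.genideal_self[OF Gs] that unfolding I' Gs_def by blast
  have ev: "lift_poly (\<lambda>k. (r, zigzag (2 * k) r)) f \<in> I" if r: "r \<in> {a, b}" for r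
  proof -
    have "(other r, r) \<in> E" "special (other r, r)" using r ab by (auto simp: special_def)
    from GI[OF this(1)] this(2) show ?thesis by (simp add: zigzag_even[OF r])
  qed
  have od: "lift_poly (\<lambda>k. (r, zigzag (2 * k + 1) r)) f \<in> I" if r: "r \<in> {a, b}" for r
  proof -
    have o: "other r \<in> {a, b}" "other (other r) = r" using other_ab[OF r] by auto
    have "lift_poly (\<lambda>k. (other r, loop (other r) r k)) f \<in> I"
      using ev[OF o(1)] unfolding zigzag_even[OF o(1)] o(2) .
    moreover have "edge_path G (r, other r) \<in> carrier P"
      using awalk_path_mem[OF awalk_arc[of r "other r"]] other_ab[OF r] by simp
    ultimately show ?thesis unfolding edge_zigzag[OF r, symmetric] by (rule ideal.I_l_closed[OF id])
  qed
  obtain e where e: "bij_betw e {..<N} V" using ex_enumeration[OF finite_V N] by blast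
  interpret gens: edge_tree_gens V E a b side par dep f K actK \<kappa> I Gs N e
  proof (rule edge_tree_gens.intro[OF edge_tree_quotient_axioms edge_tree_idealI[OF id] edge_tree_gens_axioms.intro[OF I' Gs e od]])
    show "lift_poly (\<lambda>k. (t, loop t s k)) [:-1, 1:] \<in> I" if "(s, t) \<in> E" "\<not> special (s, t)" for s t
      using GI[OF that(1)] that(2) by simp
    fix g u v assume "g \<in> Gs"
    then obtain s t where g: "g = lift_poly (\<lambda>k. (t, loop t s k)) (if special (s, t) then f else [:-1, 1:])" "(s, t) \<in> E"
      unfolding Gs_def by blast
    show "f dvd M u v g"
      unfolding g(1) M_loop[OF g(2) E_sym[OF g(2)]] by simp
  qed
  show ?thesis by (rule gens.tensor_iso_matrix[OF ev])
qed

text \<open>Generators have constant term 0 between equal sides: round trips at ordinary edges have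
  matrix 0, and odd zigzags join different sides.\<close>

theorem tensor_iso_matrix_product_loops:
  assumes I: "I = Idl\<^bsub>P\<^esub> ({lift_poly (\<lambda>k. (t, loop t s k)) [:-1, 1:] | s t. (s, t) \<in> E \<and> \<not> special (s, t)} \<union>
      {lift_poly (\<lambda>k. (r, zigzag (2 * k + 1) r)) f | r. r \<in> {a, b}})"
    and N: "card V = N" "card {v\<in>V. side v} = n1" "card {v\<in>V. \<not> side v} = n2"
  shows "tensor_ring (P Quot I) Q_ring \<simeq>
    RDirProd (matrix_ring N K) (RDirProd (matrix_ring n1 Q_ring) (matrix_ring n2 Q_ring))"
proof -
  define Gs where "Gs = {lift_poly (\<lambda>k. (t, loop t s k)) [:-1, 1:] | s t. (s, t) \<in> E \<and> \<not> special (s, t)} \<union>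
      {lift_poly (\<lambda>k. (r, zigzag (2 * k + 1) r)) f | r. r \<in> {a, b}}"
  have I': "I = Idl\<^bsub>P\<^esub> Gs" by (simp only: I Gs_def)
  have Gs: "Gs \<subseteq> carrier P"
  proof
    fix g assume "g \<in> Gs"
    then show "g \<in> carrier P" unfolding Gs_def using loop_carrier zigzag_carrier by blast
  qed
  have id: "ideal I P" unfolding I' by (rule P.genideal_ideal[OF Gs])
  have GI: "lift_poly (\<lambda>k. (t, loop t s k)) [:-1, 1:] \<in> I" if "(s, t) \<in> E" "\<not> special (s, t)" for s t
    using P.genideal_self[OF Gs] that unfolding I' Gs_def by blast
  have od: "lift_poly (\<lambda>k. (r, zigzag (2 * k + 1) r)) f \<in> I" if "r \<in> {a, b}" for r
    using P.genideal_self[OF Gs] that unfolding I' Gs_def by blast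
  have gM: "f dvd M u v g \<and> (side u = side v \<longrightarrow> Polynomial.coeff (M u v g) 0 = 0)" if "g \<in> Gs" for g u v
  proof -
    from that consider s t where "g = lift_poly (\<lambda>k. (t, loop t s k)) [:-1, 1:]" "(s, t) \<in> E" "\<not> special (s, t)"
      | r where "g = lift_poly (\<lambda>k. (r, zigzag (2 * k + 1) r)) f" "r \<in> {a, b}"
      unfolding Gs_def by blast
    then show ?thesis
    proof cases
      case 1
      show ?thesis unfolding 1(1) M_loop[OF 1(2) E_sym[OF 1(2)]] using 1(3) by simp
    next
      case 2
      then have "side r \<noteq> side (other r)" using ab by auto
      then show ?thesis unfolding 2(1) M_zigzag_odd[OF 2(2)] by (auto simp del: mult_pCons_left)
    qed
  qed
  obtain e where e: "bij_betw e {..<N} V" using ex_enumeration[OF finite_V N(1)] by blast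
  have fin: "finite {v\<in>V. side v}" "finite {v\<in>V. \<not> side v}" using finite_V by simp_all
  obtain e1 where e1: "bij_betw e1 {..<n1} {v\<in>V. side v}" using ex_enumeration[OF fin(1) N(2)] by blast
  obtain e2 where e2: "bij_betw e2 {..<n2} {v\<in>V. \<not> side v}" using ex_enumeration[OF fin(2) N(3)] by blast
  interpret gens: edge_tree_gens V E a b side par dep f K actK \<kappa> I Gs N e
    by (rule edge_tree_gens.intro[OF edge_tree_quotient_axioms edge_tree_idealI[OF id] edge_tree_gens_axioms.intro[OF I' Gs e od]])
      (use GI gM in blast)+
  show ?thesis
    by (rule gens.tensor_iso_matrix_product) (use e1 e2 gM in simp_all)
qed

end

section \<open>Coxeter graphs that are trees\<close>

lemma Setcompr_cong2:
  assumes "\<And>s t. Q s t \<longleftrightarrow> Q' s t" "\<And>s t. Q' s t \<Longrightarrow> F s t = F' s t"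
  shows "{F s t | s t. Q s t} = {F' s t | s t. Q' s t}"
  using assms by metis

text \<open>The label m belongs to \<open>{a, b}\<close> and may be 3 as well; every other edge has
  label 3. By \<open>E_iff\<close> no edge carries the entry 0 that encodes infinity.\<close>

locale coxeter_tree = edge_tree S E a b side par dep
  for S :: "'w set" and E a b side par dep +
  fixes W :: "('w, 'x) monoid_scheme" and m :: nat
  assumes E_arcs: "E = arcs (coxeter_graph W S)"
    and matrix: "\<And>s t. (s, t) \<in> E \<Longrightarrow> coxeter_matrix W s t = (if special (s, t) then m else 3)"
    and E_iff: "\<And>s t. s \<in> S \<Longrightarrow> t \<in> S \<Longrightarrow> 2 < coxeter_matrix W s t \<longleftrightarrow> (s, t) \<in> E"
    and m: "m \<ge> 3"
begin

lemma coxeter_graph_eq: "coxeter_graph W S = G"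
proof -
  have "G = \<lparr>verts = S, arcs = arcs (coxeter_graph W S), tail = fst, head = snd\<rparr>"
    unfolding G_def by (simp only: E_arcs[symmetric])
  then show ?thesis by (simp add: coxeter_graph_def)
qed

lemma P_ring_eq: "P_ring W S = P"
  by (simp add: P_ring_def coxeter_graph_eq)

lemma loop_eval_eq: "(s, t) \<in> E \<Longrightarrow> loop_eval W S F s t = lift_poly (\<lambda>k. (t, loop t s k)) F"
  unfolding loop_eval_def P_ring_eq coxeter_graph_eq by (rule eval_loop[OF _ E_sym])

lemma arc_iff: "s \<in> S \<and> t \<in> S \<and> 2 < coxeter_matrix W s t \<longleftrightarrow> (s, t) \<in> E"
  using E_iff E_V by blast

theorem R_hat_iso:
  assumes "poly_quotient (C_poly m) K actK \<kappa>" "card S = N"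
  shows "R_hat W S \<simeq> matrix_ring N K"
proof -
  interpret q: poly_quotient "C_poly m" K actK \<kappa> by fact
  interpret edge_tree_quotient S E a b side par dep "C_poly m" K actK \<kappa> ..
  have "{loop_eval W S (C_poly (coxeter_matrix W s t)) s t | s t. s \<in> S \<and> t \<in> S \<and> 2 < coxeter_matrix W s t} =
      {lift_poly (\<lambda>k. (t, loop t s k)) (if special (s, t) then C_poly m else [:-1, 1:]) | s t. (s, t) \<in> E}"
  proof -
    have *: "loop_eval W S (C_poly (coxeter_matrix W s t)) s t =
        lift_poly (\<lambda>k. (t, loop t s k)) (if special (s, t) then C_poly m else [:-1, 1:])" if "(s, t) \<in> E" for s t
      using that by (simp add: loop_eval_eq matrix C_poly_3)
    show ?thesis by (rule Setcompr_cong2[OF arc_iff *])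
  qed
  then show ?thesis
    unfolding R_hat_def R_ring_def P_ring_eq I_ideal_def
    by (intro tensor_iso_matrix_loops assms(2)) simp
qed

text \<open>All labels are odd, so the second family of generators is empty, and at label 3 both
  polynomials equal t - 1.\<close>

theorem R_tilde_hat_iso_odd:
  assumes "odd m" "poly_quotient (c_poly m) K actK \<kappa>" "card S = N"
  shows "R_tilde_hat W S \<simeq> matrix_ring N K"
proof -
  interpret q: poly_quotient "c_poly m" K actK \<kappa> by fact
  interpret edge_tree_quotient S E a b side par dep "c_poly m" K actK \<kappa> ..
  have od: "odd (coxeter_matrix W s t)" if "(s, t) \<in> E" for s t using matrix[OF that] assms(1) by simp
  have *: "loop_eval W S (c_poly (coxeter_matrix W s t)) s t =
      lift_poly (\<lambda>k. (t, loop t s k)) (if special (s, t) then c_poly m else [:-1, 1:])" if "(s, t) \<in> E" for s t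
    using that by (simp add: loop_eval_eq matrix C_poly_3 c_poly_eq_C_poly)
  have 1: "{loop_eval W S (c_poly (coxeter_matrix W s t)) s t | s t.
      s \<in> S \<and> t \<in> S \<and> 2 < coxeter_matrix W s t \<and> odd (coxeter_matrix W s t)} =
      {lift_poly (\<lambda>k. (t, loop t s k)) (if special (s, t) then c_poly m else [:-1, 1:]) | s t. (s, t) \<in> E}"
  proof (rule Setcompr_cong2[OF _ *])
    show "s \<in> S \<and> t \<in> S \<and> 2 < coxeter_matrix W s t \<and> odd (coxeter_matrix W s t) \<longleftrightarrow> (s, t) \<in> E" for s t
      using od[of s t] arc_iff[of s t] by blast
  qed
  have no: "\<not> (s \<in> S \<and> t \<in> S \<and> 2 < coxeter_matrix W s t \<and> even (coxeter_matrix W s t))" for s t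
    using od[of s t] arc_iff[of s t] by blast
  have 2: "{y_edge W S s t \<otimes>\<^bsub>P_ring W S\<^esub> loop_eval W S (c_poly (coxeter_matrix W s t)) s t | s t.
      s \<in> S \<and> t \<in> S \<and> 2 < coxeter_matrix W s t \<and> even (coxeter_matrix W s t)} = {}"
    using no by blast
  show ?thesis
    unfolding R_tilde_hat_def R_tilde_ring_def I_tilde_ideal_def 1 2 unfolding P_ring_eq Un_empty_right
    by (rule tensor_iso_matrix_loops[OF refl assms(3)])
qed

text \<open>The only even label is that of \<open>{a, b}\<close>, so the first family of generators
  comes from the ordinary edges and the second consists of the two odd zigzag relations.\<close>

theorem R_tilde_hat_iso_even:
  assumes "even m" "poly_quotient (c_poly m) K actK \<kappa>"
    and "card S = N" "card {v\<in>S. side v} = n1" "card {v\<in>S. \<not> side v} = n2"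
  shows "R_tilde_hat W S \<simeq>
    RDirProd (matrix_ring N K) (RDirProd (matrix_ring n1 Q_ring) (matrix_ring n2 Q_ring))"
proof -
  interpret q: poly_quotient "c_poly m" K actK \<kappa> by fact
  interpret edge_tree_quotient S E a b side par dep "c_poly m" K actK \<kappa> ..
  have ev: "even (coxeter_matrix W s t) \<longleftrightarrow> special (s, t)" if "(s, t) \<in> E" for s t using matrix[OF that] assms(1) by simp
  have *: "loop_eval W S (c_poly (coxeter_matrix W s t)) s t =
      lift_poly (\<lambda>k. (t, loop t s k)) [:-1, 1:]" if "(s, t) \<in> E \<and> \<not> special (s, t)" for s t
    using that by (simp add: loop_eval_eq matrix C_poly_3 c_poly_eq_C_poly)
  have 1: "{loop_eval W S (c_poly (coxeter_matrix W s t)) s t | s t.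
      s \<in> S \<and> t \<in> S \<and> 2 < coxeter_matrix W s t \<and> odd (coxeter_matrix W s t)} =
      {lift_poly (\<lambda>k. (t, loop t s k)) [:-1, 1:] | s t. (s, t) \<in> E \<and> \<not> special (s, t)}"
  proof (rule Setcompr_cong2[OF _ *])
    show "s \<in> S \<and> t \<in> S \<and> 2 < coxeter_matrix W s t \<and> odd (coxeter_matrix W s t) \<longleftrightarrow>
        (s, t) \<in> E \<and> \<not> special (s, t)" for s t
      using ev[of s t] arc_iff[of s t] by blast
  qed
  have **: "y_edge W S s t \<otimes>\<^bsub>P_ring W S\<^esub> loop_eval W S (c_poly (coxeter_matrix W s t)) s t =
      lift_poly (\<lambda>k. (s, zigzag (2 * k + 1) s)) (c_poly m) \<and> s \<in> {a, b}" if st: "(s, t) \<in> E" "special (s, t)" for s t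
  proof -
    have s: "s \<in> {a, b}" "t = other s" using st(2) by (auto simp: special_def)
    show ?thesis
      unfolding loop_eval_eq[OF st(1)] matrix[OF st(1)] P_ring_eq coxeter_graph_eq
      using s(1) st(2) edge_zigzag[OF s(1)] by (simp only: if_True s(2))
  qed
  have sp: "(r, other r) \<in> E \<and> special (r, other r)" if "r \<in> {a, b}" for r using other_ab[OF that] by blast
  have 2: "{y_edge W S s t \<otimes>\<^bsub>P_ring W S\<^esub> loop_eval W S (c_poly (coxeter_matrix W s t)) s t | s t.
      s \<in> S \<and> t \<in> S \<and> 2 < coxeter_matrix W s t \<and> even (coxeter_matrix W s t)} =
      {lift_poly (\<lambda>k. (r, zigzag (2 * k + 1) r)) (c_poly m) | r. r \<in> {a, b}}" (is "?L = ?R")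
  proof
    show "?L \<subseteq> ?R"
    proof
      fix g assume "g \<in> ?L"
      then obtain s t where g: "g = y_edge W S s t \<otimes>\<^bsub>P_ring W S\<^esub> loop_eval W S (c_poly (coxeter_matrix W s t)) s t"
        "(s, t) \<in> E" "even (coxeter_matrix W s t)" using arc_iff by blast
      then show "g \<in> ?R" using **[of s t] ev[of s t] by blast
    qed
    show "?R \<subseteq> ?L"
    proof
      fix g assume "g \<in> ?R"
      then obtain r where r: "r \<in> {a, b}" "g = lift_poly (\<lambda>k. (r, zigzag (2 * k + 1) r)) (c_poly m)" by blast
      then have "g = y_edge W S r (other r) \<otimes>\<^bsub>P_ring W S\<^esub> loop_eval W S (c_poly (coxeter_matrix W r (other r))) r (other r)"
        using **[of r "other r"] sp[OF r(1)] by metis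
      moreover have "r \<in> S \<and> other r \<in> S \<and> 2 < coxeter_matrix W r (other r) \<and> even (coxeter_matrix W r (other r))"
        using ev[of r "other r"] sp[OF r(1)] arc_iff[of r "other r"] by blast
      ultimately show "g \<in> ?L" unfolding mem_Collect_eq by blast
    qed
  qed
  show ?thesis
    unfolding R_tilde_hat_def R_tilde_ring_def I_tilde_ideal_def 1 2 unfolding P_ring_eq
    by (rule tensor_iso_matrix_product_loops[OF refl assms(3-5)])
qed

end

lemma coxeter_matrix_diag:
  assumes "coxeter_system W S" "s \<in> S"
  shows "coxeter_matrix W s s = 1"
proof -
  interpret group W using assms(1) by (simp add: coxeter_system_def)
  have s: "s \<in> carrier W" "group.ord W s = 2" using assms by (auto simp: coxeter_system_def)
  then have "s \<otimes>\<^bsub>W\<^esub> s = \<one>\<^bsub>W\<^esub>" using pow_ord_eq_1[of s] by (simp add: numeral_2_eq_2)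
  then show ?thesis by (simp add: coxeter_matrix_def)
qed

text \<open>For involutions ts is the inverse of st, and inverse elements have equal order.\<close>

lemma coxeter_matrix_sym:
  assumes "coxeter_system W S" "s \<in> S" "t \<in> S"
  shows "coxeter_matrix W s t = coxeter_matrix W t s"
proof -
  interpret group W using assms(1) by (simp add: coxeter_system_def)
  have inv: "r \<in> carrier W \<and> inv\<^bsub>W\<^esub> r = r" if "r \<in> S" for r
  proof -
    have r: "r \<in> carrier W" "group.ord W r = 2" using assms(1) that by (auto simp: coxeter_system_def)
    then have "r \<otimes>\<^bsub>W\<^esub> r = \<one>\<^bsub>W\<^esub>" using pow_ord_eq_1[of r] by (simp add: numeral_2_eq_2)
    then show ?thesis using r inv_equality[of r r] by simp
  qed
  have "t \<otimes>\<^bsub>W\<^esub> s = inv\<^bsub>W\<^esub> (s \<otimes>\<^bsub>W\<^esub> t)" using inv[OF assms(2)] inv[OF assms(3)] inv_mult_group by simp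
  then show ?thesis
    unfolding coxeter_matrix_def using inv[OF assms(2)] inv[OF assms(3)] ord_inv[of "s \<otimes>\<^bsub>W\<^esub> t"] by simp
qed

text \<open>Transports a tree on the numbers from 1 to r, given by a parent function p with depths d
  and sides sd, along the enumeration s of the generators.\<close>

lemma coxeter_tree_of_enumeration:
  fixes s :: "nat \<Rightarrow> 'w" and d :: "nat \<Rightarrow> nat"
  assumes cs: "coxeter_system W S" and bij: "bij_betw s {1..r} S"
    and ent: "\<And>i j. 1 \<le> i \<Longrightarrow> i < j \<Longrightarrow> j \<le> r \<Longrightarrow> coxeter_matrix W (s i) (s j) =
      (if i = ia \<and> j = ib then m
       else if i \<noteq> ia \<and> i \<noteq> ib \<and> j = p i \<or> j \<noteq> ia \<and> j \<noteq> ib \<and> i = p j then 3 else 2)"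
    and iab: "1 \<le> ia" "ia < ib" "ib \<le> r" "sd ia" "\<not> sd ib" and m: "m \<ge> 3"
    and p: "\<And>i. 1 \<le> i \<Longrightarrow> i \<le> r \<Longrightarrow> i \<noteq> ia \<Longrightarrow> i \<noteq> ib \<Longrightarrow>
      1 \<le> p i \<and> p i \<le> r \<and> d (p i) < d i \<and> sd (p i) = sd i"
  defines "ix \<equiv> inv_into {1..r} s"
  shows "coxeter_tree S (arcs (coxeter_graph W S)) (s ia) (s ib) (sd \<circ> ix) (s \<circ> p \<circ> ix) (d \<circ> ix) W m"
proof -
  define E where "E = arcs (coxeter_graph W S)"
  define ran where "ran i \<longleftrightarrow> 1 \<le> i \<and> i \<le> r" for i
  define adj where "adj i j \<longleftrightarrow> i \<noteq> ia \<and> i \<noteq> ib \<and> j = p i \<or> j \<noteq> ia \<and> j \<noteq> ib \<and> i = p j" for i j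
  have ix: "ix (s i) = i" and sS: "s i \<in> S" if "ran i" for i
    using bij_betw_inv_into_left[OF bij, of i] bij that by (auto simp: ix_def ran_def bij_betw_def)
  have ex: "\<exists>i. ran i \<and> v = s i" if "v \<in> S" for v
    using bij that by (auto simp: bij_betw_def ran_def)
  have inj: "s i = s j \<longleftrightarrow> i = j" if "ran i" "ran j" for i j
    using ix[OF that(1)] ix[OF that(2)] by metis
  have ab_ran: "ran ia" "ran ib" using iab by (auto simp: ran_def)
  have fin: "finite S" using bij bij_betw_finite by blast
  \<comment> \<open>The entries are given for i < j only; symmetry of the Coxeter matrix supplies
    the rest.\<close>
  have mat: "coxeter_matrix W (s i) (s j) =
      (if i = ia \<and> j = ib \<or> i = ib \<and> j = ia then m else if adj i j then 3 else 2)"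
    if ij: "ran i" "ran j" "i \<noteq> j" for i j
  proof (cases "i < j")
    case True
    then show ?thesis using ent[of i j] ij iab by (auto simp: ran_def adj_def)
  next
    case False
    then have "j < i" using ij by simp
    then show ?thesis using ent[of j i] ij iab coxeter_matrix_sym[OF cs sS[OF ij(1)] sS[OF ij(2)]]
      by (auto simp: ran_def adj_def)
  qed
  have EI: "(s i, s j) \<in> E \<longleftrightarrow> i \<noteq> j \<and> (i = ia \<and> j = ib \<or> i = ib \<and> j = ia \<or> adj i j)"
    if ij: "ran i" "ran j" for i j
  proof (cases "i = j")
    case False
    then show ?thesis using mat[OF ij False] m sS[OF ij(1)] sS[OF ij(2)] inj[OF ij]
      by (auto simp: E_def coxeter_graph_def)
  qed (simp add: E_def coxeter_graph_def)
  have ES: "u \<in> S \<and> v \<in> S" if "(u, v) \<in> E" for u v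
    using that by (simp add: E_def coxeter_graph_def)
  have p': "ran (p i) \<and> d (p i) < d i \<and> sd (p i) = sd i \<and> p i \<noteq> i" if "ran i" "i \<noteq> ia" "i \<noteq> ib" for i
    using p[of i] that by (auto simp: ran_def)
  interpret edge_tree S E "s ia" "s ib" "sd \<circ> ix" "s \<circ> p \<circ> ix" "d \<circ> ix"
  proof (rule edge_tree.intro[OF fin])
    show "(s ia, s ib) \<in> E" "(s ib, s ia) \<in> E" using EI ab_ran iab by auto
    show "(sd \<circ> ix) (s ia)" "\<not> (sd \<circ> ix) (s ib)" using ab_ran iab by (auto simp: ix)
    show "u \<in> S \<and> v \<in> S" if "(u, v) \<in> E" for u v by (rule ES[OF that])
    fix v assume v: "v \<in> S" "v \<noteq> s ia" "v \<noteq> s ib"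
    obtain i where i: "ran i" "v = s i" using ex[OF v(1)] by blast
    have ni: "i \<noteq> ia" "i \<noteq> ib" using v i by auto
    note pi = p'[OF i(1) ni]
    have "(s i, s (p i)) \<in> E" "(s (p i), s i) \<in> E"
      using EI[OF i(1), of "p i"] EI[of "p i" i] pi ni i(1) by (auto simp: adj_def)
    then show "(v, (s \<circ> p \<circ> ix) v) \<in> E \<and> ((s \<circ> p \<circ> ix) v, v) \<in> E \<and>
        (d \<circ> ix) ((s \<circ> p \<circ> ix) v) < (d \<circ> ix) v \<and> (sd \<circ> ix) ((s \<circ> p \<circ> ix) v) = (sd \<circ> ix) v"
      using pi i by (simp add: ix)
  next
    fix u v assume uv: "(u, v) \<in> E"
    obtain i j where ij: "ran i" "u = s i" "ran j" "v = s j" using ES[OF uv] ex by blast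
    have "i = ia \<and> j = ib \<or> i = ib \<and> j = ia \<or> adj i j" using EI[OF ij(1,3)] uv ij by blast
    then show "(u, v) = (s ia, s ib) \<or> (u, v) = (s ib, s ia) \<or>
        u \<noteq> s ia \<and> u \<noteq> s ib \<and> v = (s \<circ> p \<circ> ix) u \<or> v \<noteq> s ia \<and> v \<noteq> s ib \<and> u = (s \<circ> p \<circ> ix) v"
      using ij by (auto simp: adj_def inj ab_ran ix)
  qed
  have sp: "special (s i, s j) \<longleftrightarrow> i = ia \<and> j = ib \<or> i = ib \<and> j = ia" if "ran i" "ran j" for i j
    using that by (simp add: special_def inj ab_ran)
  have "coxeter_tree S E (s ia) (s ib) (sd \<circ> ix) (s \<circ> p \<circ> ix) (d \<circ> ix) W m"
  proof (rule coxeter_tree.intro[OF edge_tree_axioms coxeter_tree_axioms.intro])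
    show "E = arcs (coxeter_graph W S)" by (rule E_def)
    show "m \<ge> 3" by (rule m)
    show "coxeter_matrix W u v = (if special (u, v) then m else 3)" if uv: "(u, v) \<in> E" for u v
    proof -
      obtain i j where ij: "ran i" "u = s i" "ran j" "v = s j" using ES[OF uv] ex by blast
      show ?thesis using EI[OF ij(1,3)] uv mat[OF ij(1,3)] sp[OF ij(1,3)] ij(2,4) by auto
    qed
    show "2 < coxeter_matrix W u v \<longleftrightarrow> (u, v) \<in> E" if uv: "u \<in> S" "v \<in> S" for u v
    proof -
      obtain i j where ij: "ran i" "u = s i" "ran j" "v = s j" using uv ex by blast
      show ?thesis
      proof (cases "i = j")
        case True
        then show ?thesis using EI[OF ij(1,3)] coxeter_matrix_diag[OF cs uv(1)] ij by simp
      next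
        case False
        then show ?thesis using EI[OF ij(1,3)] mat[OF ij(1,3) False] m ij(2,4) by auto
      qed
    qed
  qed
  then show ?thesis by (simp only: E_def)
qed

text \<open>After this each type is a matter of index arithmetic: a distinguished edge, a parent
  function, depths and sides. The two cardinalities are kept because they are the sizes of the
  blocks at t = 0.\<close>

lemma coxeter_tree_of_type:
  fixes W :: "('w, 'x) monoid_scheme" and d :: "nat \<Rightarrow> nat"
  assumes cs: "coxeter_system W S" and ty: "of_type W S T" and r: "type_rank T = r"
    and ent: "\<And>i j. 1 \<le> i \<Longrightarrow> i < j \<Longrightarrow> j \<le> r \<Longrightarrow> type_entry T i j =
      (if i = ia \<and> j = ib then m
       else if i \<noteq> ia \<and> i \<noteq> ib \<and> j = p i \<or> j \<noteq> ia \<and> j \<noteq> ib \<and> i = p j then 3 else 2)"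
    and iab: "1 \<le> ia" "ia < ib" "ib \<le> r" "sd ia" "\<not> sd ib" and m: "m \<ge> 3"
    and p: "\<And>i. 1 \<le> i \<Longrightarrow> i \<le> r \<Longrightarrow> i \<noteq> ia \<Longrightarrow> i \<noteq> ib \<Longrightarrow>
      1 \<le> p i \<and> p i \<le> r \<and> d (p i) < d i \<and> sd (p i) = sd i"
  shows "\<exists>E a b side par dep. coxeter_tree S E a b side par dep W m \<and> card S = r \<and>
    card {v\<in>S. side v} = card {i\<in>{1..r}. sd i} \<and> card {v\<in>S. \<not> side v} = card {i\<in>{1..r}. \<not> sd i}"
proof -
  obtain s where s: "bij_betw s {1..r} S"
    "\<And>i j. 1 \<le> i \<Longrightarrow> i < j \<Longrightarrow> j \<le> r \<Longrightarrow> coxeter_matrix W (s i) (s j) = type_entry T i j"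
    using ty unfolding of_type_def r by blast
  let ?ix = "inv_into {1..r} s"
  have tree: "coxeter_tree S (arcs (coxeter_graph W S)) (s ia) (s ib) (sd \<circ> ?ix) (s \<circ> p \<circ> ?ix) (d \<circ> ?ix) W m"
    by (rule coxeter_tree_of_enumeration[OF cs s(1) _ iab m p]) (simp_all add: s(2) ent)
  have c: "card {v\<in>S. Q (?ix v)} = card {i\<in>{1..r}. Q i}" for Q
  proof -
    have inj: "inj_on s {i\<in>{1..r}. Q i}"
      using s(1) unfolding bij_betw_def by (blast intro: inj_on_subset)
    have "{v\<in>S. Q (?ix v)} = s ` {i\<in>{1..r}. Q i}"
    proof (intro equalityI subsetI)
      fix v assume v: "v \<in> {v\<in>S. Q (?ix v)}"
      then have "?ix v \<in> {1..r}" "s (?ix v) = v"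
        using bij_betw_apply[OF bij_betw_inv_into[OF s(1)], of v] bij_betw_inv_into_right[OF s(1), of v] by simp_all
      then show "v \<in> s ` {i\<in>{1..r}. Q i}" using v by force
    next
      fix v assume "v \<in> s ` {i\<in>{1..r}. Q i}"
      then obtain i where i: "i \<in> {1..r}" "Q i" "v = s i" by blast
      then show "v \<in> {v\<in>S. Q (?ix v)}"
        using bij_betw_inv_into_left[OF s(1) i(1)] bij_betw_apply[OF s(1) i(1)] by simp
    qed
    then show ?thesis using card_image[OF inj] by simp
  qed
  have "card S = r" using bij_betw_same_card[OF s(1)] by simp
  moreover have "card {v\<in>S. (sd \<circ> ?ix) v} = card {i\<in>{1..r}. sd i}"
    "card {v\<in>S. \<not> (sd \<circ> ?ix) v} = card {i\<in>{1..r}. \<not> sd i}"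
    using c[of sd] c[of "\<lambda>i. \<not> sd i"] by simp_all
  ultimately show ?thesis using tree by blast
qed

lemma poly_quotient_C_poly: "n \<ge> 3 \<Longrightarrow> \<exists>act \<kappa>. poly_quotient (C_poly n) (Qn_ring n) act \<kappa>"
  unfolding Qn_ring_def using poly_quotient_Quot[of "C_poly n"] C_poly_monic[of n] C_poly_0[of n]
  by (auto simp: poly_0_coeff_0)

lemma poly_quotient_c_poly: "n \<ge> 1 \<Longrightarrow> \<exists>act \<kappa>. poly_quotient (c_poly n) (Ln_ring n) act \<kappa>"
  unfolding Ln_ring_def using poly_quotient_Quot[of "c_poly n"] c_poly_monic[of n] c_poly_0[of n]
  by (auto simp: poly_0_coeff_0)

lemma poly_quotient_rational:
  "poly_quotient (C_poly 3) Q_ring (*) (\<lambda>p. poly p (of_int 1))"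
  "poly_quotient (C_poly 4) Q_ring (*) (\<lambda>p. poly p (of_int 2))"
  "poly_quotient (C_poly 6) Q_ring (*) (\<lambda>p. poly p (of_int 3))"
  unfolding C_poly_3 C_poly_4 C_poly_6
  using poly_quotient_Q[of 1] poly_quotient_Q[of 2] poly_quotient_Q[of 3] by simp_all

text \<open>Without edges there is no distinguished one, and both ideals are generated by the empty
  set. The path algebra is a copy of the integers.\<close>

lemma rank_one_iso:
  assumes S: "S = {x}" and cm: "coxeter_matrix W x x = 1"
  shows "R_hat W S \<simeq> matrix_ring 1 Q_ring" "R_tilde_hat W S \<simeq> matrix_ring 1 Q_ring"
proof -
  define G where "G = coxeter_graph W S"
  have G: "G = \<lparr>verts = {x}, arcs = {}, tail = fst, head = snd\<rparr>"
    by (auto simp: G_def coxeter_graph_def S)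
  define P where "P = P_ring W S"
  have P: "P = path_algebra G" by (simp add: P_def P_ring_def G_def)
  have wf: "wf_digraph G" by (simp add: G wf_digraph_def)
  have ringP: "ring P" unfolding P by (rule ring_path_algebra[OF wf]) (simp add: G)
  interpret P: ring P by (rule ringP)
  have paths: "graph_paths G = {(x, [])}"
    by (auto simp: graph_paths_def pre_digraph.awalk_def G pre_digraph.cas.simps)
  have single: "y = Poly_Mapping.single (x, []) (Poly_Mapping.lookup y (x, []))" if "y \<in> carrier P" for y
  proof (rule poly_mapping_eqI)
    fix k
    show "Poly_Mapping.lookup y k = Poly_Mapping.lookup (Poly_Mapping.single (x, []) (Poly_Mapping.lookup y (x, []))) k"
      using that by (cases "k = (x, [])") (auto simp: P paths lookup_single in_keys_iff when_def)
  qed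
  define \<phi> where "\<phi> y = rat_of_int (Poly_Mapping.lookup y (x, []))" for y :: "('a, 'a \<times> 'a) path \<Rightarrow>\<^sub>0 int"
  have mult: "\<phi> (y \<otimes>\<^bsub>P\<^esub> z) = \<phi> y * \<phi> z" if "y \<in> carrier P" "z \<in> carrier P" for y z
  proof -
    have "\<phi> (Poly_Mapping.single (x, []) c \<otimes>\<^bsub>P\<^esub> Poly_Mapping.single (x, []) d) = of_int c * of_int d" for c d
      by (simp add: P basis_mult_single \<phi>_def pre_digraph.awalk_verts.simps)
    then show ?thesis using single[OF that(1)] single[OF that(2)] unfolding \<phi>_def by metis
  qed
  have phi: "\<phi> \<in> Ring.ring_hom P Q_ring"
  proof (rule ring_hom_memI)
    show "\<phi> (y \<otimes>\<^bsub>P\<^esub> z) = \<phi> y \<otimes>\<^bsub>Q_ring\<^esub> \<phi> z" if "y \<in> carrier P" "z \<in> carrier P" for y z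
      using mult[OF that] by simp
    show "\<phi> (y \<oplus>\<^bsub>P\<^esub> z) = \<phi> y \<oplus>\<^bsub>Q_ring\<^esub> \<phi> z" for y z by (simp add: P \<phi>_def lookup_add)
    show "\<phi> \<one>\<^bsub>P\<^esub> = \<one>\<^bsub>Q_ring\<^esub>" by (simp add: P \<phi>_def G)
  qed simp
  interpret h: ring_hom_ring P Q_ring \<phi>
    by (rule ring_hom_ringI2[OF ringP ring_from_type_algebra phi])
  have iso: "tensor_ring (P Quot Idl\<^bsub>P\<^esub> {}) Q_ring \<simeq> Q_ring"
  proof (rule tensor_ring_Quot_Q_iso[OF ringP rat_algebra_Q phi])
    show "Idl\<^bsub>P\<^esub> {} = a_kernel P Q_ring \<phi>"
    proof
      show "Idl\<^bsub>P\<^esub> {} \<subseteq> a_kernel P Q_ring \<phi>" by (rule P.genideal_minimal[OF h.kernel_is_ideal]) simp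
      show "a_kernel P Q_ring \<phi> \<subseteq> Idl\<^bsub>P\<^esub> {}"
      proof
        fix y assume "y \<in> a_kernel P Q_ring \<phi>"
        then have y: "y \<in> carrier P" "\<phi> y = 0" unfolding a_kernel_iff by simp_all
        then have "y = 0" using single[OF y(1)] by (simp add: \<phi>_def)
        then have "y = \<zero>\<^bsub>P\<^esub>" by (simp add: P)
        then show "y \<in> Idl\<^bsub>P\<^esub> {}"
          using additive_subgroup.zero_closed[OF ideal.axioms(1)[OF P.genideal_ideal[of "{}"]]] by simp
      qed
    qed
    fix q :: rat
    obtain k l where kl: "quotient_of q = (k, l)" by fastforce
    then have l: "l > 0" and q: "q = of_int k / of_int l"
      using quotient_of_denom_pos quotient_of_div by blast+
    have "Poly_Mapping.single (x, []) k \<in> carrier P" by (simp add: P paths)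
    moreover have "q = 1 / of_nat (nat l) * \<phi> (Poly_Mapping.single (x, []) k)" using l by (simp add: \<phi>_def q)
    moreover have "nat l \<ge> 1" using l by simp
    ultimately show "\<exists>y\<in>carrier P. \<exists>n::nat. n \<ge> 1 \<and> q = 1 / of_nat n * \<phi> y" by blast
  qed
  have "Q_ring \<simeq> matrix_ring 1 Q_ring"
    using ring_iso_sym[OF ring_matrix_ring[OF ring_from_type_algebra] matrix_ring_1_iso[OF ring_from_type_algebra]] by simp
  then have *: "tensor_ring (P Quot Idl\<^bsub>P\<^esub> {}) Q_ring \<simeq> matrix_ring 1 Q_ring" using ring_iso_trans[OF iso] by blast
  have no: "\<not> (s \<in> S \<and> t \<in> S \<and> 2 < coxeter_matrix W s t)" for s t using cm by (auto simp: S)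
  have "I_ideal W S = Idl\<^bsub>P\<^esub> {}"
  proof -
    have "{loop_eval W S (C_poly (coxeter_matrix W s t)) s t | s t. s \<in> S \<and> t \<in> S \<and> 2 < coxeter_matrix W s t} = {}"
      using no by blast
    then show ?thesis by (simp only: I_ideal_def P_def)
  qed
  then show "R_hat W S \<simeq> matrix_ring 1 Q_ring" using * by (simp only: R_hat_def R_ring_def P_def)
  have "I_tilde_ideal W S = Idl\<^bsub>P\<^esub> {}"
  proof -
    have "{loop_eval W S (c_poly (coxeter_matrix W s t)) s t | s t.
         s \<in> S \<and> t \<in> S \<and> 2 < coxeter_matrix W s t \<and> odd (coxeter_matrix W s t)} = {}"
      "{y_edge W S s t \<otimes>\<^bsub>P_ring W S\<^esub> loop_eval W S (c_poly (coxeter_matrix W s t)) s t | s t.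
         s \<in> S \<and> t \<in> S \<and> 2 < coxeter_matrix W s t \<and> even (coxeter_matrix W s t)} = {}"
      using no by blast+
    then show ?thesis by (simp only: I_tilde_ideal_def P_def Un_empty_right)
  qed
  then show "R_tilde_hat W S \<simeq> matrix_ring 1 Q_ring" using * by (simp only: R_tilde_hat_def R_tilde_ring_def P_def)
qed

section \<open>The finite types\<close>

lemma simply_laced_iso:
  assumes "coxeter_tree S E a b side par dep W 3"
  shows "R_hat W S \<simeq> matrix_ring (card S) Q_ring" "R_tilde_hat W S \<simeq> matrix_ring (card S) Q_ring"
  using coxeter_tree.R_hat_iso[OF assms poly_quotient_rational(1) refl]
    coxeter_tree.R_tilde_hat_iso_odd[OF assms _ _ refl, of Q_ring "(*)" "\<lambda>p. poly p (of_int 1)"]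
    poly_quotient_rational(1) c_poly_eq_C_poly[of 3] by simp_all

lemma type_A_iso:
  assumes cs: "coxeter_system W S" and ty: "of_type W S (Type_A n)" and n: "n \<ge> 1"
  shows "R_hat W S \<simeq> matrix_ring (card S) Q_ring \<and> R_tilde_hat W S \<simeq> matrix_ring (card S) Q_ring"
proof (cases "n = 1")
  case True
  obtain s where "bij_betw s {1..1::nat} S" using ty True unfolding of_type_def by auto
  then have S: "S = {s 1}" by (simp add: bij_betw_def)
  from rank_one_iso[OF S coxeter_matrix_diag[OF cs]] show ?thesis using S by simp
next
  case False
  \<comment> \<open>The first edge of the chain is distinguished, and every later vertex has its
    predecessor as parent.\<close>
  have "\<exists>E a b side par dep. coxeter_tree S E a b side par dep W 3 \<and> card S = n \<and>
    card {v\<in>S. side v} = card {i\<in>{1..n}. i = 1} \<and> card {v\<in>S. \<not> side v} = card {i\<in>{1..n}. \<not> i = 1}"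
    by (rule coxeter_tree_of_type[OF cs ty, where ia = 1 and ib = 2 and p = "\<lambda>j. j - 1" and d = "\<lambda>j. j"])
      (use n False in auto)
  then obtain E a b side par dep where "coxeter_tree S E a b side par dep W 3" by blast
  from simply_laced_iso[OF this] show ?thesis by blast
qed

lemma type_D_iso:
  assumes cs: "coxeter_system W S" and ty: "of_type W S (Type_D n)" and n: "n \<ge> 4"
  shows "R_hat W S \<simeq> matrix_ring (card S) Q_ring \<and> R_tilde_hat W S \<simeq> matrix_ring (card S) Q_ring"
proof -
  have "\<exists>E a b side par dep. coxeter_tree S E a b side par dep W 3 \<and> card S = n \<and>
    card {v\<in>S. side v} = card {i\<in>{1..n}. i = 1} \<and> card {v\<in>S. \<not> side v} = card {i\<in>{1..n}. \<not> i = 1}"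
  \<comment> \<open>A chain rooted at its first edge, except that the last vertex hangs off n -
    2.\<close>
  proof (rule coxeter_tree_of_type[OF cs ty, where ia = 1 and ib = 2 and p = "\<lambda>j. if j < n then j - 1 else n - 2" and d = "\<lambda>j. j"])
    fix i j assume ij: "1 \<le> i" "i < j" "j \<le> n"
    then have "(j = i + 1 \<and> j < n \<or> i + 2 = n \<and> j = n) \<longleftrightarrow> i = 1 \<and> j = 2 \<or>
        (i \<noteq> 1 \<and> i \<noteq> 2 \<and> j = (if i < n then i - 1 else n - 2) \<or> j \<noteq> 1 \<and> j \<noteq> 2 \<and> i = (if j < n then j - 1 else n - 2))"
      using n by (cases "j < n") auto
    then show "type_entry (Type_D n) i j = (if i = 1 \<and> j = 2 then 3 else
        if i \<noteq> 1 \<and> i \<noteq> 2 \<and> j = (if i < n then i - 1 else n - 2) \<or> j \<noteq> 1 \<and> j \<noteq> 2 \<and> i = (if j < n then j - 1 else n - 2)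
        then 3 else 2)" unfolding type_entry.simps by presburger
  qed (use n in auto)
  then obtain E a b side par dep where "coxeter_tree S E a b side par dep W 3" by blast
  from simply_laced_iso[OF this] show ?thesis by blast
qed

lemma type_E_iso:
  assumes cs: "coxeter_system W S" and ty: "of_type W S (Type_E n)" and n: "n \<in> {6, 7, 8}"
  shows "R_hat W S \<simeq> matrix_ring (card S) Q_ring \<and> R_tilde_hat W S \<simeq> matrix_ring (card S) Q_ring"
proof -
  \<comment> \<open>The distinguished edge is {1, 3}. The branch vertex 2 has parent 4, so its depth
    is set to 5 to exceed that of its parent.\<close>
  have "\<exists>E a b side par dep. coxeter_tree S E a b side par dep W 3 \<and> card S = n \<and>
    card {v\<in>S. side v} = card {i\<in>{1..n}. i = 1} \<and> card {v\<in>S. \<not> side v} = card {i\<in>{1..n}. \<not> i = 1}"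
    by (rule coxeter_tree_of_type[OF cs ty, where ia = 1 and ib = 3 and p = "\<lambda>j. if j = 2 then 4 else j - 1"
          and d = "\<lambda>j. if j = 2 then 5 else j"]) (use n in auto)
  then obtain E a b side par dep where "coxeter_tree S E a b side par dep W 3" by blast
  from simply_laced_iso[OF this] show ?thesis by blast
qed

lemma label_4_iso:
  assumes "coxeter_tree S E a b side par dep W 4" "card {v\<in>S. side v} = n1" "card {v\<in>S. \<not> side v} = n2"
  shows "R_hat W S \<simeq> matrix_ring (card S) Q_ring"
    and "R_tilde_hat W S \<simeq> RDirProd (matrix_ring (card S) Q_ring) (RDirProd (matrix_ring n1 Q_ring) (matrix_ring n2 Q_ring))"
proof -
  show "R_hat W S \<simeq> matrix_ring (card S) Q_ring"
    by (rule coxeter_tree.R_hat_iso[OF assms(1) poly_quotient_rational(2) refl])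
  have "c_poly 4 = C_poly 4" by (rule c_poly_eq_C_poly) simp
  with poly_quotient_rational(2) have "poly_quotient (c_poly 4) Q_ring (*) (\<lambda>p. poly p (of_int 2))" by simp
  then show "R_tilde_hat W S \<simeq> RDirProd (matrix_ring (card S) Q_ring) (RDirProd (matrix_ring n1 Q_ring) (matrix_ring n2 Q_ring))"
    by (intro coxeter_tree.R_tilde_hat_iso_even[OF assms(1)] assms(2,3)) simp_all
qed

lemma RDirProd_cong:
  assumes "R \<simeq> R'" "S \<simeq> S'"
  shows "RDirProd R S \<simeq> RDirProd R' S'"
proof -
  obtain f g where "f \<in> ring_iso R R'" "g \<in> ring_iso S S'" using assms by (auto simp: is_ring_iso_def)
  from RDirProd_iso6[OF this] show ?thesis by (auto simp: is_ring_iso_def)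
qed

lemma ring_iso_refl: "R \<simeq> R"
proof -
  have "(\<lambda>x. x) \<in> ring_iso R R" by (auto simp: ring_iso_def Ring.ring_hom_def bij_betw_def)
  then show ?thesis by (auto simp: is_ring_iso_def)
qed

lemma matrix_ring_1_Q_iso: "matrix_ring 1 Q_ring \<simeq> Q_ring"
  using matrix_ring_1_iso[OF ring_from_type_algebra] by simp

text \<open>The edge labelled 4 is {n - 1, n}, and removing it leaves components with n - 1 vertices
  and one vertex. Parents increase the index towards that edge, so n - j serves as the
  depth.\<close>

lemma type_B_iso:
  assumes cs: "coxeter_system W S" and ty: "of_type W S (Type_B n)" and n: "n \<ge> 2"
  shows "R_hat W S \<simeq> matrix_ring (card S) Q_ring \<and>
    R_tilde_hat W S \<simeq> RDirProd (matrix_ring n Q_ring) (RDirProd (matrix_ring (n - 1) Q_ring) Q_ring)"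
proof -
  have "\<exists>E a b side par dep. coxeter_tree S E a b side par dep W 4 \<and> card S = n \<and>
    card {v\<in>S. side v} = card {i\<in>{1..n}. i < n} \<and> card {v\<in>S. \<not> side v} = card {i\<in>{1..n}. \<not> i < n}"
    by (rule coxeter_tree_of_type[OF cs ty, where ia = "n - 1" and ib = n and p = Suc and d = "\<lambda>j. n - j"])
      (use n in auto)
  moreover have "{i\<in>{1..n}. i < n} = {1..<n}" "{i\<in>{1..n}. \<not> i < n} = {n}" using n by auto
  ultimately obtain E a b side par dep where t: "coxeter_tree S E a b side par dep W 4" "card S = n"
    "card {v\<in>S. side v} = n - 1" "card {v\<in>S. \<not> side v} = 1" by auto
  have "RDirProd (matrix_ring n Q_ring) (RDirProd (matrix_ring (n - 1) Q_ring) (matrix_ring 1 Q_ring)) \<simeq>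
      RDirProd (matrix_ring n Q_ring) (RDirProd (matrix_ring (n - 1) Q_ring) Q_ring)"
    by (intro RDirProd_cong ring_iso_refl matrix_ring_1_Q_iso)
  then show ?thesis using label_4_iso[OF t(1,3,4)] ring_iso_trans t(2) by metis
qed

lemma type_F4_iso:
  assumes cs: "coxeter_system W S" and ty: "of_type W S Type_F4"
  shows "R_hat W S \<simeq> matrix_ring (card S) Q_ring \<and>
    R_tilde_hat W S \<simeq> RDirProd (matrix_ring 4 Q_ring) (RDirProd (matrix_ring 2 Q_ring) (matrix_ring 2 Q_ring))"
proof -
  \<comment> \<open>The middle edge {2, 3} has label 4; the end vertices 1 and 4 hang off it, one on
    each side, which gives two blocks of size 2.\<close>
  have "\<exists>E a b side par dep. coxeter_tree S E a b side par dep W 4 \<and> card S = 4 \<and>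
    card {v\<in>S. side v} = card {i\<in>{1..4::nat}. i \<le> 2} \<and> card {v\<in>S. \<not> side v} = card {i\<in>{1..4::nat}. \<not> i \<le> 2}"
    by (rule coxeter_tree_of_type[OF cs ty, where ia = 2 and ib = 3 and p = "\<lambda>j. if j = 1 then 2 else 3"
          and d = "\<lambda>j. if j = 1 \<or> j = 4 then 1 else 0"]) auto
  moreover have "{i\<in>{1..4::nat}. i \<le> 2} = {1, 2}" "{i\<in>{1..4::nat}. \<not> i \<le> 2} = {3, 4}" by auto
  ultimately obtain E a b side par dep where t: "coxeter_tree S E a b side par dep W 4" "card S = 4"
    "card {v\<in>S. side v} = 2" "card {v\<in>S. \<not> side v} = 2" by auto
  show ?thesis using label_4_iso[OF t(1,3,4)] t(2) by simp
qed

lemma type_H_iso: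
  assumes cs: "coxeter_system W S" and ty: "of_type W S (Type_H n)" and n: "n \<in> {3, 4}"
  shows "R_hat W S \<simeq> matrix_ring (card S) (Qn_ring 5) \<and> R_tilde_hat W S \<simeq> matrix_ring (card S) (Qn_ring 5)"
proof -
  \<comment> \<open>The same tree as in type B, with label 5 on the distinguished last edge.\<close>
  have "\<exists>E a b side par dep. coxeter_tree S E a b side par dep W 5 \<and> card S = n \<and>
    card {v\<in>S. side v} = card {i\<in>{1..n}. i < n} \<and> card {v\<in>S. \<not> side v} = card {i\<in>{1..n}. \<not> i < n}"
    by (rule coxeter_tree_of_type[OF cs ty, where ia = "n - 1" and ib = n and p = Suc and d = "\<lambda>j. n - j"])
      (use n in auto)
  then obtain E a b side par dep where t: "coxeter_tree S E a b side par dep W 5" by blast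
  obtain act \<kappa> where q: "poly_quotient (C_poly 5) (Qn_ring 5) act \<kappa>" using poly_quotient_C_poly[of 5] by auto
  have "c_poly 5 = C_poly 5" by (rule c_poly_eq_C_poly) simp
  with q have q': "poly_quotient (c_poly 5) (Qn_ring 5) act \<kappa>" by simp
  show ?thesis
    using coxeter_tree.R_hat_iso[OF t q refl] coxeter_tree.R_tilde_hat_iso_odd[OF t _ q' refl] by simp
qed

lemma type_I2_tree:
  assumes cs: "coxeter_system W S" and ty: "of_type W S (Type_I2 n)" and n: "n \<ge> 5"
  shows "\<exists>E a b side par dep. coxeter_tree S E a b side par dep W n \<and> card S = 2 \<and>
    card {v\<in>S. side v} = 1 \<and> card {v\<in>S. \<not> side v} = 1"
proof -
  \<comment> \<open>Both vertices belong to the distinguished edge, so the conditions on parents and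
    depths are void.\<close>
  have "\<exists>E a b side par dep. coxeter_tree S E a b side par dep W n \<and> card S = 2 \<and>
    card {v\<in>S. side v} = card {i\<in>{1..2::nat}. i = 1} \<and> card {v\<in>S. \<not> side v} = card {i\<in>{1..2::nat}. \<not> i = 1}"
    by (rule coxeter_tree_of_type[OF cs ty, where ia = 1 and ib = 2 and p = "\<lambda>j. j" and d = "\<lambda>j. j"])
      (use n in auto)
  moreover have "{i\<in>{1..2::nat}. i = 1} = {1}" "{i\<in>{1..2::nat}. \<not> i = 1} = {2}" by auto
  ultimately show ?thesis by simp
qed

text \<open>For n = 6 the polynomial is t - 3, so the coefficient field can be taken to be the
  rationals; this is type G2.\<close>

lemma type_I2_iso:
  assumes cs: "coxeter_system W S" and ty: "of_type W S (Type_I2 n)" and n: "n \<ge> 5"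
  shows "R_hat W S \<simeq> matrix_ring 2 (Qn_ring n)"
    and "n = 6 \<Longrightarrow> R_hat W S \<simeq> matrix_ring (card S) Q_ring"
    and "odd n \<Longrightarrow> R_tilde_hat W S \<simeq> matrix_ring 2 (Ln_ring n)"
    and "even n \<Longrightarrow> R_tilde_hat W S \<simeq> RDirProd (matrix_ring 2 (Ln_ring n)) (RDirProd Q_ring Q_ring)"
proof -
  obtain E a b side par dep where t: "coxeter_tree S E a b side par dep W n" "card S = 2"
    "card {v\<in>S. side v} = 1" "card {v\<in>S. \<not> side v} = 1" using type_I2_tree[OF assms] by blast
  obtain act \<kappa> where q: "poly_quotient (C_poly n) (Qn_ring n) act \<kappa>" using poly_quotient_C_poly[of n] n by auto
  obtain act' \<kappa>' where q': "poly_quotient (c_poly n) (Ln_ring n) act' \<kappa>'" using poly_quotient_c_poly[of n] n by auto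
  show "R_hat W S \<simeq> matrix_ring 2 (Qn_ring n)" by (rule coxeter_tree.R_hat_iso[OF t(1) q t(2)])
  show "R_hat W S \<simeq> matrix_ring (card S) Q_ring" if "n = 6"
    using coxeter_tree.R_hat_iso[OF t(1) _ refl] poly_quotient_rational(3) that by blast
  show "R_tilde_hat W S \<simeq> matrix_ring 2 (Ln_ring n)" if "odd n"
    by (rule coxeter_tree.R_tilde_hat_iso_odd[OF t(1) that q' t(2)])
  show "R_tilde_hat W S \<simeq> RDirProd (matrix_ring 2 (Ln_ring n)) (RDirProd Q_ring Q_ring)" if "even n"
  proof -
    have "RDirProd (matrix_ring 2 (Ln_ring n)) (RDirProd (matrix_ring 1 Q_ring) (matrix_ring 1 Q_ring)) \<simeq>
        RDirProd (matrix_ring 2 (Ln_ring n)) (RDirProd Q_ring Q_ring)"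
      by (intro RDirProd_cong ring_iso_refl matrix_ring_1_Q_iso)
    with coxeter_tree.R_tilde_hat_iso_even[OF t(1) that q' t(2-4)] show ?thesis by (rule ring_iso_trans)
  qed
qed

theorem theorem3p8:
  fixes W :: "('w, 'x) monoid_scheme" and S :: "'w set" and N :: nat
  assumes "coxeter_system W S"
    and "finite S" and "card S = N"
    and "finite (carrier W)"
    and "coxeter_irreducible W S"
  shows
    "(((\<exists>n\<ge>1. of_type W S (Type_A n)) \<or> (\<exists>n\<ge>2. of_type W S (Type_B n)) \<or>
       (\<exists>n\<ge>4. of_type W S (Type_D n)) \<or> (\<exists>n\<in>{6, 7, 8}. of_type W S (Type_E n)) \<or>
       of_type W S Type_F4 \<or> of_type W S Type_G2) \<longrightarrow>
        R_hat W S \<simeq> matrix_ring N Q_ring) \<and>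
     ((\<exists>n\<in>{3, 4}. of_type W S (Type_H n)) \<longrightarrow>
        R_hat W S \<simeq> matrix_ring N (Qn_ring 5)) \<and>
     (\<forall>n\<ge>5. n \<noteq> 6 \<and> of_type W S (Type_I2 n) \<longrightarrow>
        R_hat W S \<simeq> matrix_ring 2 (Qn_ring n)) \<and>

     (((\<exists>n\<ge>1. of_type W S (Type_A n)) \<or> (\<exists>n\<ge>4. of_type W S (Type_D n)) \<or>
       (\<exists>n\<in>{6, 7, 8}. of_type W S (Type_E n))) \<longrightarrow>
        R_tilde_hat W S \<simeq> matrix_ring N Q_ring) \<and>
     ((\<exists>n\<in>{3, 4}. of_type W S (Type_H n)) \<longrightarrow>
        R_tilde_hat W S \<simeq> matrix_ring N (Qn_ring 5)) \<and>
     (\<forall>n\<ge>5. odd n \<and> of_type W S (Type_I2 n) \<longrightarrow>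
        R_tilde_hat W S \<simeq> matrix_ring 2 (Ln_ring n)) \<and>
     (\<forall>n\<ge>6. even n \<and> of_type W S (Type_I2 n) \<longrightarrow>
        R_tilde_hat W S \<simeq> RDirProd (matrix_ring 2 (Ln_ring n)) (RDirProd Q_ring Q_ring)) \<and>
     (\<forall>n\<ge>2. of_type W S (Type_B n) \<longrightarrow>
        R_tilde_hat W S \<simeq>
          RDirProd (matrix_ring n Q_ring) (RDirProd (matrix_ring (n - 1) Q_ring) Q_ring)) \<and>
     (of_type W S Type_F4 \<longrightarrow>
        R_tilde_hat W S \<simeq>
          RDirProd (matrix_ring 4 Q_ring)
            (RDirProd (matrix_ring 2 Q_ring) (matrix_ring 2 Q_ring)))"
proof -
  note cs = assms(1) and N = assms(3)
  note A = type_A_iso[OF cs, unfolded N] and B = type_B_iso[OF cs, unfolded N] and D = type_D_iso[OF cs, unfolded N]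
    and E = type_E_iso[OF cs, unfolded N] and F4 = type_F4_iso[OF cs, unfolded N]
    and H = type_H_iso[OF cs, unfolded N] and I2 = type_I2_iso[OF cs, unfolded N]
  have G2: "R_hat W S \<simeq> matrix_ring N Q_ring" if "of_type W S Type_G2"
    by (rule I2(2)[OF that]) simp_all
  show ?thesis
  proof (intro conjI allI impI, goal_cases)
    case 1
    then show ?case using A B D E F4 G2 by blast
  next
    case 2
    then show ?case using H by blast
  next
    case (3 n)
    then show ?case using I2(1)[of n] by blast
  next
    case 4
    then show ?case using A D E by blast
  next
    case 5
    then show ?case using H by blast
  next
    case (6 n)
    then show ?case using I2(3)[of n] by blast
  next
    case (7 n)
    then show ?case using I2(4)[of n] by simp
  next
    case (8 n)
    then show ?case using B by blast
  next
    case 9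
    then show ?case using F4 by blast
  qed
qed

end
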